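(* Let $\mathcal{R}=\mathbb{C}[\partial]A\oplus\mathbb{C}[\partial]B$ be the rank two Lie conformal algebra of Type I, and let $V_{\alpha,\beta,\phi}=\mathbb{C}[\partial]v$ and $V_{\bar\alpha,\bar\beta,\bar\phi}=\mathbb{C}[\partial]\bar v$ be nontrivial finite irreducible $\mathcal{R}$-modules (with parameters $\delta_1,\delta_2$ and $\bar\delta_1,\bar\delta_2$ respectively). Consider extensions of $\mathcal{R}$-modules of the form $$0\longrightarrow V_{\alpha,\beta,\phi}\longrightarrow E\longrightarrow V_{\bar\alpha,\bar\beta,\bar\phi}\longrightarrow0 .\qquad(\ast)$$ Every such $E$ is, as a $\mathbb{C}[\partial]$-module, $\mathbb{C}[\partial]v\oplus\mathbb{C}[\partial]\bar v$ with $$A_\lambda v=\delta_1(\partial+\alpha\lambda+\beta)v,\quad B_\lambda v=\delta_2\phi(\lambda)v,$$ $$A_\lambda\bar v=\bar\delta_1(\partial+\bar\alpha\lambda+\bar\beta)\bar v+f(\partial,\lambda)v,\quad B_\lambda\bar v=\bar\delta_2\bar\phi(\lambda)\bar v+g(\partial,\lambda)v\qquad(\ast\ast)$$ for some $f,g\in\mathbb{C}[\partial,\lambda]$. Nontrivial extensions of the form $(\ast)$ exist only when $(\delta_1,\delta_2)=(\bar\delta_1,\bar\delta_2)$. Moreover, they are given (up to equivalence) by $(\ast\ast)$ with the following data: (1) $(\delta_1,\delta_2)=(\bar\delta_1,\bar\delta_2)=(1,0)$, $g=0$, $\beta=\bar\beta$, $\bar\alpha-\alpha\in\{0,1,2,3,4,5,6\}$,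 $\alpha,\bar\alpha\neq0$, and (i) $\bar\alpha=\alpha$, $f(\partial,\lambda)=s_0+s_1\lambda$, where $(s_0,s_1)\neq(0,0)$; (ii) $\bar\alpha-\alpha=2$, $f(\partial,\lambda)=s\lambda^2(2(\partial+\beta)+\lambda)$, where $s\neq0$; (iii) $\bar\alpha-\alpha=3$, $f(\partial,\lambda)=s(\partial+\beta)\lambda^2((\partial+\beta)+\lambda)$, where $s\neq0$; (iv) $\bar\alpha-\alpha=4$, $f(\partial,\lambda)=s\lambda^2\big(4(\partial+\beta)^3+6(\partial+\beta)^2\lambda-(\partial+\beta)\lambda^2+\alpha\lambda^3\big)$, where $s\neq0$; (v) $\bar\alpha=1$ and $\alpha=-4$, $f(\partial,\lambda)=s\big((\partial+\beta)^4\lambda^2-10(\partial+\beta)^2\lambda^4-17(\partial+\beta)\lambda^5-8\lambda^6\big)$, where $s\neq0$; (vi) $\bar\alpha=\frac72\pm\frac{\sqrt{19}}2$ and $\alpha=-\frac52\pm\frac{\sqrt{19}}2$ (same sign), $f(\partial,\lambda)=s\big((\partial+\beta)^4\lambda^3-(2\alpha+3)(\partial+\beta)^3\lambda^4-3\alpha(\partial+\beta)^2\lambda^5-(3\alpha+1)(\partial+\beta)\lambda^6-(\alpha+\frac9{28})\lambda^7\big)$, where $s\neq0$. The value of $\dim\mathrm{Ext}(V_{\bar\alpha,\bar\beta,\bar\phi},V_{\alpha,\beta,\phi})$ is $2$ in subcase (i) and $1$ in subcases (ii)–(vi). (2) $(\delta_1,\delta_2)=(\bar\delta_1,\bar\delta_2)=(0,1)$,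 $\phi(\lambda)=\bar\phi(\lambda)$, $f(\partial,\lambda)=s(\lambda)$, $g(\partial,\lambda)=t(\lambda)$ with polynomials $s,t$, and either $s(\lambda)\neq0$ or $t(\lambda)$ is not a scalar multiple of $\lambda\phi(\lambda)$. Then the space $\mathrm{Ext}(V_{\bar\alpha,\bar\beta,\bar\phi},V_{\alpha,\beta,\phi})$ is infinite-dimensional.
   Context: Everything is over $\mathbb{C}$. A Lie conformal algebra $\mathcal{R}$ is a $\mathbb{C}[\partial]$-module with a $\mathbb{C}$-linear $\lambda$-bracket $\mathcal{R}\otimes\mathcal{R}\to\mathcal{R}[\lambda]$, $a\otimes b\mapsto[a_\lambda b]$, satisfying $[\partial a_\lambda b]=-\lambda[a_\lambda b]$, $[a_\lambda\partial b]=(\partial+\lambda)[a_\lambda b]$, $[a_\lambda b]=-[b_{-\lambda-\partial}a]$ and $[a_\lambda[b_\mu c]]=[[a_\lambda b]_{\lambda+\mu}c]+[b_\mu[a_\lambda c]]$. A conformal $\mathcal{R}$-module $V$ is a $\mathbb{C}[\partial]$-module with a $\mathbb{C}$-linear map $\mathcal{R}\otimes V\to V[\lambda]$, $a\otimes v\mapsto a_\lambda v$, satisfying $(\partial a)_\lambda v=-\lambda(a_\lambda v)$, $a_\lambda(\partial v)=(\partial+\lambda)a_\lambda v$, $a_\lambda(b_\mu v)=[a_\lambda b]_{\lambda+\mu}v+b_\mu(a_\lambda v)$. An extension of $W$ by $V$ is an exact sequence of modules $0\to V\to E\to W\to0$. Two extensions $E,E'$ are equivalent if there is a module homomorphism $E\to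 E'$ compatible with the identity maps of $V$ and $W$. An extension is trivial if it is equivalent to $V\oplus W$. $\mathrm{Ext}(W,V)$ is the vector space of extension cocycles modulo those equivalent to the trivial extension, and $\dim\mathrm{Ext}(W,V)$ is its dimension. The Lie conformal algebra of Type I is the direct sum of the Virasoro conformal algebra and a rank one commutative one: it has free basis $\{A,B\}$ over $\mathbb{C}[\partial]$ with $[A_\lambda A]=(\partial+2\lambda)A$, $[A_\lambda B]=0$, $[B_\lambda B]=0$. Its nontrivial finite irreducible modules are $V_{\alpha,\beta,\phi}=\mathbb{C}[\partial]v$ (free of rank one) with $A_\lambda v=\delta_1(\partial+\alpha\lambda+\beta)v$, $B_\lambda v=\delta_2\phi(\lambda)v$, where $\delta_1,\delta_2\in\{0,1\}$, $\delta_1^2+\delta_2^2=1$, $\beta\in\mathbb{C}$, $0\neq\alpha\in\mathbb{C}$, and $\phi\in\mathbb{C}[\lambda]$ is a nonzero polynomial; $V_{\bar\alpha,\bar\beta,\bar\phi}$ is defined in the same way with barred parameters.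
   Formalization: In case (2), the data are claimed to be realized by extensions only for s(λ)=0: when δ₁=δ̄₁=0, the relation [A_λ A]=(∂+2λ)A forces f=0, so no extension with s(λ)≠0 exists. *)

theory Defs
  imports
    Complex_Main
    "HOL-Computational_Algebra.Polynomial"
    "HOL-Library.Function_Algebras"
    "HOL-Library.Product_Plus"
begin

section \<open>Lie conformal algebras and conformal modules\<close>

text \<open>
  A \<open>\<complex>[\<partial>]\<close>-module structure on an abelian group \<open>'v\<close> is a scalar multiplication
  \<open>complex poly \<Rightarrow> 'v \<Rightarrow> 'v\<close> satisfying the library's \<^locale>\<open>module\<close>; the element \<open>\<partial>\<close> is
  \<open>[:0, 1:]\<close>, and restricting to constants \<open>[:k:]\<close> gives the complex vector space structure.
  The space \<open>V[\<lambda>]\<close> is \<open>'v poly\<close>, so \<open>pCons 0\<close> is multiplication by \<open>\<lambda>\<close>.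
\<close>

abbreviation (input) der :: "complex poly"
  where "der \<equiv> [:0, 1:]"

text \<open>
  \<open>subst_lambda S p q\<close> is the value of \<open>p \<in> V[\<lambda>]\<close> at \<open>\<lambda> = q \<in> \<complex>[\<partial>]\<close>, the powers of \<open>q\<close> acting
  on the coefficients from the left.  With \<open>q = [:l:]\<close> this is evaluation at the complex number
  \<open>l\<close>; with \<open>q = [:-l, -1:]\<close> it is the substitution of \<open>- l - \<partial>\<close>.
\<close>

definition subst_lambda :: "(complex poly \<Rightarrow> 'v \<Rightarrow> 'v) \<Rightarrow> 'v::ab_group_add poly \<Rightarrow> complex poly \<Rightarrow> 'v"
  where "subst_lambda S p q = (\<Sum>i\<le>degree p. S (q ^ i) (coeff p i))"

record (overloaded) 'r lca =
  scal :: "complex poly \<Rightarrow> 'r \<Rightarrow> 'r"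
  bracket :: "'r \<Rightarrow> 'r \<Rightarrow> 'r::zero poly"

record (overloaded) ('r, 'v) cmod =
  mscal :: "complex poly \<Rightarrow> 'v \<Rightarrow> 'v"
  act :: "'r \<Rightarrow> 'v \<Rightarrow> 'v::zero poly"

text \<open>
  Skew-symmetry and the Jacobi identities below are identities between polynomials in \<open>\<lambda>\<close>,
  respectively in \<open>\<lambda>\<close> and \<open>\<mu>\<close>, with coefficients in a complex vector space.  Such polynomials
  are determined by their values, so the identities are stated for all complex values
  \<open>l\<close>, \<open>m\<close> of \<open>\<lambda>\<close>, \<open>\<mu>\<close>.
\<close>

locale lie_conformal_algebra =
  fixes R :: "'r::ab_group_add lca"
  assumes module_scal: "module (scal R)"
    and bracket_add_left: "bracket R (a + b) c = bracket R a c + bracket R b c"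
    and bracket_add_right: "bracket R a (b + c) = bracket R a b + bracket R a c"
    and bracket_scale_left:
      "bracket R (scal R [:k:] a) b = map_poly (scal R [:k:]) (bracket R a b)"
    and bracket_scale_right:
      "bracket R a (scal R [:k:] b) = map_poly (scal R [:k:]) (bracket R a b)"
    and bracket_der_left: "bracket R (scal R der a) b = - pCons 0 (bracket R a b)"
    and bracket_der_right:
      "bracket R a (scal R der b) = map_poly (scal R der) (bracket R a b) + pCons 0 (bracket R a b)"
    and skew_symmetry:
      "subst_lambda (scal R) (bracket R a b) [:l:]
         = - subst_lambda (scal R) (bracket R b a) [:-l, -1:]"
    and jacobi:
      "subst_lambda (scal R) (bracket R a (subst_lambda (scal R) (bracket R b c) [:m:])) [:l:]
         = subst_lambda (scal R)
             (bracket R (subst_lambda (scal R) (bracket R a b) [:l:]) c) [:l + m:]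
         + subst_lambda (scal R) (bracket R b (subst_lambda (scal R) (bracket R a c) [:l:])) [:m:]"

locale conformal_module =
  fixes R :: "'r::ab_group_add lca" and V :: "('r, 'v::ab_group_add) cmod"
  assumes lca: "lie_conformal_algebra R"
    and module_mscal: "module (mscal V)"
    and act_add_left: "act V (a + b) v = act V a v + act V b v"
    and act_add_right: "act V a (v + w) = act V a v + act V a w"
    and act_scale_left: "act V (scal R [:k:] a) v = map_poly (mscal V [:k:]) (act V a v)"
    and act_scale_right: "act V a (mscal V [:k:] v) = map_poly (mscal V [:k:]) (act V a v)"
    and act_der_left: "act V (scal R der a) v = - pCons 0 (act V a v)"
    and act_der_right:
      "act V a (mscal V der v) = map_poly (mscal V der) (act V a v) + pCons 0 (act V a v)"
    and act_jacobi:
      "subst_lambda (mscal V) (act V a (subst_lambda (mscal V) (act V b v) [:m:])) [:l:]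
         = subst_lambda (mscal V)
             (act V (subst_lambda (scal R) (bracket R a b) [:l:]) v) [:l + m:]
         + subst_lambda (mscal V) (act V b (subst_lambda (mscal V) (act V a v) [:l:])) [:m:]"

definition cmod_hom :: "('r, 'v::ab_group_add) cmod \<Rightarrow> ('r, 'w::ab_group_add) cmod \<Rightarrow> ('v \<Rightarrow> 'w) \<Rightarrow> bool"
  where "cmod_hom V W h \<longleftrightarrow>
    module_hom (mscal V) (mscal W) h \<and> (\<forall>a v. act W a (h v) = map_poly h (act V a v))"

section \<open>Extensions\<close>

text \<open>\<open>0 \<rightarrow> V \<rightarrow> E \<rightarrow> W \<rightarrow> 0\<close> with maps \<open>i\<close> and \<open>p\<close>.\<close>

definition extension ::
  "'r::ab_group_add lca \<Rightarrow> ('r, 'v::ab_group_add) cmod \<Rightarrow> ('r, 'w::ab_group_add) cmod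
    \<Rightarrow> ('r, 'e::ab_group_add) cmod \<Rightarrow> ('v \<Rightarrow> 'e) \<Rightarrow> ('e \<Rightarrow> 'w) \<Rightarrow> bool"
  where "extension R V W E i p \<longleftrightarrow>
    conformal_module R V \<and> conformal_module R W \<and> conformal_module R E \<and>
    cmod_hom V E i \<and> cmod_hom E W p \<and>
    inj i \<and> surj p \<and> range i = {x. p x = 0}"

definition equivalent_ext ::
  "('r, 'e::ab_group_add) cmod \<Rightarrow> ('v \<Rightarrow> 'e) \<Rightarrow> ('e \<Rightarrow> 'w)
    \<Rightarrow> ('r, 'e'::ab_group_add) cmod \<Rightarrow> ('v \<Rightarrow> 'e') \<Rightarrow> ('e' \<Rightarrow> 'w) \<Rightarrow> bool"
  where "equivalent_ext E i p E' i' p' \<longleftrightarrow>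
    (\<exists>h. cmod_hom E E' h \<and> (\<forall>v. h (i v) = i' v) \<and> (\<forall>x. p' (h x) = p x))"

text \<open>
  The \<open>\<complex>[\<partial>]\<close>-module \<open>V \<oplus> W\<close> with action \<open>a\<^sub>\<lambda>(v, w) = (a\<^sub>\<lambda>v + c\<^sub>\<lambda>(a, w), a\<^sub>\<lambda>w)\<close>.
\<close>

definition twisted_sum ::
  "('r, 'v::ab_group_add) cmod \<Rightarrow> ('r, 'w::ab_group_add) cmod \<Rightarrow> ('r \<Rightarrow> 'w \<Rightarrow> 'v poly)
    \<Rightarrow> ('r, 'v \<times> 'w) cmod"
  where "twisted_sum V W c =
    \<lparr>mscal = (\<lambda>k (v, w). (mscal V k v, mscal W k w)),
     act = (\<lambda>a (v, w). map_poly (\<lambda>x. (x, 0)) (act V a v + c a w)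
                     + map_poly (\<lambda>y. (0, y)) (act W a w))\<rparr>"

definition direct_sum ::
  "('r, 'v::ab_group_add) cmod \<Rightarrow> ('r, 'w::ab_group_add) cmod \<Rightarrow> ('r, 'v \<times> 'w) cmod"
  where "direct_sum V W = twisted_sum V W (\<lambda>_ _. 0)"

definition trivial_ext ::
  "('r, 'v::ab_group_add) cmod \<Rightarrow> ('r, 'w::ab_group_add) cmod
    \<Rightarrow> ('r, 'e::ab_group_add) cmod \<Rightarrow> ('v \<Rightarrow> 'e) \<Rightarrow> ('e \<Rightarrow> 'w) \<Rightarrow> bool"
  where "trivial_ext V W E i p \<longleftrightarrow> equivalent_ext E i p (direct_sum V W) (\<lambda>v. (v, 0)) snd"

section \<open>The space Ext(W, V)\<close>

text \<open>
  For a fixed decomposition \<open>V \<oplus> W\<close> over \<open>\<complex>[\<partial>]\<close> (available for every extension when \<open>W\<close> is free),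
  an extension is the same as a map \<open>c\<close> making \<open>twisted_sum V W c\<close> a conformal module.
\<close>

definition ext_cocycles ::
  "'r::ab_group_add lca \<Rightarrow> ('r, 'v::ab_group_add) cmod \<Rightarrow> ('r, 'w::ab_group_add) cmod
    \<Rightarrow> ('r \<Rightarrow> 'w \<Rightarrow> 'v poly) set"
  where "ext_cocycles R V W = {c. conformal_module R (twisted_sum V W c)}"

definition trivial_cocycles ::
  "'r::ab_group_add lca \<Rightarrow> ('r, 'v::ab_group_add) cmod \<Rightarrow> ('r, 'w::ab_group_add) cmod
    \<Rightarrow> ('r \<Rightarrow> 'w \<Rightarrow> 'v poly) set"
  where "trivial_cocycles R V W =
    {c \<in> ext_cocycles R V W. trivial_ext V W (twisted_sum V W c) (\<lambda>v. (v, 0)) snd}"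

definition cocycle_scale ::
  "('r, 'v::ab_group_add) cmod \<Rightarrow> complex \<Rightarrow> ('r \<Rightarrow> 'w \<Rightarrow> 'v poly) \<Rightarrow> ('r \<Rightarrow> 'w \<Rightarrow> 'v poly)"
  where "cocycle_scale V k c = (\<lambda>a w. map_poly (mscal V [:k:]) (c a w))"

text \<open>
  For complex subspaces \<open>B \<subseteq> Z\<close>, a finite \<open>S \<subseteq> Z\<close> whose classes are linearly independent in,
  respectively span, the quotient space \<open>Z / B\<close>.
\<close>

definition independent_mod :: "(complex \<Rightarrow> 'c \<Rightarrow> 'c) \<Rightarrow> 'c::ab_group_add set \<Rightarrow> 'c set \<Rightarrow> bool"
  where "independent_mod sc B S \<longleftrightarrow>
    (\<forall>k. (\<Sum>x\<in>S. sc (k x) x) \<in> B \<longrightarrow> (\<forall>x\<in>S. k x = 0))"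

definition spanning_mod :: "(complex \<Rightarrow> 'c \<Rightarrow> 'c) \<Rightarrow> 'c::ab_group_add set \<Rightarrow> 'c set \<Rightarrow> 'c set \<Rightarrow> bool"
  where "spanning_mod sc Z B S \<longleftrightarrow> (\<forall>z\<in>Z. \<exists>k. z - (\<Sum>x\<in>S. sc (k x) x) \<in> B)"

definition dim_Ext_eq ::
  "'r::ab_group_add lca \<Rightarrow> ('r, 'w::ab_group_add) cmod \<Rightarrow> ('r, 'v::ab_group_add) cmod \<Rightarrow> nat \<Rightarrow> bool"
  where "dim_Ext_eq R W V n \<longleftrightarrow>
    (\<exists>S. finite S \<and> card S = n \<and> S \<subseteq> ext_cocycles R V W \<and>
       independent_mod (cocycle_scale V) (trivial_cocycles R V W) S \<and>
       spanning_mod (cocycle_scale V) (ext_cocycles R V W) (trivial_cocycles R V W) S)"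

definition infinite_dim_Ext ::
  "'r::ab_group_add lca \<Rightarrow> ('r, 'w::ab_group_add) cmod \<Rightarrow> ('r, 'v::ab_group_add) cmod \<Rightarrow> bool"
  where "infinite_dim_Ext R W V \<longleftrightarrow>
    \<not> (\<exists>S. finite S \<and> S \<subseteq> ext_cocycles R V W \<and>
       spanning_mod (cocycle_scale V) (ext_cocycles R V W) (trivial_cocycles R V W) S)"

section \<open>Type I and its rank one modules\<close>

definition free_basis :: "(complex poly \<Rightarrow> 'v \<Rightarrow> 'v) \<Rightarrow> 'v::ab_group_add list \<Rightarrow> bool"
  where "free_basis S xs \<longleftrightarrow>
    distinct xs \<and> \<not> module.dependent S (set xs) \<and> module.span S (set xs) = UNIV"

definition type_I :: "'r::ab_group_add lca \<Rightarrow> 'r \<Rightarrow> 'r \<Rightarrow> bool"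
  where "type_I R A B \<longleftrightarrow>
    lie_conformal_algebra R \<and> free_basis (scal R) [A, B] \<and>
    bracket R A A = [:scal R der A, scal R 2 A:] \<and> bracket R A B = 0 \<and> bracket R B B = 0"

text \<open>
  \<open>\<complex>[\<partial>, \<lambda>]\<close> is \<open>complex poly poly\<close> with outer variable \<open>\<lambda>\<close> and inner variable \<open>\<partial>\<close>;
  \<open>papply S F v\<close> is \<open>F(\<partial>, \<lambda>)v \<in> V[\<lambda>]\<close>.
\<close>

definition papply :: "(complex poly \<Rightarrow> 'v \<Rightarrow> 'v) \<Rightarrow> complex poly poly \<Rightarrow> 'v::zero \<Rightarrow> 'v poly"
  where "papply S F v = map_poly (\<lambda>q. S q v) F"

abbreviation cst :: "complex \<Rightarrow> complex poly poly"
  where "cst k \<equiv> [:[:k:]:]"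

abbreviation lam :: "complex poly poly"
  where "lam \<equiv> [:0, 1:]"

abbreviation der_plus :: "complex \<Rightarrow> complex poly poly"
  where "der_plus b \<equiv> [:[:b, 1:]:]"

definition lam_poly :: "complex poly \<Rightarrow> complex poly poly"
  where "lam_poly s = map_poly (\<lambda>k. [:k:]) s"

definition symbolA :: "complex \<Rightarrow> complex \<Rightarrow> complex \<Rightarrow> complex poly poly"
  where "symbolA d \<alpha> \<beta> = cst d * (der_plus \<beta> + cst \<alpha> * lam)"

definition symbolB :: "complex \<Rightarrow> complex poly \<Rightarrow> complex poly poly"
  where "symbolB d \<phi> = cst d * lam_poly \<phi>"

text \<open>\<open>V\<close> is the nontrivial irreducible module \<open>V\<^bsub>\<alpha>,\<beta>,\<phi>\<^esub> = \<complex>[\<partial>]v\<close> with parameters \<open>d1\<close>, \<open>d2\<close>.\<close>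

definition irreducible_rank_one ::
  "'r::ab_group_add lca \<Rightarrow> 'r \<Rightarrow> 'r \<Rightarrow> ('r, 'v::ab_group_add) cmod \<Rightarrow> 'v
    \<Rightarrow> complex \<Rightarrow> complex \<Rightarrow> complex \<Rightarrow> complex \<Rightarrow> complex poly \<Rightarrow> bool"
  where "irreducible_rank_one R A B V v d1 d2 \<alpha> \<beta> \<phi> \<longleftrightarrow>
    d1 \<in> {0, 1} \<and> d2 \<in> {0, 1} \<and> d1\<^sup>2 + d2\<^sup>2 = 1 \<and> \<alpha> \<noteq> 0 \<and> \<phi> \<noteq> 0 \<and>
    conformal_module R V \<and> free_basis (mscal V) [v] \<and>
    act V A v = papply (mscal V) (symbolA d1 \<alpha> \<beta>) v \<and>
    act V B v = papply (mscal V) (symbolB d2 \<phi>) v"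

section \<open>The data of the classification\<close>

text \<open>
  \<open>E\<close> is \<open>\<complex>[\<partial>]x \<oplus> \<complex>[\<partial>]y\<close>, where \<open>x\<close>, \<open>y\<close> play the roles of \<open>v\<close> and of a lift of the
  generator of the quotient, and \<open>A\<close>, \<open>B\<close> act on \<open>x\<close> with the parameters \<open>d1\<close>, ..., \<open>\<phi>\<close> and
  on \<open>y\<close> with the parameters \<open>d1'\<close>, ..., \<open>\<phi>'\<close> up to the terms \<open>f(\<partial>, \<lambda>)x\<close> and \<open>g(\<partial>, \<lambda>)x\<close>.
\<close>

definition star_form ::
  "'r \<Rightarrow> 'r \<Rightarrow> ('r, 'e::ab_group_add) cmod \<Rightarrow> 'e \<Rightarrow> 'e
    \<Rightarrow> complex \<Rightarrow> complex \<Rightarrow> complex \<Rightarrow> complex \<Rightarrow> complex poly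
    \<Rightarrow> complex \<Rightarrow> complex \<Rightarrow> complex \<Rightarrow> complex \<Rightarrow> complex poly
    \<Rightarrow> complex poly poly \<Rightarrow> complex poly poly \<Rightarrow> bool"
  where "star_form A B E x y d1 d2 \<alpha> \<beta> \<phi> d1' d2' \<alpha>' \<beta>' \<phi>' f g \<longleftrightarrow>
    free_basis (mscal E) [x, y] \<and>
    act E A x = papply (mscal E) (symbolA d1 \<alpha> \<beta>) x \<and>
    act E B x = papply (mscal E) (symbolB d2 \<phi>) x \<and>
    act E A y = papply (mscal E) (symbolA d1' \<alpha>' \<beta>') y + papply (mscal E) f x \<and>
    act E B y = papply (mscal E) (symbolB d2' \<phi>') y + papply (mscal E) g x"

definition subcase_vi :: "complex \<Rightarrow> complex \<Rightarrow> bool"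
  where "subcase_vi \<alpha> \<alpha>' \<longleftrightarrow>
    (\<exists>e\<in>{1, -1}. \<alpha>' = 7/2 + e * complex_of_real (sqrt 19) / 2 \<and>
                 \<alpha> = -5/2 + e * complex_of_real (sqrt 19) / 2)"

definition case_one_f :: "complex \<Rightarrow> complex \<Rightarrow> complex \<Rightarrow> complex poly poly \<Rightarrow> bool"
  where "case_one_f \<alpha> \<beta> \<alpha>' f \<longleftrightarrow>
    (let X = der_plus \<beta> in
      (\<alpha>' = \<alpha> \<and> (\<exists>s0 s1. (s0, s1) \<noteq> (0, 0) \<and> f = cst s0 + cst s1 * lam)) \<or>
      (\<alpha>' - \<alpha> = 2 \<and> (\<exists>s. s \<noteq> 0 \<and> f = cst s * lam^2 * (2 * X + lam))) \<or>
      (\<alpha>' - \<alpha> = 3 \<and> (\<exists>s. s \<noteq> 0 \<and> f = cst s * X * lam^2 * (X + lam))) \<or>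
      (\<alpha>' - \<alpha> = 4 \<and> (\<exists>s. s \<noteq> 0 \<and>
         f = cst s * lam^2 * (4 * X^3 + 6 * X^2 * lam - X * lam^2 + cst \<alpha> * lam^3))) \<or>
      (\<alpha>' = 1 \<and> \<alpha> = -4 \<and> (\<exists>s. s \<noteq> 0 \<and>
         f = cst s * (X^4 * lam^2 - 10 * X^2 * lam^4 - 17 * X * lam^5 - 8 * lam^6))) \<or>
      (subcase_vi \<alpha> \<alpha>' \<and> (\<exists>s. s \<noteq> 0 \<and>
         f = cst s * (X^4 * lam^3 - cst (2 * \<alpha> + 3) * X^3 * lam^4 - cst (3 * \<alpha>) * X^2 * lam^5
                - cst (3 * \<alpha> + 1) * X * lam^6 - cst (\<alpha> + 9/28) * lam^7))))"

definition case_one ::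
  "complex \<Rightarrow> complex \<Rightarrow> complex \<Rightarrow> complex
    \<Rightarrow> complex \<Rightarrow> complex \<Rightarrow> complex \<Rightarrow> complex
    \<Rightarrow> complex poly poly \<Rightarrow> complex poly poly \<Rightarrow> bool"
  where "case_one d1 d2 \<alpha> \<beta> d1' d2' \<alpha>' \<beta>' f g \<longleftrightarrow>
    (d1, d2) = (1, 0) \<and> (d1', d2') = (1, 0) \<and> g = 0 \<and> \<beta> = \<beta>' \<and>
    \<alpha>' - \<alpha> \<in> {0, 1, 2, 3, 4, 5, 6} \<and> \<alpha> \<noteq> 0 \<and> \<alpha>' \<noteq> 0 \<and> case_one_f \<alpha> \<beta> \<alpha>' f"

text \<open>
  The condition on \<open>s\<close> and \<open>t\<close> does not by itself make the action a module structure: the relation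
  \<open>[A\<^sub>\<lambda> A] = (\<partial> + 2\<lambda>)A\<close> forces \<open>s = 0\<close> when \<open>A\<close> acts as zero on \<open>V\<close> and on the quotient.
\<close>

definition case_two ::
  "complex \<Rightarrow> complex \<Rightarrow> complex poly \<Rightarrow> complex \<Rightarrow> complex \<Rightarrow> complex poly
    \<Rightarrow> complex poly poly \<Rightarrow> complex poly poly \<Rightarrow> bool"
  where "case_two d1 d2 \<phi> d1' d2' \<phi>' f g \<longleftrightarrow>
    (d1, d2) = (0, 1) \<and> (d1', d2') = (0, 1) \<and> \<phi> = \<phi>' \<and>
    (\<exists>s t. f = lam_poly s \<and> g = lam_poly t \<and>
       (s \<noteq> 0 \<or> \<not> (\<exists>k. t = smult k ([:0, 1:] * \<phi>))))"

end

theory Submission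
  imports Defs
begin

text \<open>
  Choose a lift \<open>y\<close> of the generator of the quotient.  An extension is then the pair \<open>(f, g)\<close> of
  polynomials by which \<open>A\<close> and \<open>B\<close> act on \<open>y\<close>, the Jacobi identity on generators is a system of
  polynomial equations for \<open>(f, g)\<close> (\<open>ext_cocycle\<close>), and replacing \<open>y\<close> by \<open>y + P(\<partial>)v\<close> changes
  \<open>(f, g)\<close> by an explicit coboundary (\<open>cob_poly\<close>).  This dictionary rests on evaluating all
  \<open>\<lambda>\<close>-actions at complex numbers: an action becomes a family of sesquilinear maps, so it is
  determined by generators and so is the Jacobi identity (\<open>conformal_module_iff\<close>,
  \<open>jacobi_from_generators\<close>, \<open>jacobi_iff_cocycle\<close>).  Equivalence of extensions becomes cohomology
  (\<open>cohomologous_if_equivalent\<close>, \<open>equivalent_if_cohomologous\<close>), and every polynomial cocycle comes from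
  an extension (\<open>cochain_exists\<close>, \<open>ext_cocycles_iff\<close>).  What remains is to find the polynomial
  cocycles modulo coboundaries (\<open>cocycle_normal_form\<close>, \<open>normal_form_not_coboundary\<close>).

  If \<open>B\<close> acts by different polynomials on the two modules, pick a number \<open>m\<close> at which they take
  different values \<open>a \<noteq> b\<close>.  The operator \<open>p(x) \<mapsto> a p(x + m) - b p(x)\<close> on polynomials is bijective.
  By surjectivity a coboundary makes \<open>g(x, m)\<close> vanish; the equation for \<open>[B, B] = 0\<close> with one variable
  set to \<open>m\<close> then gives \<open>g = 0\<close> by injectivity, and the one for \<open>[A, B] = 0\<close> gives \<open>f = 0\<close>
  (\<open>split_if_B_differs\<close>).  If both polynomials are \<open>\<phi> \<noteq> 0\<close>, then \<open>f = 0\<close>, and for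
  \<open>a = b \<noteq> 0\<close> and \<open>m \<noteq> 0\<close> the same operator is surjective with kernel the constants, so that \<open>g\<close>
  reduces to a polynomial in \<open>\<lambda>\<close> (\<open>normal_form_B_equal\<close>).

  If \<open>B\<close> acts by zero on both modules, then \<open>g = 0\<close> and \<open>f\<close> is a cocycle for the Virasoro conformal
  algebra.  For \<open>\<beta> \<noteq> \<beta>'\<close> the value of \<open>f\<close> at \<open>\<lambda> = 0\<close> provides a splitting.  For \<open>\<beta> = \<beta>'\<close> write
  \<open>f = \<Sum> c(k, i) X^k \<lambda>^i\<close> with \<open>X = \<partial> + \<beta>\<close>, put \<open>\<delta> = \<alpha>' - \<alpha>\<close> and compare coefficients.  The
  coefficients with \<open>i = 1\<close> can be removed by a coboundary (for \<open>\<delta> = 0\<close>, all but \<open>c(0, 1)\<close>), and then,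
  as in an Euler identity, only the total degree \<open>\<delta> + 1\<close> survives (\<open>vir_normalize\<close>).  So nothing is
  left unless \<open>\<delta>\<close> is a natural number, and for \<open>\<delta> = 0\<close> what is left is \<open>s0 + s1 \<lambda>\<close>.  For \<open>\<delta> > 0\<close> the
  equations form a recursion by which the two coefficients with \<open>i = 2\<close> and \<open>i = 3\<close> determine \<open>f\<close>
  (\<open>vir_cocycle_zeroI\<close>).  One direction in this plane is the coboundary of \<open>X^\<delta>\<close>, hence there is at
  most one class up to scalars, and none for \<open>\<delta> = 1\<close>, where there is no coefficient with \<open>i = 3\<close>.
  For \<open>\<delta> = 2, 3, 4\<close> the class exists.  For \<open>\<delta> \<ge> 5\<close> the recursion is overdetermined: a further
  equation forces the class to vanish unless \<open>Q = (\<delta> + 2\<alpha>)^2 - 5\<delta> - 4\<alpha>\<close> is zero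
  (\<open>obstruction_4_3\<close>), and for \<open>\<delta> \<ge> 7\<close> another one has the factor \<open>9\<delta>(\<delta> - 1)\<close> modulo \<open>Q\<close>
  (\<open>obstruction_5_4\<close>), so that nothing is left.  With \<open>\<alpha> \<noteq> 0\<close>, the equation \<open>Q = 0\<close> means
  \<open>\<alpha> = -4\<close> for \<open>\<delta> = 5\<close> and \<open>2\<alpha>^2 + 10\<alpha> + 3 = 0\<close> for \<open>\<delta> = 6\<close>, the two exceptional cases.
\<close>

section \<open>Polynomials in two and three variables as functions\<close>

text \<open>
  Polynomial identities below are stated and proved through values at complex numbers.  Here \<open>x\<close>
  stands for \<open>\<partial>\<close> and \<open>l\<close> for \<open>\<lambda>\<close>; in \<open>ev3\<close> the outermost variable is a second spectral parameter.
\<close>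

definition ev2 :: "complex poly poly \<Rightarrow> complex \<Rightarrow> complex \<Rightarrow> complex"
  where "ev2 f x l = poly (poly f [:l:]) x"

definition ev3 :: "complex poly poly poly \<Rightarrow> complex \<Rightarrow> complex \<Rightarrow> complex \<Rightarrow> complex"
  where "ev3 P x l m = ev2 (poly P [:[:m:]:]) x l"

lemma ev2_simps [simp]:
  "ev2 0 x l = 0" "ev2 1 x l = 1" "ev2 (f + g) x l = ev2 f x l + ev2 g x l"
  "ev2 (f - g) x l = ev2 f x l - ev2 g x l" "ev2 (- f) x l = - ev2 f x l"
  "ev2 (f * g) x l = ev2 f x l * ev2 g x l" "ev2 (f ^ n) x l = ev2 f x l ^ n"
  "ev2 (numeral k) x l = numeral k"
  "ev2 (pCons q f) x l = poly q x + l * ev2 f x l" "ev2 (smult q f) x l = poly q x * ev2 f x l"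
  by (simp_all add: ev2_def)

lemma ev2_sum: "ev2 (\<Sum>i\<in>S. f i) x l = (\<Sum>i\<in>S. ev2 (f i) x l)"
  by (induction S rule: infinite_finite_induct) simp_all

lemma infinite_const_poly: "infinite (range (\<lambda>l::'a::{field_char_0}. [:l:]))"
  using finite_imageD[of "\<lambda>l::'a. [:l:]" UNIV] infinite_UNIV_char_0 by (auto simp: inj_on_def)

lemma poly_const_zero_imp_zero:
  fixes f :: "'a::field_char_0 poly poly"
  assumes "\<And>l. poly f [:l:] = 0"
  shows "f = 0"
proof (rule ccontr)
  assume "f \<noteq> 0"
  then have "finite {x. poly f x = 0}" by (rule poly_roots_finite)
  moreover have "range (\<lambda>l. [:l:]) \<subseteq> {x. poly f x = 0}" using assms by auto
  ultimately show False using infinite_const_poly finite_subset by blast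
qed

lemma poly_evals_eqI: "(\<And>x. poly p x = poly q x) \<Longrightarrow> p = (q::complex poly)"
  using poly_eq_poly_eq_iff[of p q] by blast

lemma ev2_eqI:
  assumes "\<And>x l. ev2 f x l = ev2 g x l"
  shows "f = g"
proof -
  have "poly (f - g) [:l:] = 0" for l
  proof -
    have "poly (poly (f - g) [:l:]) x = 0" for x
      using assms[of x l] by (simp add: ev2_def)
    then show ?thesis using poly_all_0_iff_0 by blast
  qed
  then show ?thesis using poly_const_zero_imp_zero[of "f - g"] by simp
qed

lemma ev3_zero_imp_zero:
  assumes "\<And>x l m. ev3 P x l m = 0"
  shows "P = 0"
proof (rule ccontr)
  assume "P \<noteq> 0"
  then have "finite {x. poly P x = 0}" by (rule poly_roots_finite)
  moreover have "poly P [:[:m:]:] = 0" for m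
    using assms by (intro ev2_eqI) (simp add: ev3_def)
  then have "range (\<lambda>m. [:[:m:]:]) \<subseteq> {x. poly P x = 0}" by auto
  moreover have "infinite (range (\<lambda>m::complex. [:[:m:]:]))"
    using finite_imageD[of "\<lambda>m::complex. [:[:m:]:]" UNIV] infinite_UNIV_char_0
    by (auto simp: inj_on_def)
  ultimately show False using finite_subset by blast
qed

lemma ev3_simps [simp]:
  "ev3 0 x l m = 0" "ev3 (f + g) x l m = ev3 f x l m + ev3 g x l m"
  "ev3 (f - g) x l m = ev3 f x l m - ev3 g x l m"
  "ev3 (f * g) x l m = ev3 f x l m * ev3 g x l m"
  "ev3 (pCons q f) x l m = ev2 q x l + m * ev3 f x l m" "ev3 (smult q f) x l m = ev2 q x l * ev3 f x l m"
  by (simp_all add: ev3_def)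

section \<open>Reading off coefficients\<close>

text \<open>
  \<open>h k i j\<close> is the coefficient of \<open>x^k l^i m^j\<close> in the polynomial function \<open>H\<close>.  Carrying the
  coefficients next to the function makes it possible to compare coefficients in an identity of
  functions that involves shifts such as \<open>f(x + l, m)\<close>: the rules below follow the
  syntax of the function, and \<open>has_coeffs_unique\<close> equates the two results.
\<close>

definition has_coeffs ::
  "(complex \<Rightarrow> complex \<Rightarrow> complex \<Rightarrow> complex) \<Rightarrow> (nat \<Rightarrow> nat \<Rightarrow> nat \<Rightarrow> complex) \<Rightarrow> bool"
  where "has_coeffs H h \<longleftrightarrow>
    (\<exists>P. (\<forall>x l m. H x l m = ev3 P x l m) \<and> (\<forall>k i j. h k i j = coeff (coeff (coeff P j) i) k))"

lemma has_coeffs_unique: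
  assumes "has_coeffs H h" "has_coeffs H h'"
  shows "h = h'"
proof -
  obtain P where P: "\<And>x l m. H x l m = ev3 P x l m" "\<And>k i j. h k i j = coeff (coeff (coeff P j) i) k"
    using assms(1) by (auto simp: has_coeffs_def)
  obtain Q where Q: "\<And>x l m. H x l m = ev3 Q x l m" "\<And>k i j. h' k i j = coeff (coeff (coeff Q j) i) k"
    using assms(2) by (auto simp: has_coeffs_def)
  have "P - Q = 0" by (rule ev3_zero_imp_zero) (simp flip: P Q)
  then show ?thesis by (intro ext) (simp add: P Q)
qed

lemma has_coeffs_cong:
  assumes "has_coeffs H h" "\<And>x l m. H x l m = H' x l m" "\<And>a b c. h a b c = h' a b c"
  shows "has_coeffs H' h'"
  using assms unfolding has_coeffs_def by simp

lemma pascal: "0 < b \<Longrightarrow> Suc n choose b = (n choose b) + (n choose (b - 1))"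
  by (cases b) auto

lemma has_coeffs_add:
  "has_coeffs H h \<Longrightarrow> has_coeffs K k \<Longrightarrow>
   has_coeffs (\<lambda>x l m. H x l m + K x l m) (\<lambda>a b c. h a b c + k a b c)"
  unfolding has_coeffs_def by (metis coeff_add ev3_simps(2))

lemma has_coeffs_diff:
  "has_coeffs H h \<Longrightarrow> has_coeffs K k \<Longrightarrow>
   has_coeffs (\<lambda>x l m. H x l m - K x l m) (\<lambda>a b c. h a b c - k a b c)"
  unfolding has_coeffs_def by (metis coeff_diff ev3_simps(3))

lemma has_coeffs_const: "has_coeffs (\<lambda>x l m. z) (\<lambda>a b c. if a = 0 \<and> b = 0 \<and> c = 0 then z else 0)"
  unfolding has_coeffs_def
  by (rule exI[of _ "[:[:[:z:]:]:]"]) (auto simp: coeff_pCons split: nat.splits)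

lemma has_coeffs_mult:
  assumes "has_coeffs H h"
    and "\<And>P k i j. h' (\<lambda>k i j. coeff (coeff (coeff P j) i) k) k i j = coeff (coeff (coeff (Q * P) j) i) k"
  shows "has_coeffs (\<lambda>x l m. ev3 Q x l m * H x l m) (h' h)"
proof -
  obtain P where H: "\<And>x l m. H x l m = ev3 P x l m" and "\<And>k i j. h k i j = coeff (coeff (coeff P j) i) k"
    using assms(1) by (auto simp: has_coeffs_def)
  then have h: "h = (\<lambda>k i j. coeff (coeff (coeff P j) i) k)" by (intro ext)
  show ?thesis
    unfolding has_coeffs_def by (rule exI[of _ "Q * P"]) (simp add: H h assms(2))
qed

lemma has_coeffs_cmult:
  assumes "has_coeffs H h"
  shows "has_coeffs (\<lambda>x l m. z * H x l m) (\<lambda>a b c. z * h a b c)"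
  using has_coeffs_mult[OF assms, of "\<lambda>h a b c. z * h a b c" "[:[:[:z:]:]:]"] by simp

lemma has_coeffs_mult_x:
  assumes "has_coeffs H h"
  shows "has_coeffs (\<lambda>x l m. x * H x l m) (\<lambda>a b c. if a = 0 then 0 else h (a - 1) b c)"
  using has_coeffs_mult[OF assms, of "\<lambda>h a b c. if a = 0 then 0 else h (a - 1) b c" "[:[:[:0, 1:]:]:]"]
  by (simp add: coeff_pCons split: nat.splits)

lemma has_coeffs_mult_l:
  assumes "has_coeffs H h"
  shows "has_coeffs (\<lambda>x l m. l * H x l m) (\<lambda>a b c. if b = 0 then 0 else h a (b - 1) c)"
  using has_coeffs_mult[OF assms, of "\<lambda>h a b c. if b = 0 then 0 else h a (b - 1) c" "[:[:0, 1:]:]"]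
  by (simp add: coeff_pCons split: nat.splits)

lemma has_coeffs_mult_m:
  assumes "has_coeffs H h"
  shows "has_coeffs (\<lambda>x l m. m * H x l m) (\<lambda>a b c. if c = 0 then 0 else h a b (c - 1))"
  using has_coeffs_mult[OF assms, of "\<lambda>h a b c. if c = 0 then 0 else h a b (c - 1)" "[:0, 1:]"]
  by (simp add: coeff_pCons split: nat.splits)

lemma has_coeffs_swap:
  assumes "has_coeffs H h"
  shows "has_coeffs (\<lambda>x l m. H x m l) (\<lambda>a b c. h a c b)"
proof -
  have P1: "has_coeffs (\<lambda>x l m. poly q x) (\<lambda>a b c. if b = 0 \<and> c = 0 then coeff q a else 0)" for q
    unfolding has_coeffs_def
    by (rule exI[of _ "[:[:q:]:]"]) (auto simp: coeff_pCons split: nat.splits)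
  have P2: "has_coeffs (\<lambda>x l m. ev2 f x m) (\<lambda>a b c. if b = 0 then coeff (coeff f c) a else 0)" for f
  proof (induction f)
    case 0
    show ?case using has_coeffs_const[of 0] by (simp add: if_distrib cong: if_cong)
  next
    case (pCons q f)
    show ?case
      by (rule has_coeffs_cong[OF has_coeffs_add[OF P1[of q] has_coeffs_mult_m[OF pCons(2)]]])
        (auto simp: coeff_pCons split: nat.splits)
  qed
  have "has_coeffs (\<lambda>x l m. ev3 P x m l) (\<lambda>a b c. coeff (coeff (coeff P b) c) a)" for P
  proof (induction P)
    case 0
    show ?case using has_coeffs_const[of 0] by (simp add: if_distrib cong: if_cong)
  next
    case (pCons f P)
    show ?case
      by (rule has_coeffs_cong[OF has_coeffs_add[OF P2[of f] has_coeffs_mult_l[OF pCons(2)]]])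
        (auto simp: coeff_pCons split: nat.splits)
  qed
  moreover obtain P where P: "\<And>x l m. H x l m = ev3 P x l m" "\<And>k i j. h k i j = coeff (coeff (coeff P j) i) k"
    using assms by (auto simp: has_coeffs_def)
  ultimately show ?thesis by (simp add: P)
qed

lemma has_coeffs_ev2: "has_coeffs (\<lambda>x l m. ev2 f x l) (\<lambda>a b c. if c = 0 then coeff (coeff f b) a else 0)"
  unfolding has_coeffs_def
  by (rule exI[of _ "[:f:]"]) (auto simp: coeff_pCons split: nat.splits)

text \<open>
  Binomial coefficients enter through Pascal's rule: in the induction on \<open>q\<close>, multiplication by \<open>x + l\<close>
  adds two neighbouring coefficients.
\<close>

lemma has_coeffs_poly_shift:
  "has_coeffs (\<lambda>x l m. poly q (x + l)) (\<lambda>a b c. if c = 0 then of_nat ((a + b) choose b) * coeff q (a + b) else 0)"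
proof (induction q)
  case 0
  show ?case using has_coeffs_const[of 0] by (simp add: if_distrib cong: if_cong)
next
  case (pCons z q)
  show ?case
    by (rule has_coeffs_cong[OF has_coeffs_add[OF has_coeffs_const[of z]
          has_coeffs_add[OF has_coeffs_mult_x[OF pCons(2)] has_coeffs_mult_l[OF pCons(2)]]]])
      (auto simp: coeff_pCons algebra_simps pascal split: nat.splits)
qed

lemma has_coeffs_ev2_shift:
  "has_coeffs (\<lambda>x l m. ev2 f (x + l) m) (\<lambda>a b c. of_nat ((a + b) choose b) * coeff (coeff f c) (a + b))"
proof (induction f)
  case 0
  show ?case using has_coeffs_const[of 0] by (simp add: if_distrib cong: if_cong)
next
  case (pCons q f)
  show ?case
    by (rule has_coeffs_cong[OF has_coeffs_add[OF has_coeffs_poly_shift[of q] has_coeffs_mult_m[OF pCons(2)]]])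
      (auto simp: coeff_pCons split: nat.splits)
qed

lemma has_coeffs_ev2_sum:
  "has_coeffs (\<lambda>x l m. ev2 f x (l + m)) (\<lambda>a b c. of_nat ((b + c) choose b) * coeff (coeff f (b + c)) a)"
proof (induction f)
  case 0
  show ?case using has_coeffs_const[of 0] by (simp add: if_distrib cong: if_cong)
next
  case (pCons q f)
  have "has_coeffs (\<lambda>x l m. poly q x) (\<lambda>a b c. if b = 0 \<and> c = 0 then coeff q a else 0)"
    unfolding has_coeffs_def
    by (rule exI[of _ "[:[:q:]:]"]) (auto simp: coeff_pCons split: nat.splits)
  from has_coeffs_add[OF this has_coeffs_add[OF has_coeffs_mult_l[OF pCons(2)] has_coeffs_mult_m[OF pCons(2)]]]
  show ?case
    by (rule has_coeffs_cong) (auto simp: coeff_pCons algebra_simps pascal split: nat.splits)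
qed

section \<open>Coboundaries and the Virasoro cocycle equation\<close>

text \<open>
  \<open>p(\<partial> + \<lambda>)\<close>, which arises when an action is moved past \<open>p(\<partial>)\<close>.
\<close>

definition shift_poly :: "complex poly \<Rightarrow> complex poly poly"
  where "shift_poly p = pcompose (lam_poly p) [:[:0, 1:], 1:]"

lemma lam_poly_pCons [simp]: "lam_poly (pCons a p) = pCons [:a:] (lam_poly p)" "lam_poly 0 = 0"
  by (simp_all add: lam_poly_def map_poly_pCons)

lemma ev2_lam_poly [simp]: "ev2 (lam_poly p) x l = poly p l"
  by (induction p) simp_all

lemma ev2_shift_poly [simp]: "ev2 (shift_poly p) x l = poly p (x + l)"
  unfolding shift_poly_def by (induction p) (simp_all add: pcompose_pCons algebra_simps)

lemma ev2_symbols [simp]: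
  "ev2 (symbolA d \<alpha> \<beta>) x l = d * (x + \<alpha> * l + \<beta>)"
  "ev2 (symbolB d \<phi>) x l = d * poly \<phi> l"
  by (simp_all add: symbolA_def symbolB_def algebra_simps)

text \<open>
  If \<open>a\<close> acts on \<open>v\<close> by \<open>s\<close> and on the lift \<open>y\<close> by \<open>t\<close>, this is the amount by which its symbol changes
  when \<open>y\<close> is replaced by \<open>y + p(\<partial>)v\<close>.
\<close>

definition cob_poly :: "complex poly poly \<Rightarrow> complex poly poly \<Rightarrow> complex poly \<Rightarrow> complex poly poly"
  where "cob_poly s t p = s * shift_poly p - t * [:p:]"

lemma ev2_cob_poly [simp]: "ev2 (cob_poly s t p) x l = ev2 s x l * poly p (x + l) - ev2 t x l * poly p x"
  by (simp add: cob_poly_def)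

text \<open>
  The equation that \<open>[A\<^sub>\<lambda> A] = (\<partial> + 2\<lambda>)A\<close> imposes on \<open>f\<close> when \<open>A\<close> acts by \<open>x + \<alpha>\<lambda>\<close> and by
  \<open>x + \<alpha>'\<lambda>\<close>; the parameters \<open>\<beta> = \<beta>'\<close> have been absorbed into the variable \<open>x = \<partial> + \<beta>\<close>.
\<close>

definition vir_cocycle :: "complex \<Rightarrow> complex \<Rightarrow> (complex \<Rightarrow> complex \<Rightarrow> complex) \<Rightarrow> bool"
  where "vir_cocycle \<alpha> \<alpha>' F \<longleftrightarrow>
    (\<forall>x l m. (x + l + \<alpha>' * m) * F x l + (x + \<alpha> * l) * F (x + l) m
       - (x + m + \<alpha>' * l) * F x m - (x + \<alpha> * m) * F (x + m) l = (l - m) * F x (l + m))"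

definition vir_cob :: "complex \<Rightarrow> complex \<Rightarrow> complex poly \<Rightarrow> complex \<Rightarrow> complex \<Rightarrow> complex"
  where "vir_cob \<alpha> \<alpha>' p x l = (x + \<alpha> * l) * poly p (x + l) - (x + \<alpha>' * l) * poly p x"

definition vir_cob_poly :: "complex \<Rightarrow> complex \<Rightarrow> complex poly \<Rightarrow> complex poly poly"
  where "vir_cob_poly \<alpha> \<alpha>' p = cob_poly (symbolA 1 \<alpha> 0) (symbolA 1 \<alpha>' 0) p"

lemma ev2_vir_cob_poly [simp]: "ev2 (vir_cob_poly \<alpha> \<alpha>' p) = vir_cob \<alpha> \<alpha>' p"
  by (intro ext) (simp add: vir_cob_poly_def vir_cob_def algebra_simps)

lemma vir_cocycle_cob: "vir_cocycle \<alpha> \<alpha>' (vir_cob \<alpha> \<alpha>' p)"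
proof -
  have "(x + l + \<alpha>' * m) * ((x + \<alpha> * l) * pl - (x + \<alpha>' * l) * p0)
      + (x + \<alpha> * l) * ((x + l + \<alpha> * m) * plm - (x + l + \<alpha>' * m) * pl)
      - (x + m + \<alpha>' * l) * ((x + \<alpha> * m) * pm - (x + \<alpha>' * m) * p0)
      - (x + \<alpha> * m) * ((x + m + \<alpha> * l) * plm - (x + m + \<alpha>' * l) * pm)
      = (l - m) * ((x + \<alpha> * (l + m)) * plm - (x + \<alpha>' * (l + m)) * p0)"
    for x l m p0 pl pm plm :: complex
    by algebra
  from this[of _ _ _ "poly p (_ + _)" "poly p _" "poly p (_ + _ + _)" "poly p (_ + _)"]
  show ?thesis
    unfolding vir_cocycle_def vir_cob_def by (simp add: add_ac)
qed

lemma vir_cocycle_combine: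
  assumes "vir_cocycle \<alpha> \<alpha>' F" "vir_cocycle \<alpha> \<alpha>' G"
  shows "vir_cocycle \<alpha> \<alpha>' (\<lambda>x l. F x l + c * G x l)"
  unfolding vir_cocycle_def
proof (intro allI)
  fix x l m
  have F: "(x + l + \<alpha>' * m) * F x l + (x + \<alpha> * l) * F (x + l) m
       - (x + m + \<alpha>' * l) * F x m - (x + \<alpha> * m) * F (x + m) l = (l - m) * F x (l + m)"
    using assms(1) by (simp add: vir_cocycle_def)
  have G: "(x + l + \<alpha>' * m) * G x l + (x + \<alpha> * l) * G (x + l) m
       - (x + m + \<alpha>' * l) * G x m - (x + \<alpha> * m) * G (x + m) l = (l - m) * G x (l + m)"
    using assms(2) by (simp add: vir_cocycle_def)
  show "(x + l + \<alpha>' * m) * (F x l + c * G x l) + (x + \<alpha> * l) * (F (x + l) m + c * G (x + l) m)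
       - (x + m + \<alpha>' * l) * (F x m + c * G x m) - (x + \<alpha> * m) * (F (x + m) l + c * G (x + m) l)
       = (l - m) * (F x (l + m) + c * G x (l + m))"
    using F G by algebra
qed

lemma vir_cocycle_subtract_cob:
  assumes "vir_cocycle \<alpha> \<alpha>' (ev2 f)"
  shows "vir_cocycle \<alpha> \<alpha>' (ev2 (f - vir_cob_poly \<alpha> \<alpha>' p))"
proof -
  have "ev2 (f - vir_cob_poly \<alpha> \<alpha>' p) = (\<lambda>x l. ev2 f x l + (-1) * vir_cob \<alpha> \<alpha>' p x l)"
    by (intro ext) simp
  then show ?thesis
    using vir_cocycle_combine[OF assms vir_cocycle_cob[of \<alpha> \<alpha>' p], of "-1"] by simp
qed

text \<open>
  The coefficient of \<open>x^(n + 1 - i) l^i\<close> in \<open>(x + \<alpha>l)(x + l)^n\<close>, for \<open>i > 0\<close>.  For \<open>i > 1\<close> this is also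
  the coefficient of the coboundary of \<open>x^n\<close>.
\<close>

definition cob_coeff :: "complex \<Rightarrow> nat \<Rightarrow> nat \<Rightarrow> complex"
  where "cob_coeff \<alpha> n i = of_nat (n choose i) + \<alpha> * of_nat (n choose (i - 1))"

lemma cob_coeff_1 [simp]: "cob_coeff \<alpha> n 1 = of_nat n + \<alpha>" "cob_coeff \<alpha> n (Suc 0) = of_nat n + \<alpha>"
  by (simp_all add: cob_coeff_def)

lemma has_coeffs_vir_cob:
  "has_coeffs (\<lambda>x l m. vir_cob \<alpha> \<alpha>' p x l)
     (\<lambda>k i j. if j = 0 \<and> 0 < i then cob_coeff \<alpha> (k + i - 1) i * coeff p (k + i - 1)
        - (if i = 1 then \<alpha>' * coeff p k else 0) else 0)"
proof -
  have P: "has_coeffs (\<lambda>x l m. poly p x) (\<lambda>a b c. if b = 0 \<and> c = 0 then coeff p a else 0)"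
    unfolding has_coeffs_def
    by (rule exI[of _ "[:[:p:]:]"]) (auto simp: coeff_pCons split: nat.splits)
  note S = has_coeffs_poly_shift[of p]
  have "has_coeffs (\<lambda>x l m. (x * poly p (x + l) + \<alpha> * (l * poly p (x + l))) - (x * poly p x + \<alpha>' * (l * poly p x)))
     (\<lambda>k i j. if j = 0 \<and> 0 < i then cob_coeff \<alpha> (k + i - 1) i * coeff p (k + i - 1)
        - (if i = 1 then \<alpha>' * coeff p k else 0) else 0)"
    by (rule has_coeffs_cong[OF has_coeffs_diff[OF
           has_coeffs_add[OF has_coeffs_mult_x[OF S] has_coeffs_cmult[OF has_coeffs_mult_l[OF S]]]
           has_coeffs_add[OF has_coeffs_mult_x[OF P] has_coeffs_cmult[OF has_coeffs_mult_l[OF P]]]]])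
      (auto simp: cob_coeff_def algebra_simps)
  then show ?thesis
    by (rule has_coeffs_cong) (simp_all add: vir_cob_def algebra_simps)
qed

lemma coeff_vir_cob_poly:
  "0 < i \<Longrightarrow> coeff (coeff (vir_cob_poly \<alpha> \<alpha>' p) i) k
     = cob_coeff \<alpha> (k + i - 1) i * coeff p (k + i - 1) - (if i = 1 then \<alpha>' * coeff p k else 0)"
  using has_coeffs_unique[OF has_coeffs_ev2 has_coeffs_vir_cob[of \<alpha> \<alpha>' p, folded ev2_vir_cob_poly],
      THEN fun_cong[of _ _ k], THEN fun_cong[of _ _ i], THEN fun_cong[of _ _ 0]]
  by simp

lemma coeff_monom_cob:
  assumes "1 < i"
  shows "coeff (coeff (vir_cob_poly \<alpha> \<alpha>' (monom c n)) i) k = (if k + i = n + 1 then c * cob_coeff \<alpha> n i else 0)"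
  using assms by (auto simp: coeff_vir_cob_poly)

text \<open>
  The coefficient of \<open>x^k l^i m^j\<close> in the cocycle equation, for \<open>i > 0\<close> and \<open>j > 1\<close>.  All coefficients of \<open>f\<close> that
  occur have the same total degree \<open>k + i + j - 1\<close>, so the equations decouple by degree.
\<close>

lemma cocycle_coeffs:
  assumes "vir_cocycle \<alpha> \<alpha>' (ev2 f)" and "0 < i" "1 < j"
  shows "(if i = 1 then - \<alpha>' * coeff (coeff f j) k else 0)
       + cob_coeff \<alpha> (k + i - 1) i * coeff (coeff f j) (k + i - 1)
       - cob_coeff \<alpha> (k + j - 1) j * coeff (coeff f i) (k + j - 1)
      = (of_nat ((i + j - 1) choose j) - of_nat ((i + j - 1) choose i)) * coeff (coeff f (i + j - 1)) k"
proof -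
  note F = has_coeffs_ev2[of f] and F' = has_coeffs_swap[OF has_coeffs_ev2[of f]]
  note S = has_coeffs_ev2_shift[of f] and S' = has_coeffs_swap[OF has_coeffs_ev2_shift[of f]]
  note Q = has_coeffs_ev2_sum[of f]
  let ?L = "\<lambda>x l m. x * ev2 f x l + l * ev2 f x l + \<alpha>' * (m * ev2 f x l)
       + (x * ev2 f (x + l) m + \<alpha> * (l * ev2 f (x + l) m))
       - (x * ev2 f x m + m * ev2 f x m + \<alpha>' * (l * ev2 f x m))
       - (x * ev2 f (x + m) l + \<alpha> * (m * ev2 f (x + m) l))"
  let ?R = "\<lambda>x l m. l * ev2 f x (l + m) - m * ev2 f x (l + m)"
  have LR: "?L = ?R"
  proof (intro ext)
    fix x l m
    have "(x + l + \<alpha>' * m) * ev2 f x l + (x + \<alpha> * l) * ev2 f (x + l) m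
       - (x + m + \<alpha>' * l) * ev2 f x m - (x + \<alpha> * m) * ev2 f (x + m) l = (l - m) * ev2 f x (l + m)"
      using assms(1) unfolding vir_cocycle_def by blast
    then show "?L x l m = ?R x l m" by algebra
  qed
  note L = has_coeffs_diff[OF has_coeffs_diff[OF has_coeffs_add[OF
       has_coeffs_add[OF has_coeffs_add[OF has_coeffs_mult_x[OF F] has_coeffs_mult_l[OF F]] has_coeffs_cmult[OF has_coeffs_mult_m[OF F], of \<alpha>']]
       has_coeffs_add[OF has_coeffs_mult_x[OF S] has_coeffs_cmult[OF has_coeffs_mult_l[OF S], of \<alpha>]]]
       has_coeffs_add[OF has_coeffs_add[OF has_coeffs_mult_x[OF F'] has_coeffs_mult_m[OF F']] has_coeffs_cmult[OF has_coeffs_mult_l[OF F'], of \<alpha>']]]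
       has_coeffs_add[OF has_coeffs_mult_x[OF S'] has_coeffs_cmult[OF has_coeffs_mult_m[OF S'], of \<alpha>]]]
  note R = has_coeffs_diff[OF has_coeffs_mult_l[OF Q] has_coeffs_mult_m[OF Q]]
  have *: "(i + j - Suc 0) choose (i - Suc 0) = (i + j - Suc 0) choose j"
    using assms by (subst binomial_symmetric) auto
  have **: "i - Suc 0 + j = i + j - Suc 0" "i + (j - Suc 0) = i + j - Suc 0"
     "k + (i - Suc 0) = k + i - Suc 0"  "k + (j - Suc 0) = k + j - Suc 0" 
     "0 < k \<Longrightarrow> k - Suc 0 + i = k + i - Suc 0"  "0 < k \<Longrightarrow> k - Suc 0 + j = k + j - Suc 0"
    using assms by auto
  have ***: "(i - Suc 0) choose i = 0" "(j - Suc 0) choose j = 0"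
    using assms by auto
  from fun_cong[OF fun_cong[OF fun_cong[OF has_coeffs_unique[OF L R[folded LR]], of k], of i], of j]
  show ?thesis
    using assms by (cases "k = 0") (auto simp: cob_coeff_def * ** *** algebra_simps)
qed

text \<open>
  The case \<open>i = 1\<close> of the coefficient equations, an Euler identity: up to the contribution of the
  row \<open>\<lambda>^1\<close>, every coefficient of total degree other than \<open>\<alpha>' - \<alpha> + 1\<close> in a row \<open>\<lambda>^j\<close> with \<open>j > 1\<close>
  vanishes.
\<close>

lemma euler_row:
  assumes f: "vir_cocycle \<alpha> \<alpha>' (ev2 f)" and "1 < j"
  shows "(of_nat (k + j) - 1 + \<alpha> - \<alpha>') * coeff (coeff f j) k
       = cob_coeff \<alpha> (k + j - 1) j * coeff (coeff f 1) (k + j - 1)"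
  using cocycle_coeffs[OF f, of 1 j k] assms(2) by (simp add: algebra_simps)

text \<open>
  Putting \<open>l = 0\<close> in the cocycle equation shows that \<open>F = f(\<cdot>, 0)\<close> satisfies
  \<open>(x + \<alpha>m)F(x + m) = (x + \<alpha>'m)F(x)\<close>.  If \<open>\<alpha>' \<noteq> \<alpha>\<close>, choose \<open>m\<close> with \<open>x + \<alpha>m = 0\<close>; if \<open>\<alpha>' = \<alpha>\<close>, put \<open>x = 0\<close>.
\<close>

lemma zero_row:
  assumes f: "vir_cocycle \<alpha> \<alpha>' (ev2 f)" and \<alpha>: "\<alpha> \<noteq> 0"
  shows "\<alpha>' \<noteq> \<alpha> \<Longrightarrow> coeff f 0 = 0" and "\<alpha>' = \<alpha> \<Longrightarrow> \<exists>c. coeff f 0 = [:c:]"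
proof -
  have F: "(x + \<alpha> * m) * poly (coeff f 0) (x + m) = (x + \<alpha>' * m) * poly (coeff f 0) x" for x m
  proof -
    have "(x + 0 + \<alpha>' * m) * ev2 f x 0 + (x + \<alpha> * 0) * ev2 f (x + 0) m
       - (x + m + \<alpha>' * 0) * ev2 f x m - (x + \<alpha> * m) * ev2 f (x + m) 0 = (0 - m) * ev2 f x (0 + m)"
      using f unfolding vir_cocycle_def by blast
    moreover have "ev2 f y 0 = poly (coeff f 0) y" for y
      by (simp add: ev2_def poly_0_coeff_0)
    ultimately show ?thesis by (simp add: algebra_simps)
  qed
  show "coeff f 0 = 0" if "\<alpha>' \<noteq> \<alpha>"
  proof -
    let ?p = "[:0, 1:] * coeff f 0"
    \<comment> \<open>This argument only reaches \<open>x \<noteq> 0\<close>, hence the factor \<open>x\<close> in \<open>?p\<close>.\<close>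
    have "poly ?p x = 0" for x
      using F[of x "- x / \<alpha>"] \<alpha> that by (simp add: field_simps)
    then have "?p = 0" using poly_all_0_iff_0 by blast
    then show ?thesis by simp
  qed
  show "\<exists>c. coeff f 0 = [:c:]" if "\<alpha>' = \<alpha>"
  proof -
    let ?p = "[:0, 1:] * (coeff f 0 - [:poly (coeff f 0) 0:])"
    have "poly ?p x = 0" for x
      using F[of 0 x] \<alpha> that by (simp add: field_simps)
    then have "?p = 0" using poly_all_0_iff_0 by blast
    then have "coeff f 0 = [:poly (coeff f 0) 0:]" by simp
    then show ?thesis by blast
  qed
qed

text \<open>
  The case \<open>j = 2\<close> of the coefficient equations is a recursion for the rows \<open>\<lambda>^i\<close>: the coefficient
  of row \<open>i + 1\<close> is \<open>C(i + 1, 2) - (i + 1)\<close>, which is nonzero for \<open>i \<ge> 3\<close>.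
\<close>

lemma vir_cocycle_zeroI:
  assumes f: "vir_cocycle \<alpha> \<alpha>' (ev2 f)" and z: "coeff f 0 = 0" "coeff f 1 = 0" "coeff f 2 = 0" "coeff f 3 = 0"
  shows "f = 0"
proof -
  have "coeff f i = 0" for i
  proof (induction i rule: less_induct)
    case (less i)
    show ?case
    proof (cases "4 \<le> i")
      case False
      then have "i \<in> {0, 1, 2, 3}" by auto
      then show ?thesis using z by auto
    next
      case True
      define r where "r = i - 4"
      have i: "i = r + 4" using True by (simp add: r_def)
      have "(r + 4) choose 2 \<noteq> r + 4"
        using binomial_right_mono[of 3 "r + 3" 2] by (simp add: eval_nat_numeral)
      moreover have "(r + 4) choose (r + 3) = r + 4"
        using binomial_symmetric[of "r + 3" "r + 4"] by simp
      ultimately have "complex_of_nat ((r + 4) choose 2) - of_nat ((r + 4) choose (r + 3)) \<noteq> 0"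
        by (simp only: right_minus_eq of_nat_eq_iff not_False_eq_True)
      moreover have s: "r + 3 + 2 - 1 = r + 4" by simp
      have "(of_nat ((r + 4) choose 2) - of_nat ((r + 4) choose (r + 3))) * coeff (coeff f i) k = 0" for k
        using cocycle_coeffs[OF f, of "r + 3" 2 k, unfolded s] less[of "r + 3"] z by (simp add: i)
      ultimately show ?thesis by (intro poly_eqI) simp
    qed
  qed
  then show ?thesis by (intro poly_eqI) simp
qed

section \<open>The obstruction for large weight differences\<close>

lemma of_nat_choose:
  fixes m :: nat
  defines "z \<equiv> complex_of_nat m"
  shows "of_nat (m choose 0) = (1::complex)" "of_nat (m choose 1) = z"
    "of_nat (m choose 2) = z * (z - 1) / 2"
    "of_nat (m choose 3) = z * (z - 1) * (z - 2) / 6"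
    "of_nat (m choose 4) = z * (z - 1) * (z - 2) * (z - 3) / 24"
    "of_nat (m choose 5) = z * (z - 1) * (z - 2) * (z - 3) * (z - 4) / 120"
    "of_nat (m choose 6) = z * (z - 1) * (z - 2) * (z - 3) * (z - 4) * (z - 5) / 720"
    "of_nat (m choose 7) = z * (z - 1) * (z - 2) * (z - 3) * (z - 4) * (z - 5) * (z - 6) / 5040"
  unfolding z_def
  by (simp_all add: binomial_gbinomial gbinomial_prod_rev numeral_eq_Suc prod.atLeast0_lessThan_Suc)

lemma cob_coeff_eqs:
  fixes m :: nat
  defines "z \<equiv> complex_of_nat m"
  shows "cob_coeff \<alpha> m 2 = z * (z - 1) / 2 + \<alpha> * z"
    "cob_coeff \<alpha> m 3 = z * (z - 1) * (z - 2) / 6 + \<alpha> * (z * (z - 1) / 2)"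
    "cob_coeff \<alpha> m 4 = z * (z - 1) * (z - 2) * (z - 3) / 24 + \<alpha> * (z * (z - 1) * (z - 2) / 6)"
    "cob_coeff \<alpha> m 5 = z * (z - 1) * (z - 2) * (z - 3) * (z - 4) / 120 + \<alpha> * (z * (z - 1) * (z - 2) * (z - 3) / 24)"
    "cob_coeff \<alpha> m 6 = z * (z - 1) * (z - 2) * (z - 3) * (z - 4) * (z - 5) / 720
       + \<alpha> * (z * (z - 1) * (z - 2) * (z - 3) * (z - 4) / 120)"
    "cob_coeff \<alpha> m 7 = z * (z - 1) * (z - 2) * (z - 3) * (z - 4) * (z - 5) * (z - 6) / 5040
       + \<alpha> * (z * (z - 1) * (z - 2) * (z - 3) * (z - 4) * (z - 5) / 720)"
  by (simp_all add: cob_coeff_def z_def of_nat_choose)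

lemma binomial_numerals:
  "4 choose 2 = 6" "4 choose 3 = 4" "5 choose 2 = 10" "5 choose 4 = 5" "6 choose 2 = 15" "6 choose 5 = 6"
  "7 choose 2 = 21" "7 choose 6 = 7" "8 choose 2 = 28" "8 choose 7 = 8"
  "6 choose 3 = 20" "6 choose 4 = 15" "8 choose 4 = 70" "8 choose 5 = 56"
  by (simp_all add: numeral_eq_Suc)

text \<open>
  The hypotheses are the recursion \<open>j = 2\<close>, which expresses \<open>a4\<close>, \<open>a5\<close>, \<open>a6\<close> by \<open>a2\<close> and \<open>a3\<close>, and the
  coefficient equation \<open>(i, j) = (4, 3)\<close>, with \<open>z = \<alpha>' - \<alpha>\<close>.  After elimination that equation is
  linear in \<open>a2\<close> and \<open>a3\<close> and holds for the coboundary of \<open>x^z\<close>; it is therefore a multiple of the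
  determinant of \<open>(a2, a3)\<close> against the coefficients of this coboundary (divided by \<open>z\<close>).
\<close>

lemma obstruction_4_3:
  fixes z al a2 a3 a4 a5 a6 :: complex
  assumes e4: "((z - 1)*(z - 2)*(z - 3) / 6 + al * ((z - 1)*(z - 2) / 2)) * a2 - ((z - 2)*(z - 3) / 2 + al * ((z - 2))) * a3 - 2 * a4 = 0"
    and e5: "((z - 1)*(z - 2)*(z - 3)*(z - 4) / 24 + al * ((z - 1)*(z - 2)*(z - 3) / 6)) * a2 - ((z - 3)*(z - 4) / 2 + al * ((z - 3))) * a4 - 5 * a5 = 0"
    and e6: "((z - 1)*(z - 2)*(z - 3)*(z - 4)*(z - 5) / 120 + al * ((z - 1)*(z - 2)*(z - 3)*(z - 4) / 24)) * a2 - ((z - 4)*(z - 5) / 2 + al * ((z - 4))) * a5 - 9 * a6 = 0"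
    and e: "((z - 2)*(z - 3)*(z - 4)*(z - 5) / 24 + al * ((z - 2)*(z - 3)*(z - 4) / 6)) * a3 - ((z - 3)*(z - 4)*(z - 5) / 6 + al * ((z - 3)*(z - 4) / 2)) * a4 - 5 * a6 = 0"
  shows "(z - 2) * (z - 3) * (z - 4) * (z^2 + 4*z*al - 5*z + 4*al^2 - 4*al) * ((z - 1) / 2 * ((z - 2) / 3 + al) * a2 - ((z - 1) / 2 + al) * a3) = 0"
proof -
  have a4: "a4 = (((z - 1)*(z - 2)*(z - 3) / 6 + al * ((z - 1)*(z - 2) / 2)) * a2 - ((z - 2)*(z - 3) / 2 + al * ((z - 2))) * a3) / 2" using e4 by (simp add: field_simps)
  have a5: "a5 = (((z - 1)*(z - 2)*(z - 3)*(z - 4) / 24 + al * ((z - 1)*(z - 2)*(z - 3) / 6)) * a2 - ((z - 3)*(z - 4) / 2 + al * ((z - 3))) * a4) / 5" using e5 by (simp add: field_simps)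
  have a6: "a6 = (((z - 1)*(z - 2)*(z - 3)*(z - 4)*(z - 5) / 120 + al * ((z - 1)*(z - 2)*(z - 3)*(z - 4) / 24)) * a2 - ((z - 4)*(z - 5) / 2 + al * ((z - 4))) * a5) / 9" using e6 by (simp add: field_simps)
  have "(z - 2) * (z - 3) * (z - 4) * (z^2 + 4*z*al - 5*z + 4*al^2 - 4*al) * ((z - 1) / 2 * ((z - 2) / 3 + al) * a2 - ((z - 1) / 2 + al) * a3) = - 72 * (((z - 2)*(z - 3)*(z - 4)*(z - 5) / 24 + al * ((z - 2)*(z - 3)*(z - 4) / 6)) * a3 - ((z - 3)*(z - 4)*(z - 5) / 6 + al * ((z - 3)*(z - 4) / 2)) * a4 - 5 * a6)"
    unfolding a6 a5 a4 by (simp add: divide_simps, algebra)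
  then show ?thesis by (simp only: e mult_zero_right)
qed

text \<open>
  The same elimination for the equation \<open>(i, j) = (5, 4)\<close>.  The equation \<open>(5, 3)\<close> would not help,
  because its multiplier is divisible by the multiplier of \<open>(4, 3)\<close>; here the remainder is
  \<open>9z(z - 1)\<close>.
\<close>

lemma obstruction_5_4:
  fixes z al a2 a3 a4 a5 a6 a7 a8 :: complex
  assumes e4: "((z - 1)*(z - 2)*(z - 3) / 6 + al * ((z - 1)*(z - 2) / 2)) * a2 - ((z - 2)*(z - 3) / 2 + al * ((z - 2))) * a3 - 2 * a4 = 0"
    and e5: "((z - 1)*(z - 2)*(z - 3)*(z - 4) / 24 + al * ((z - 1)*(z - 2)*(z - 3) / 6)) * a2 - ((z - 3)*(z - 4) / 2 + al * ((z - 3))) * a4 - 5 * a5 = 0"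
    and e6: "((z - 1)*(z - 2)*(z - 3)*(z - 4)*(z - 5) / 120 + al * ((z - 1)*(z - 2)*(z - 3)*(z - 4) / 24)) * a2 - ((z - 4)*(z - 5) / 2 + al * ((z - 4))) * a5 - 9 * a6 = 0"
    and e7: "((z - 1)*(z - 2)*(z - 3)*(z - 4)*(z - 5)*(z - 6) / 720 + al * ((z - 1)*(z - 2)*(z - 3)*(z - 4)*(z - 5) / 120)) * a2 - ((z - 5)*(z - 6) / 2 + al * ((z - 5))) * a6 - 14 * a7 = 0"
    and e8: "((z - 1)*(z - 2)*(z - 3)*(z - 4)*(z - 5)*(z - 6)*(z - 7) / 5040 + al * ((z - 1)*(z - 2)*(z - 3)*(z - 4)*(z - 5)*(z - 6) / 720)) * a2 - ((z - 6)*(z - 7) / 2 + al * ((z - 6))) * a7 - 20 * a8 = 0"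
    and e: "((z - 3)*(z - 4)*(z - 5)*(z - 6)*(z - 7) / 120 + al * ((z - 3)*(z - 4)*(z - 5)*(z - 6) / 24)) * a4 - ((z - 4)*(z - 5)*(z - 6)*(z - 7) / 24 + al * ((z - 4)*(z - 5)*(z - 6) / 6)) * a5 - 14 * a8 = 0"
  shows "(z - 2) * (z - 3) * (z - 4) * (z - 5) * (z - 6) * ((z^2 + 4*z*al - 19*z + 4*al^2 - 44*al + 57) * (z^2 + 4*z*al - 5*z + 4*al^2 - 4*al) + 9 * z * (z - 1)) * ((z - 1) / 2 * ((z - 2) / 3 + al) * a2 - ((z - 1) / 2 + al) * a3) = 0"
proof -
  have a4: "a4 = (((z - 1)*(z - 2)*(z - 3) / 6 + al * ((z - 1)*(z - 2) / 2)) * a2 - ((z - 2)*(z - 3) / 2 + al * ((z - 2))) * a3) / 2" using e4 by (simp add: field_simps)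
  have a5: "a5 = (((z - 1)*(z - 2)*(z - 3)*(z - 4) / 24 + al * ((z - 1)*(z - 2)*(z - 3) / 6)) * a2 - ((z - 3)*(z - 4) / 2 + al * ((z - 3))) * a4) / 5" using e5 by (simp add: field_simps)
  have a6: "a6 = (((z - 1)*(z - 2)*(z - 3)*(z - 4)*(z - 5) / 120 + al * ((z - 1)*(z - 2)*(z - 3)*(z - 4) / 24)) * a2 - ((z - 4)*(z - 5) / 2 + al * ((z - 4))) * a5) / 9" using e6 by (simp add: field_simps)
  have a7: "a7 = (((z - 1)*(z - 2)*(z - 3)*(z - 4)*(z - 5)*(z - 6) / 720 + al * ((z - 1)*(z - 2)*(z - 3)*(z - 4)*(z - 5) / 120)) * a2 - ((z - 5)*(z - 6) / 2 + al * ((z - 5))) * a6) / 14" using e7 by (simp add: field_simps)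
  have a8: "a8 = (((z - 1)*(z - 2)*(z - 3)*(z - 4)*(z - 5)*(z - 6)*(z - 7) / 5040 + al * ((z - 1)*(z - 2)*(z - 3)*(z - 4)*(z - 5)*(z - 6) / 720)) * a2 - ((z - 6)*(z - 7) / 2 + al * ((z - 6))) * a7) / 20" using e8 by (simp add: field_simps)
  have "(z - 2) * (z - 3) * (z - 4) * (z - 5) * (z - 6) * ((z^2 + 4*z*al - 19*z + 4*al^2 - 44*al + 57) * (z^2 + 4*z*al - 5*z + 4*al^2 - 4*al) + 9 * z * (z - 1)) * ((z - 1) / 2 * ((z - 2) / 3 + al) * a2 - ((z - 1) / 2 + al) * a3) = - 28800 * (((z - 3)*(z - 4)*(z - 5)*(z - 6)*(z - 7) / 120 + al * ((z - 3)*(z - 4)*(z - 5)*(z - 6) / 24)) * a4 - ((z - 4)*(z - 5)*(z - 6)*(z - 7) / 24 + al * ((z - 4)*(z - 5)*(z - 6) / 6)) * a5 - 14 * a8)"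
    unfolding a8 a7 a6 a5 a4 by (simp add: divide_simps, algebra)
  then show ?thesis by (simp only: e mult_zero_right)
qed

lemma homogeneous_recursion:
  assumes "vir_cocycle \<alpha> \<alpha>' (ev2 f)" "2 \<le> i" "2 \<le> j" "i + j \<le> n + 2"
  shows "cob_coeff \<alpha> (n + 1 - j) i * coeff (coeff f j) (n + 1 - j)
       - cob_coeff \<alpha> (n + 1 - i) j * coeff (coeff f i) (n + 1 - i)
      = (of_nat ((i + j - 1) choose j) - of_nat ((i + j - 1) choose i)) * coeff (coeff f (i + j - 1)) (n + 2 - (i + j))"
proof -
  have "n + 2 - (i + j) + i - 1 = n + 1 - j" "n + 2 - (i + j) + j - 1 = n + 1 - i"
    using assms by auto
  then show ?thesis using cocycle_coeffs[OF assms(1), of i j "n + 2 - (i + j)"] assms by simp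
qed

text \<open>
  Outside the exceptional parameters one of the two obstructions applies, so rows 2 and 3 of a
  cocycle are proportional to those of the coboundary of \<open>x^n\<close>.
\<close>

lemma coefficient_ratio_forced:
  assumes f: "vir_cocycle \<alpha> \<alpha>' (ev2 f)" and n: "5 \<le> n" and \<alpha>: "\<alpha> \<noteq> 0"
    and n5: "n = 5 \<Longrightarrow> \<alpha> \<noteq> -4" and n6: "n = 6 \<Longrightarrow> 2 * \<alpha>\<^sup>2 + 10 * \<alpha> + 3 \<noteq> 0"
  shows "coeff (coeff f 2) (n - 1) * cob_coeff \<alpha> n 3 = coeff (coeff f 3) (n - 2) * cob_coeff \<alpha> n 2"
proof -
  define z where "z = complex_of_nat n"
  define a where "a i = coeff (coeff f i) (n + 1 - i)" for i
  have zs: "complex_of_nat (n - s) = z - of_nat s" if "s \<le> n" for s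
    using that by (simp add: z_def of_nat_diff)
  have rec: "cob_coeff \<alpha> (n + 1 - j) i * a j - cob_coeff \<alpha> (n + 1 - i) j * a i
      = (of_nat ((i + j - 1) choose j) - of_nat ((i + j - 1) choose i)) * a (i + j - 1)"
    if "2 \<le> i" "2 \<le> j" "i + j \<le> n + 2" for i j
    using homogeneous_recursion[OF f that] that by (simp add: a_def)
  define Q where "Q = z^2 + 4*z*\<alpha> - 5*z + 4*\<alpha>^2 - 4*\<alpha>"
  define D where "D = (z - 1) / 2 * ((z - 2) / 3 + \<alpha>) * a 2 - ((z - 1) / 2 + \<alpha>) * a 3"
  have nz: "z - of_nat s \<noteq> 0" if "s < n" for s
    using that by (simp add: z_def)
  have e4: "((z - 1)*(z - 2)*(z - 3) / 6 + \<alpha> * ((z - 1)*(z - 2) / 2)) * a 2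
      - ((z - 2)*(z - 3) / 2 + \<alpha> * ((z - 2))) * a 3 - 2 * a 4 = 0"
    using rec[of 3 2] n zs[of 1] zs[of 2] by (simp add: cob_coeff_eqs binomial_numerals)
  have e5: "((z - 1)*(z - 2)*(z - 3)*(z - 4) / 24 + \<alpha> * ((z - 1)*(z - 2)*(z - 3) / 6)) * a 2
      - ((z - 3)*(z - 4) / 2 + \<alpha> * ((z - 3))) * a 4 - 5 * a 5 = 0"
    using rec[of 4 2] n zs[of 1] zs[of 3] by (simp add: cob_coeff_eqs binomial_numerals)
  have e6: "((z - 1)*(z - 2)*(z - 3)*(z - 4)*(z - 5) / 120 + \<alpha> * ((z - 1)*(z - 2)*(z - 3)*(z - 4) / 24)) * a 2
      - ((z - 4)*(z - 5) / 2 + \<alpha> * ((z - 4))) * a 5 - 9 * a 6 = 0"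
    using rec[of 5 2] n zs[of 1] zs[of 4] by (simp add: cob_coeff_eqs binomial_numerals)
  have e: "((z - 2)*(z - 3)*(z - 4)*(z - 5) / 24 + \<alpha> * ((z - 2)*(z - 3)*(z - 4) / 6)) * a 3
      - ((z - 3)*(z - 4)*(z - 5) / 6 + \<alpha> * ((z - 3)*(z - 4) / 2)) * a 4 - 5 * a 6 = 0"
    using rec[of 4 3] n zs[of 2] zs[of 3] by (simp add: cob_coeff_eqs binomial_numerals)
  have QD: "Q = 0 \<or> D = 0"
    using obstruction_4_3[OF e4 e5 e6 e] nz[of 2] nz[of 3] nz[of 4] n by (simp add: Q_def D_def)
  have "D = 0"
  proof (rule ccontr)
    assume D: "D \<noteq> 0"
    with QD have Q: "Q = 0" by simp
    consider "n = 5" | "n = 6" | "7 \<le> n" using n by linarith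
    then show False
    proof cases
      case 1
      then have "4 * \<alpha> * (\<alpha> + 4) = 0" using Q by (simp add: Q_def z_def power2_eq_square algebra_simps)
      then show False using \<alpha> n5[OF 1] by (simp add: eq_neg_iff_add_eq_0)
    next
      case 2
      then have "2 * (2 * \<alpha>\<^sup>2 + 10 * \<alpha> + 3) = Q" by (simp add: Q_def z_def algebra_simps)
      then show False using n6[OF 2] Q by (metis mult_eq_0_iff zero_neq_numeral)
    next
      case 3
      have e7: "((z - 1)*(z - 2)*(z - 3)*(z - 4)*(z - 5)*(z - 6) / 720
            + \<alpha> * ((z - 1)*(z - 2)*(z - 3)*(z - 4)*(z - 5) / 120)) * a 2
          - ((z - 5)*(z - 6) / 2 + \<alpha> * ((z - 5))) * a 6 - 14 * a 7 = 0"
        using rec[of 6 2] 3 zs[of 1] zs[of 5] by (simp add: cob_coeff_eqs binomial_numerals)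
      have e8: "((z - 1)*(z - 2)*(z - 3)*(z - 4)*(z - 5)*(z - 6)*(z - 7) / 5040
            + \<alpha> * ((z - 1)*(z - 2)*(z - 3)*(z - 4)*(z - 5)*(z - 6) / 720)) * a 2
          - ((z - 6)*(z - 7) / 2 + \<alpha> * ((z - 6))) * a 7 - 20 * a 8 = 0"
        using rec[of 7 2] 3 zs[of 1] zs[of 6] by (simp add: cob_coeff_eqs binomial_numerals)
      have e': "((z - 3)*(z - 4)*(z - 5)*(z - 6)*(z - 7) / 120 + \<alpha> * ((z - 3)*(z - 4)*(z - 5)*(z - 6) / 24)) * a 4
          - ((z - 4)*(z - 5)*(z - 6)*(z - 7) / 24 + \<alpha> * ((z - 4)*(z - 5)*(z - 6) / 6)) * a 5 - 14 * a 8 = 0"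
        using rec[of 5 4] 3 zs[of 3] zs[of 4] by (simp add: cob_coeff_eqs binomial_numerals)
      have "z \<noteq> 0" "z - 1 \<noteq> 0" using nz[of 0] nz[of 1] 3 by auto
      then show False
        using obstruction_5_4[OF e4 e5 e6 e7 e8 e'] nz[of 2] nz[of 3] nz[of 4] nz[of 5] nz[of 6] 3 D Q
        by (simp add: Q_def D_def)
    qed
  qed
  then have "z * D = 0" by (simp only: mult_zero_right)
  moreover have "coeff (coeff f 2) (n - 1) * cob_coeff \<alpha> n 3 - coeff (coeff f 3) (n - 2) * cob_coeff \<alpha> n 2 = z * D"
    using n unfolding D_def cob_coeff_eqs a_def z_def[symmetric] by (simp add: field_simps)
  ultimately show ?thesis by (metis right_minus_eq)
qed

section \<open>The nontrivial Virasoro cocycles\<close>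

text \<open>
  The nontrivial cocycles for \<open>\<alpha>' = \<alpha> + n\<close> with \<open>n > 0\<close>, listed by rows: entry \<open>i\<close>, counted from 0, is the
  coefficient of \<open>\<lambda>^i\<close> as a polynomial in \<open>\<partial> + \<beta>\<close>.
\<close>

definition std_cocycle :: "complex \<Rightarrow> nat \<Rightarrow> complex poly poly \<Rightarrow> bool"
  where "std_cocycle \<alpha> n e \<longleftrightarrow>
    n = 2 \<and> e = [:0, 0, [:0, 2:], [:1:]:] \<or>
    n = 3 \<and> e = [:0, 0, [:0, 0, 1:], [:0, 1:]:] \<or>
    n = 4 \<and> e = [:0, 0, [:0, 0, 0, 4:], [:0, 0, 6:], [:0, -1:], [:\<alpha>:]:] \<or>
    n = 5 \<and> \<alpha> = -4 \<and>
      e = [:0, 0, [:0, 0, 0, 0, 1:], 0, [:0, 0, -10:], [:0, -17:], [:-8:]:] \<or>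
    n = 6 \<and> 2 * \<alpha>\<^sup>2 + 10 * \<alpha> + 3 = 0 \<and>
      e = [:0, 0, 0, [:0, 0, 0, 0, 1:], [:0, 0, 0, - (2 * \<alpha> + 3):], [:0, 0, - (3 * \<alpha>):],
            [:0, - (3 * \<alpha> + 1):], [:- (\<alpha> + 9/28):]:]"

lemma std_cocycle_unique:
  "std_cocycle \<alpha> n e \<Longrightarrow> std_cocycle \<alpha> n e' \<Longrightarrow> e = e'"
  unfolding std_cocycle_def by (elim disjE conjE) simp_all

lemma std_cocycle_cocycle:
  assumes "std_cocycle \<alpha> n e"
  shows "vir_cocycle \<alpha> (\<alpha> + of_nat n) (ev2 e)"
proof -
  \<comment> \<open>The identity for \<open>n = 6\<close> needs the quadratic equation for \<open>\<alpha>\<close>; the factor 28 clears denominators.\<close>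
  have vi: "(x + l + (\<alpha> + 6) * m) * E x l + (x + \<alpha> * l) * E (x + l) m
       - (x + m + (\<alpha> + 6) * l) * E x m - (x + \<alpha> * m) * E (x + m) l = (l - m) * E x (l + m)"
    if a: "2 * \<alpha>\<^sup>2 + 10 * \<alpha> + 3 = 0"
      and E: "\<And>x l. 28 * E x l = 28 * x^4 * l^3 - 28 * (2 * \<alpha> + 3) * x^3 * l^4 - 28 * 3 * \<alpha> * x^2 * l^5
         - 28 * (3 * \<alpha> + 1) * x * l^6 - (28 * \<alpha> + 9) * l^7"
    for E :: "complex \<Rightarrow> complex \<Rightarrow> complex" and x l m
    using a E[of x l] E[of x m] E[of "x + l" m] E[of "x + m" l] E[of x "l + m"] by algebra
  from assms consider "n = 2" | "n = 3" | "n = 4" | "n = 5" | "n = 6"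
    by (auto simp: std_cocycle_def)
  then show ?thesis
  proof cases
    case 5
    then have a: "2 * \<alpha>\<^sup>2 + 10 * \<alpha> + 3 = 0" using assms by (simp add: std_cocycle_def)
    have e: "e = [:0, 0, 0, [:0, 0, 0, 0, 1:], [:0, 0, 0, - (2 * \<alpha> + 3):], [:0, 0, - (3 * \<alpha>):],
            [:0, - (3 * \<alpha> + 1):], [:- (\<alpha> + 9/28):]:]"
      using assms 5 by (simp add: std_cocycle_def)
    have "28 * ev2 e x l = 28 * x^4 * l^3 - 28 * (2 * \<alpha> + 3) * x^3 * l^4 - 28 * 3 * \<alpha> * x^2 * l^5
         - 28 * (3 * \<alpha> + 1) * x * l^6 - (28 * \<alpha> + 9) * l^7" for x l
      unfolding e by (simp add: field_simps) algebra
    from vi[OF a this] show ?thesis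
      unfolding vir_cocycle_def 5 by simp
  next
    case 1
    have E1: "ev2 e x l = 2 * x * l^2 + l^3" for x l
      using assms 1 by (simp add: std_cocycle_def algebra_simps power_numeral_reduce)
    show ?thesis unfolding vir_cocycle_def 1 of_nat_numeral E1 by (intro allI) algebra
  next
    case 2
    have E2: "ev2 e x l = x^2 * l^2 + x * l^3" for x l
      using assms 2 by (simp add: std_cocycle_def algebra_simps power_numeral_reduce)
    show ?thesis unfolding vir_cocycle_def 2 of_nat_numeral E2 by (intro allI) algebra
  next
    case 3
    have E3: "ev2 e x l = 4 * x^3 * l^2 + 6 * x^2 * l^3 - x * l^4 + \<alpha> * l^5" for x l
      using assms 3 by (simp add: std_cocycle_def algebra_simps power_numeral_reduce)
    show ?thesis unfolding vir_cocycle_def 3 of_nat_numeral E3 by (intro allI) algebra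
  next
    case 4
    have E4: "ev2 e x l = x^4 * l^2 - 10 * x^2 * l^4 - 17 * x * l^5 - 8 * l^6" "\<alpha> = -4" for x l
      using assms 4 by (simp_all add: std_cocycle_def algebra_simps power_numeral_reduce)
    show ?thesis unfolding vir_cocycle_def 4 of_nat_numeral E4 by (intro allI) algebra
  qed
qed

text \<open>
  The last claim says that rows 2 and 3 are not proportional to those of the coboundary of \<open>x^n\<close>;
  both the nontriviality and the uniqueness of the class come from this determinant.
\<close>

lemma std_cocycle_coeffs:
  assumes "std_cocycle \<alpha> n e" and "\<alpha> \<noteq> 0"
  shows "2 \<le> n"
    and "coeff e 0 = 0" "coeff e 1 = 0"
    and "k \<noteq> n - 1 \<Longrightarrow> coeff (coeff e 2) k = 0"
    and "k \<noteq> n - 2 \<Longrightarrow> coeff (coeff e 3) k = 0"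
    and "coeff (coeff e 2) (n - 1) * cob_coeff \<alpha> n 3 \<noteq> coeff (coeff e 3) (n - 2) * cob_coeff \<alpha> n 2"
proof -
  show "2 \<le> n" "coeff e 0 = 0" "coeff e 1 = 0"
    using assms by (auto simp: std_cocycle_def)
  show "coeff (coeff e 2) k = 0" if "k \<noteq> n - 1"
    using assms that by (auto simp: std_cocycle_def numeral_eq_Suc coeff_pCons split: nat.splits)
  show "coeff (coeff e 3) k = 0" if "k \<noteq> n - 2"
    using assms that by (auto simp: std_cocycle_def numeral_eq_Suc coeff_pCons split: nat.splits)
  show "coeff (coeff e 2) (n - 1) * cob_coeff \<alpha> n 3 \<noteq> coeff (coeff e 3) (n - 2) * cob_coeff \<alpha> n 2"
  proof -
    have v: "360 + \<alpha> * 144 \<noteq> 0" if "2 * \<alpha>\<^sup>2 + 10 * \<alpha> + 3 = 0"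
      using that by algebra
    show ?thesis
      using assms v
      by (auto simp: std_cocycle_def cob_coeff_eqs(1)[unfolded numeral_2_eq_2] cob_coeff_eqs(2)[unfolded numeral_3_eq_3]
            numeral_eq_Suc field_simps)
  qed
qed

text \<open>
  In a coboundary of total degree \<open>n + 1\<close> only the coefficient of \<open>x^n\<close> in \<open>p\<close> takes part, so rows 2
  and 3 would be proportional to those of the coboundary of \<open>x^n\<close>.
\<close>

lemma std_cocycle_nontrivial:
  assumes e: "std_cocycle \<alpha> n e" and \<alpha>: "\<alpha> \<noteq> 0"
    and eq: "\<And>x l. s * ev2 e x l = vir_cob \<alpha> (\<alpha> + of_nat n) p x l"
  shows "s = 0"
proof -
  note E = std_cocycle_coeffs[OF e \<alpha>]
  have "smult [:s:] e = vir_cob_poly \<alpha> (\<alpha> + of_nat n) p"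
    using eq by (intro ev2_eqI) simp
  then have c: "s * coeff (coeff e i) k = coeff (coeff (vir_cob_poly \<alpha> (\<alpha> + of_nat n) p) i) k" for i k
    by (metis coeff_smult mult_pCons_left mult_zero_left add.right_neutral smult_0_left pCons_0_0)
  have "s * coeff (coeff e 2) (n - 1) = cob_coeff \<alpha> n 2 * coeff p n"
    using c[of 2 "n - 1"] E(1) by (simp add: coeff_vir_cob_poly)
  moreover have "s * coeff (coeff e 3) (n - 2) = cob_coeff \<alpha> n 3 * coeff p n"
    using c[of 3 "n - 2"] E(1) by (simp add: coeff_vir_cob_poly)
  ultimately have "s * (coeff (coeff e 2) (n - 1) * cob_coeff \<alpha> n 3 - coeff (coeff e 3) (n - 2) * cob_coeff \<alpha> n 2) = 0"
    by algebra
  then show ?thesis using E(6) by simp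
qed

section \<open>Classification of the Virasoro cocycles\<close>

text \<open>
  The coboundary of \<open>x^n\<close> has \<open>n - (\<alpha>' - \<alpha>)\<close> as coefficient of \<open>x^n l\<close>, so the row \<open>\<lambda>^1\<close> can be removed
  except for \<open>n = \<alpha>' - \<alpha>\<close>.  For this \<open>n\<close>, if it is not zero, the Euler identity for the coefficient of
  \<open>l^(n + 1)\<close> and \<open>\<alpha> \<noteq> 0\<close> make the coefficient of \<open>x^n l\<close> vanish.
\<close>

lemma vir_normalize:
  assumes f: "vir_cocycle \<alpha> \<alpha>' (ev2 f)" and \<alpha>: "\<alpha> \<noteq> 0"
  obtains p where "vir_cocycle \<alpha> \<alpha>' (ev2 (f - vir_cob_poly \<alpha> \<alpha>' p))"
    "\<And>k. k \<noteq> 0 \<or> \<alpha>' \<noteq> \<alpha> \<Longrightarrow> coeff (coeff (f - vir_cob_poly \<alpha> \<alpha>' p) 1) k = 0"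
    "\<And>k j. 1 < j \<Longrightarrow> of_nat (k + j) \<noteq> \<alpha>' - \<alpha> + 1 \<Longrightarrow> coeff (coeff (f - vir_cob_poly \<alpha> \<alpha>' p) j) k = 0"
proof -
  define q where "q = coeff f 1"
  \<comment> \<open>The convention \<open>x / 0 = 0\<close> leaves out the degree in which the coboundary has no row \<open>\<lambda>^1\<close>.\<close>
  define p where "p = Poly (map (\<lambda>n. coeff q n / (of_nat n - (\<alpha>' - \<alpha>))) [0..<Suc (degree q)])"
  have p: "coeff p n = coeff q n / (of_nat n - (\<alpha>' - \<alpha>))" for n
    by (cases "n \<le> degree q") (auto simp: p_def nth_default_def coeff_eq_0 simp del: upt_Suc)
  let ?g = "f - vir_cob_poly \<alpha> \<alpha>' p"
  have g: "vir_cocycle \<alpha> \<alpha>' (ev2 ?g)" by (rule vir_cocycle_subtract_cob[OF f])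
  have g1: "coeff (coeff ?g 1) k = (if of_nat k = \<alpha>' - \<alpha> then coeff q k else 0)" for k
  proof -
    have "coeff (coeff ?g 1) k = coeff q k - (of_nat k - (\<alpha>' - \<alpha>)) * coeff p k"
      by (simp add: coeff_vir_cob_poly q_def algebra_simps)
    then show ?thesis by (simp add: p)
  qed
  have row1: "coeff (coeff ?g 1) k = 0" if k: "k \<noteq> 0 \<or> \<alpha>' \<noteq> \<alpha>" for k
  proof (cases "of_nat k = \<alpha>' - \<alpha>")
    case True
    with k have "0 < k" by (cases k) auto
    then have "cob_coeff \<alpha> k (Suc k) * coeff (coeff ?g 1) k
        = (of_nat (Suc k) - 1 + \<alpha> - \<alpha>') * coeff (coeff ?g (Suc k)) 0"
      using euler_row[OF g, of "Suc k" 0] by simp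
    then have "cob_coeff \<alpha> k (Suc k) * coeff (coeff ?g 1) k = 0"
      using True by (simp del: coeff_diff)
    moreover have "cob_coeff \<alpha> k (Suc k) = \<alpha>" by (simp add: cob_coeff_def)
    ultimately show ?thesis using \<alpha> by (metis mult_eq_0_iff)
  qed (simp only: g1 if_False)
  have "coeff (coeff ?g j) k = 0" if j: "1 < j" and ne: "of_nat (k + j) \<noteq> \<alpha>' - \<alpha> + 1" for k j
  proof -
    have "coeff (coeff ?g 1) (k + j - 1) = 0"
      using j by (intro row1) auto
    then have "(of_nat (k + j) - 1 + \<alpha> - \<alpha>') * coeff (coeff ?g j) k = 0"
      using euler_row[OF g j, of k] by (metis mult_zero_right)
    moreover have "of_nat (k + j) - 1 + \<alpha> - \<alpha>' \<noteq> 0" using ne by (simp add: algebra_simps)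
    ultimately show ?thesis by (metis mult_eq_0_iff)
  qed
  with g row1 show ?thesis by (rule that)
qed

lemma vir_classify_equal_weight:
  assumes f: "vir_cocycle \<alpha> \<alpha> (ev2 f)" and \<alpha>: "\<alpha> \<noteq> 0"
  obtains p s0 s1 where "\<And>x l. ev2 f x l = vir_cob \<alpha> \<alpha> p x l + (s0 + s1 * l)"
proof -
  obtain p where g: "vir_cocycle \<alpha> \<alpha> (ev2 (f - vir_cob_poly \<alpha> \<alpha> p))"
    "\<And>k. k \<noteq> 0 \<Longrightarrow> coeff (coeff (f - vir_cob_poly \<alpha> \<alpha> p) 1) k = 0"
    "\<And>k j. 1 < j \<Longrightarrow> of_nat (k + j) \<noteq> (1::complex) \<Longrightarrow> coeff (coeff (f - vir_cob_poly \<alpha> \<alpha> p) j) k = 0"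
    by (rule vir_normalize[OF f \<alpha>]) auto
  let ?g = "f - vir_cob_poly \<alpha> \<alpha> p"
  obtain s0 where s0: "coeff ?g 0 = [:s0:]" using zero_row(2)[OF g(1) \<alpha>] by blast
  define s1 where "s1 = coeff (coeff ?g 1) 0"
  have "coeff (coeff ?g j) k = coeff (coeff [:[:s0:], [:s1:]:] j) k" for j k
  proof -
    consider "j = 0" | "j = 1" | "1 < j" by linarith
    then show ?thesis
    proof cases
      case 1
      then show ?thesis by (simp only: s0 coeff_pCons_0)
    next
      case 2
      then show ?thesis
        using g(2)[of k] by (cases k) (simp_all add: s1_def)
    next
      case 3
      have "of_nat (k + j) \<noteq> (1::complex)"
        using 3 by (metis add.commute add_leD1 not_less of_nat_1 of_nat_eq_iff order_refl)
      then show ?thesis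
        using 3 g(3)[OF 3] by (cases j; cases "j - 1") (auto simp: coeff_pCons split: nat.splits)
    qed
  qed
  then have "?g = [:[:s0:], [:s1:]:]" by (intro poly_eqI)
  then have "f = vir_cob_poly \<alpha> \<alpha> p + [:[:s0:], [:s1:]:]" by (simp add: algebra_simps)
  then have "ev2 f x l = vir_cob \<alpha> \<alpha> p x l + (s0 + s1 * l)" for x l by simp
  then show ?thesis by (rule that)
qed

text \<open>
  After normalization only the coefficients \<open>a2\<close> of \<open>x^(n-1) l^2\<close> and \<open>a3\<close> of \<open>x^(n-2) l^3\<close> are free.
  They are matched by a combination of the coboundary of \<open>x^n\<close> and the standard cocycle if there is
  one, and otherwise by the coboundary alone.
\<close>

lemma vir_classify_distinct_weights:
  assumes f: "vir_cocycle \<alpha> \<alpha>' (ev2 f)" and \<alpha>: "\<alpha> \<noteq> 0" and ne: "\<alpha>' \<noteq> \<alpha>"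
  obtains p where "\<And>x l. ev2 f x l = vir_cob \<alpha> \<alpha>' p x l"
    | n e p s where "std_cocycle \<alpha> n e" "\<alpha>' = \<alpha> + of_nat n"
       "\<And>x l. ev2 f x l = vir_cob \<alpha> \<alpha>' p x l + s * ev2 e x l"
proof -
  obtain p where g: "vir_cocycle \<alpha> \<alpha>' (ev2 (f - vir_cob_poly \<alpha> \<alpha>' p))"
    "\<And>k. coeff (coeff (f - vir_cob_poly \<alpha> \<alpha>' p) 1) k = 0"
    "\<And>k j. 1 < j \<Longrightarrow> of_nat (k + j) \<noteq> \<alpha>' - \<alpha> + 1 \<Longrightarrow> coeff (coeff (f - vir_cob_poly \<alpha> \<alpha>' p) j) k = 0"
    by (rule vir_normalize[OF f \<alpha>]) (use ne in auto)
  define g where "g = f - vir_cob_poly \<alpha> \<alpha>' p"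
  note g = g[folded g_def]
  have fg: "ev2 f x l = vir_cob \<alpha> \<alpha>' p x l + ev2 g x l" for x l by (simp add: g_def)
  have g0: "coeff g 0 = 0" by (rule zero_row(1)[OF g(1) \<alpha> ne])
  have g1: "coeff g 1 = 0" using g(2) by (intro poly_eqI) simp
  show ?thesis
  proof (cases "\<exists>n. \<alpha>' = \<alpha> + of_nat n")
    case False
    have "of_nat (k + j) \<noteq> \<alpha>' - \<alpha> + 1" if "1 < j" for k j
    proof
      assume "of_nat (k + j) = \<alpha>' - \<alpha> + 1"
      then have "\<alpha>' = \<alpha> + of_nat (k + j - 1)" using that by (simp add: of_nat_diff algebra_simps)
      then show False using False by blast
    qed
    then have "coeff g j = 0" if "1 < j" for j using g(3)[OF that] that by (intro poly_eqI) simp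
    then have "g = 0" by (intro vir_cocycle_zeroI[OF g(1) g0 g1]) auto
    then show ?thesis using that(1)[of p] fg by simp
  next
    case True
    then obtain n where n: "\<alpha>' = \<alpha> + of_nat n" by blast
    with ne have n0: "0 < n" by (cases n) auto
    have hom: "coeff (coeff g j) k = 0" if "1 < j" "k + j \<noteq> n + 1" for k j
    proof (rule g(3)[OF that(1)])
      show "of_nat (k + j) \<noteq> \<alpha>' - \<alpha> + 1"
        using that(2) n by (metis add_diff_cancel_left' of_nat_1 of_nat_add of_nat_eq_iff)
    qed
    define a2 where "a2 = coeff (coeff g 2) (n - 1)"
    define a3 where "a3 = coeff (coeff g 3) (n - 2)"
    \<comment> \<open>By \<open>vir_cocycle_zeroI\<close>, a cocycle that agrees with \<open>g\<close> in rows 0 to 3 equals \<open>g\<close>.\<close>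
    have rigid: "g = vir_cob_poly \<alpha> \<alpha>' (monom c n) + smult [:s:] e"
      if e: "vir_cocycle \<alpha> \<alpha>' (ev2 e)" "coeff e 0 = 0" "coeff e 1 = 0"
        "\<And>k. k \<noteq> n - 1 \<Longrightarrow> coeff (coeff e 2) k = 0" "\<And>k. k \<noteq> n - 2 \<or> n < 2 \<Longrightarrow> coeff (coeff e 3) k = 0"
      and m: "a2 = c * cob_coeff \<alpha> n 2 + s * coeff (coeff e 2) (n - 1)"
         "2 \<le> n \<Longrightarrow> a3 = c * cob_coeff \<alpha> n 3 + s * coeff (coeff e 3) (n - 2)" for c s e
    proof -
      let ?d = "g - vir_cob_poly \<alpha> \<alpha>' (monom c n) - smult [:s:] e"
      have "ev2 ?d = (\<lambda>x l. ev2 (g - vir_cob_poly \<alpha> \<alpha>' (monom c n)) x l + (- s) * ev2 e x l)"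
        by (intro ext) simp
      then have d: "vir_cocycle \<alpha> \<alpha>' (ev2 ?d)"
        using vir_cocycle_combine[OF vir_cocycle_subtract_cob[OF g(1), of "monom c n"] e(1), of "- s"] by simp
      have "coeff ?d 0 = 0" by (rule zero_row(1)[OF d \<alpha> ne])
      moreover have "coeff ?d 1 = 0"
        using g1 e(3) n by (intro poly_eqI) (auto simp: coeff_vir_cob_poly)
      moreover have "coeff ?d 2 = 0"
      proof (intro poly_eqI)
        fix k
        show "coeff (coeff ?d 2) k = coeff 0 k"
          using hom[of 2 k] e(4)[of k] m(1) n0
          by (cases "k = n - 1") (auto simp: coeff_monom_cob a2_def)
      qed
      moreover have "coeff ?d 3 = 0"
      proof (intro poly_eqI)
        fix k
        have "coeff (coeff e 3) k = 0" if "k + 3 \<noteq> n + 1"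
          using that by (intro e(5)) auto
        then show "coeff (coeff ?d 3) k = coeff 0 k"
          using hom[of 3 k] m(2) n0
          by (cases "k + 3 = n + 1") (auto simp: coeff_monom_cob a3_def)
      qed
      ultimately have "?d = 0" by (rule vir_cocycle_zeroI[OF d])
      then show ?thesis by (simp add: algebra_simps)
    qed
    have split: "ev2 f x l = vir_cob \<alpha> \<alpha>' (p + monom c n) x l + s * ev2 e x l"
      if "g = vir_cob_poly \<alpha> \<alpha>' (monom c n) + smult [:s:] e" for c s e x l
      using fg[of x l] by (simp add: that vir_cob_def algebra_simps)
    show ?thesis
    proof (cases "\<exists>e. std_cocycle \<alpha> n e")
      case True
      then obtain e where e: "std_cocycle \<alpha> n e" by blast
      note E = std_cocycle_coeffs[OF e \<alpha>]
      define e2 e3 b2 b3 where "e2 = coeff (coeff e 2) (n - 1)" and "e3 = coeff (coeff e 3) (n - 2)"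
        and "b2 = cob_coeff \<alpha> n 2" and "b3 = cob_coeff \<alpha> n 3"
      have det: "e2 * b3 - e3 * b2 \<noteq> 0" using E(6) by (simp add: e2_def e3_def b2_def b3_def)
      \<comment> \<open>Cramer's rule for the two unknown coefficients.\<close>
      define c where "c = (e2 * a3 - e3 * a2) / (e2 * b3 - e3 * b2)"
      define s where "s = (a2 * b3 - a3 * b2) / (e2 * b3 - e3 * b2)"
      have "a2 * (e2 * b3 - e3 * b2) = (e2 * a3 - e3 * a2) * b2 + (a2 * b3 - a3 * b2) * e2"
        "a3 * (e2 * b3 - e3 * b2) = (e2 * a3 - e3 * a2) * b3 + (a2 * b3 - a3 * b2) * e3"
        by algebra+
      then have m: "a2 = c * b2 + s * e2" "a3 = c * b3 + s * e3"
        unfolding c_def s_def using det by (simp_all add: divide_simps)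
      have "g = vir_cob_poly \<alpha> \<alpha>' (monom c n) + smult [:s:] e"
        by (rule rigid) (use std_cocycle_cocycle[OF e] n E m in \<open>auto simp: e2_def e3_def b2_def b3_def\<close>)
      from that(2)[OF e n split[OF this]] show ?thesis .
    next
      case False
      have "a2 * cob_coeff \<alpha> n 3 = a3 * cob_coeff \<alpha> n 2 \<or> n = 1"
      proof -
        have "n \<noteq> 2" "n \<noteq> 3" "n \<noteq> 4" "n = 5 \<Longrightarrow> \<alpha> \<noteq> -4" "n = 6 \<Longrightarrow> 2 * \<alpha>\<^sup>2 + 10 * \<alpha> + 3 \<noteq> 0"
          using False unfolding std_cocycle_def by auto
        moreover from this n0 have "n = 1 \<or> 5 \<le> n" by linarith
        ultimately show ?thesis
          using coefficient_ratio_forced[OF g(1) _ \<alpha>] by (auto simp: a2_def a3_def)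
      qed
      moreover have "cob_coeff \<alpha> n 2 \<noteq> 0 \<or> cob_coeff \<alpha> n 3 \<noteq> 0"
      proof (rule ccontr)
        assume "\<not> ?thesis"
        moreover have "of_nat n * ((of_nat n - 1) + 2 * \<alpha>) = 2 * cob_coeff \<alpha> n 2"
          "of_nat n * (of_nat n - 1) * ((of_nat n - 2) + 3 * \<alpha>) = 6 * cob_coeff \<alpha> n 3"
          by (simp_all add: cob_coeff_eqs field_simps)
        ultimately have "of_nat n * ((of_nat n - 1) + 2 * \<alpha>) = 0"
          "of_nat n * (of_nat n - 1) * ((of_nat n - 2) + 3 * \<alpha>) = 0"
          by simp_all
        then have *: "(of_nat n - 1) + 2 * \<alpha> = 0" "of_nat n - 1 = (0::complex) \<or> (of_nat n - 2) + 3 * \<alpha> = 0"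
          using n0 by auto
        with \<alpha> have "(of_nat n - 2) + 3 * \<alpha> = 0" by auto
        with *(1) have "complex_of_nat n + 1 = 0" by algebra
        then have "complex_of_nat (n + 1) = 0" by (simp add: add.commute)
        then show False by (simp only: of_nat_eq_0_iff)
      qed
      moreover have "cob_coeff \<alpha> n 2 \<noteq> 0" if "n = 1"
        using that \<alpha> by (simp add: cob_coeff_eqs)
      ultimately obtain c where "a2 = c * cob_coeff \<alpha> n 2" "n = 1 \<or> a3 = c * cob_coeff \<alpha> n 3"
      proof (cases "cob_coeff \<alpha> n 2 = 0")
        case True
        with \<open>cob_coeff \<alpha> n 2 \<noteq> 0 \<or> cob_coeff \<alpha> n 3 \<noteq> 0\<close> \<open>n = 1 \<Longrightarrow> cob_coeff \<alpha> n 2 \<noteq> 0\<close>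
          \<open>a2 * cob_coeff \<alpha> n 3 = a3 * cob_coeff \<alpha> n 2 \<or> n = 1\<close>
        have "a2 = a3 / cob_coeff \<alpha> n 3 * cob_coeff \<alpha> n 2" "a3 = a3 / cob_coeff \<alpha> n 3 * cob_coeff \<alpha> n 3" by auto
        then show ?thesis using that by blast
      next
        case False
        with \<open>a2 * cob_coeff \<alpha> n 3 = a3 * cob_coeff \<alpha> n 2 \<or> n = 1\<close>
        have "a2 = a2 / cob_coeff \<alpha> n 2 * cob_coeff \<alpha> n 2" "n = 1 \<or> a3 = a2 / cob_coeff \<alpha> n 2 * cob_coeff \<alpha> n 3"
          by (auto simp: field_simps)
        then show ?thesis using that by blast
      qed
      then have "g = vir_cob_poly \<alpha> \<alpha>' (monom c n) + smult [:0:] 0"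
        by (intro rigid) (auto simp: vir_cocycle_def)
      from that(1)[of "p + monom c n"] split[OF this] show ?thesis by simp
    qed
  qed
qed

section \<open>The cocycle equations for the Type I algebra\<close>

text \<open>
  The coefficient of \<open>v\<close> in \<open>a\<^sub>l(b\<^sub>m y) - b\<^sub>m(a\<^sub>l y)\<close>, where \<open>a\<close> acts on \<open>v\<close> by \<open>s\<close> and on \<open>y\<close> by \<open>t\<close> and \<open>f\<close>,
  and \<open>b\<close> by the primed polynomials.
\<close>

definition jacobi_defect ::
  "complex poly poly \<Rightarrow> complex poly poly \<Rightarrow> complex poly poly
    \<Rightarrow> complex poly poly \<Rightarrow> complex poly poly \<Rightarrow> complex poly poly
    \<Rightarrow> complex \<Rightarrow> complex \<Rightarrow> complex \<Rightarrow> complex"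
  where
  "jacobi_defect s t f s' t' f' x l m =
     ev2 t' (x + l) m * ev2 f x l + ev2 s x l * ev2 f' (x + l) m
     - ev2 t (x + m) l * ev2 f' x m - ev2 s' x m * ev2 f (x + m) l"

text \<open>
  The relations for \<open>[A\<^sub>\<lambda> A]\<close>, \<open>[A\<^sub>\<lambda> B]\<close> and \<open>[B\<^sub>\<lambda> B]\<close>; the one for \<open>[B\<^sub>\<lambda> A]\<close> is that for \<open>[A\<^sub>\<lambda> B]\<close>
  with \<open>l\<close> and \<open>m\<close> exchanged.
\<close>

definition ext_cocycle ::
  "complex poly poly \<Rightarrow> complex poly poly \<Rightarrow> complex poly poly \<Rightarrow> complex poly poly
    \<Rightarrow> complex poly poly \<Rightarrow> complex poly poly \<Rightarrow> bool"
  where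
  "ext_cocycle sA sB tA tB f g \<longleftrightarrow>
     (\<forall>x l m. jacobi_defect sA tA f sA tA f x l m = (l - m) * ev2 f x (l + m)) \<and>
     (\<forall>x l m. jacobi_defect sA tA f sB tB g x l m = 0) \<and>
     (\<forall>x l m. jacobi_defect sB tB g sB tB g x l m = 0)"

lemma jacobi_defect_cob:
  "jacobi_defect s t (cob_poly s t p) s' t' (cob_poly s' t' p) x l m
   = (ev2 s x l * ev2 s' (x + l) m - ev2 s' x m * ev2 s (x + m) l) * poly p (x + l + m)
   - (ev2 t x l * ev2 t' (x + l) m - ev2 t' x m * ev2 t (x + m) l) * poly p x"
proof -
  have "x + m + l = x + l + m" by simp
  then show ?thesis unfolding jacobi_defect_def by (simp add: algebra_simps)
qed

lemma jacobi_defect_diff: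
  "jacobi_defect s t (f - g) s' t' (f' - g') x l m = jacobi_defect s t f s' t' f' x l m - jacobi_defect s t g s' t' g' x l m"
  by (simp add: jacobi_defect_def algebra_simps)

text \<open>
  For \<open>d\<^sup>2 = d\<close>, the polynomials \<open>d(\<partial> + \<alpha>\<lambda> + \<beta>)\<close> define a Virasoro module.
\<close>

lemma symbolA_commutator:
  fixes d :: complex
  assumes "d\<^sup>2 = d"
  shows "d * (x + \<alpha> * l + \<beta>) * (d * (x + l + \<alpha> * m + \<beta>)) - d * (x + \<alpha> * m + \<beta>) * (d * (x + m + \<alpha> * l + \<beta>))
      = (l - m) * (d * (x + \<alpha> * (l + m) + \<beta>))"
proof -
  have "d * (x + \<alpha> * l + \<beta>) * (d * (x + l + \<alpha> * m + \<beta>)) - d * (x + \<alpha> * m + \<beta>) * (d * (x + m + \<alpha> * l + \<beta>))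
      = d\<^sup>2 * ((l - m) * (x + \<alpha> * (l + m) + \<beta>))" by algebra
  then show ?thesis by (simp only: assms mult.left_commute)
qed

lemma ext_cocycle_subtract_cob:
  assumes "ext_cocycle (symbolA d1 \<alpha> \<beta>) (symbolB d2 \<phi>) (symbolA d1' \<alpha>' \<beta>') (symbolB d2' \<phi>') f g"
    and d: "d1\<^sup>2 = d1" "d1'\<^sup>2 = d1'" "d1 * d2 = 0" "d1' * d2' = 0"
  shows "ext_cocycle (symbolA d1 \<alpha> \<beta>) (symbolB d2 \<phi>) (symbolA d1' \<alpha>' \<beta>') (symbolB d2' \<phi>')
     (f - cob_poly (symbolA d1 \<alpha> \<beta>) (symbolA d1' \<alpha>' \<beta>') p) (g - cob_poly (symbolB d2 \<phi>) (symbolB d2' \<phi>') p)"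
proof -
  note A = symbolA_commutator
  have z: "d1 = 0 \<or> d2 = 0" "d1' = 0 \<or> d2' = 0" using d by auto
  show ?thesis
    using assms(1) unfolding ext_cocycle_def jacobi_defect_diff jacobi_defect_cob
      ev2_symbols A[OF d(1)] A[OF d(2)] ev2_simps ev2_cob_poly
    using z by (auto simp: add.assoc right_diff_distrib)
qed

section \<open>Twisted difference operators\<close>

lemma degree_pcompose_shift [simp]: "degree (pcompose p [:m::complex, 1:]) = degree p"
  by (simp add: degree_pcompose)

lemma twisted_difference_inj:
  assumes eq: "\<And>x. a * poly p (x + m) = b * poly p x" and "a \<noteq> (b::complex)"
  shows "p = 0"
proof -
  have "smult a (pcompose p [:m, 1:]) = smult b p"
    by (rule poly_eqI[THEN sym], rule arg_cong[where f="\<lambda>q. coeff q _"],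
        simp add: poly_eq_poly_eq_iff[symmetric] fun_eq_iff poly_pcompose eq add.commute)
  then have "coeff (smult a (pcompose p [:m, 1:])) (degree p) = coeff (smult b p) (degree p)" by simp
  moreover have "coeff (pcompose p [:m, 1:]) (degree p) = lead_coeff p"
    using lead_coeff_comp[of "[:m, 1:]" p] by simp
  ultimately show ?thesis using assms(2) by auto
qed

lemma periodic_poly_constant:
  assumes eq: "\<And>x. poly p (x + m) = poly p x" and "m \<noteq> (0::complex)"
  shows "p = [:poly p 0:]"
proof -
  have per: "poly p (of_nat k * m) = poly p 0" for k
  proof (induction k)
    case (Suc k)
    then show ?case using eq[of "of_nat k * m"] by (simp add: algebra_simps)
  qed simp
  have "p - [:poly p 0:] = 0"
  proof (rule ccontr)
    assume "p - [:poly p 0:] \<noteq> 0"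
    then have "finite {x. poly (p - [:poly p 0:]) x = 0}" by (rule poly_roots_finite)
    moreover have "range (\<lambda>k. of_nat k * m) \<subseteq> {x. poly (p - [:poly p 0:]) x = 0}" using per by auto
    moreover have "infinite (range (\<lambda>k. of_nat k * m))"
      by (rule range_inj_infinite) (use assms(2) in \<open>auto simp: inj_on_def\<close>)
    ultimately show False using finite_subset by blast
  qed
  then show ?thesis by simp
qed

lemma twisted_difference_surj:
  assumes "a \<noteq> b \<or> (a \<noteq> 0 \<and> m \<noteq> 0)"
  shows "\<exists>p. \<forall>x::complex. a * poly p (x + m) - b * poly p x = poly q x"
proof (induction "degree q" arbitrary: q rule: less_induct)
  case less
  show ?case
  proof (cases "q = 0")
    case True
    then show ?thesis by (intro exI[of _ 0]) simp
  next
    case False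
    let ?T = "\<lambda>p. smult a (pcompose p [:m, 1:]) - smult b p"
    have T: "poly (?T p) x = a * poly p (x + m) - b * poly p x" for p x
      by (simp add: poly_pcompose add.commute)
    have mono: "pcompose (monom c n) [:m, 1:] = smult c ([:m, 1:] ^ n)" for c n
      by (rule poly_eqI[THEN sym], rule arg_cong[where f="\<lambda>q. coeff q _"],
        simp add: poly_eq_poly_eq_iff[symmetric] fun_eq_iff poly_pcompose poly_monom)
    define n where "n = degree q"
    \<comment> \<open>A monomial \<open>p0\<close> whose image has the leading term of \<open>q\<close>: of the same degree if \<open>a \<noteq> b\<close>, and
      of one degree more if \<open>a = b\<close>, because then the leading terms cancel.\<close>
    obtain p0 where p0: "\<And>i. n \<le> i \<Longrightarrow> coeff (?T p0) i = coeff q i"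
    proof (cases "a = b")
      case True
      with assms have am: "a \<noteq> 0" "m \<noteq> 0" by auto
      have "complex_of_nat (Suc n) \<noteq> 0" by (simp only: of_nat_eq_0_iff)
      then have "coeff (?T (monom (coeff q n / (a * m * of_nat (Suc n))) (Suc n))) i = coeff q i" if "n \<le> i" for i
      proof -
        consider "i = n" | "i = Suc n" | "Suc n < i" using \<open>n \<le> i\<close> by linarith
        then show ?thesis
        proof cases
          case 1
          then show ?thesis
            using am \<open>complex_of_nat (Suc n) \<noteq> 0\<close> True
            by (simp add: mono coeff_linear_poly_power del: of_nat_Suc power_Suc)
        next
          case 2
          then show ?thesis
            using True by (simp add: mono coeff_linear_poly_power coeff_eq_0 n_def del: of_nat_Suc power_Suc)
        next
          case 3
          then show ?thesis
            using True coeff_eq_0[of "[:m, 1:] ^ Suc n" i] coeff_eq_0[of "q" i]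
            by (simp add: mono degree_linear_power n_def del: of_nat_Suc power_Suc)
        qed
      qed
      then show ?thesis by (rule that)
    next
      case False
      have "coeff (?T (monom (coeff q n / (a - b)) n)) i = coeff q i" if "n \<le> i" for i
      proof -
        consider "i = n" | "n < i" using \<open>n \<le> i\<close> by linarith
        then show ?thesis
        proof cases
          case 1
          then show ?thesis
            using False by (simp add: mono coeff_linear_poly_power flip: diff_divide_distrib left_diff_distrib)
        next
          case 2
          then show ?thesis
            using coeff_eq_0[of "[:m, 1:] ^ n" i] coeff_eq_0[of "q" i]
            by (simp add: mono degree_linear_power n_def)
        qed
      qed
      then show ?thesis by (rule that)
    qed
    define r where "r = q - ?T p0"
    have r: "coeff r i = 0" if "n \<le> i" for i using p0[OF that] by (simp add: r_def)
    have "\<exists>p. \<forall>x. a * poly p (x + m) - b * poly p x = poly r x"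
    proof (cases "r = 0")
      case True
      then show ?thesis by (intro exI[of _ 0]) simp
    next
      case False
      then have "lead_coeff r \<noteq> 0" by simp
      then have "degree r < degree q" using r[of "degree r"] n_def by (meson not_less)
      then show ?thesis by (rule less)
    qed
    then obtain p where p: "\<And>x. a * poly p (x + m) - b * poly p x = poly r x" by blast
    have "a * poly (p + p0) (x + m) - b * poly (p + p0) x = poly q x" for x
    proof -
      have "poly q x = poly r x + poly (?T p0) x" by (simp add: r_def)
      then show ?thesis unfolding T p[symmetric] by (simp add: algebra_simps)
    qed
    then show ?thesis by blast
  qed
qed

section \<open>Normal forms of the polynomial cocycles\<close>

text \<open>
  The equations for \<open>[B, B]\<close> and \<open>[A, B]\<close>, with the second parameter fixed at a value \<open>m\<close> where the two
  actions of \<open>B\<close> differ, say that \<open>g(\<cdot>, l)\<close> and \<open>f(\<cdot>, l)\<close> are in the kernel of an injective twisted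
  difference operator as soon as \<open>g(\<cdot>, m) = 0\<close>.
\<close>

lemma split_if_B_differs:
  assumes c: "ext_cocycle (symbolA d1 \<alpha> \<beta>) (symbolB d2 \<phi>) (symbolA d1' \<alpha>' \<beta>') (symbolB d2' \<phi>') f g"
    and d: "d1\<^sup>2 = d1" "d1'\<^sup>2 = d1'" "d1 * d2 = 0" "d1' * d2' = 0"
    and ne: "smult d2 \<phi> \<noteq> smult d2' \<phi>'"
  shows "\<exists>p. f = cob_poly (symbolA d1 \<alpha> \<beta>) (symbolA d1' \<alpha>' \<beta>') p \<and> g = cob_poly (symbolB d2 \<phi>) (symbolB d2' \<phi>') p"
proof -
  obtain m where m: "d2 * poly \<phi> m \<noteq> d2' * poly \<phi>' m"
    using ne poly_evals_eqI[of "smult d2 \<phi>" "smult d2' \<phi>'"] by auto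
  obtain p where p: "\<And>x. d2 * poly \<phi> m * poly p (x + m) - d2' * poly \<phi>' m * poly p x = ev2 g x m"
    using twisted_difference_surj[of "d2 * poly \<phi> m" "d2' * poly \<phi>' m" m "poly g [:m:]"] m
    unfolding ev2_def by blast
  define f' g' where "f' = f - cob_poly (symbolA d1 \<alpha> \<beta>) (symbolA d1' \<alpha>' \<beta>') p"
    and "g' = g - cob_poly (symbolB d2 \<phi>) (symbolB d2' \<phi>') p"
  have c': "ext_cocycle (symbolA d1 \<alpha> \<beta>) (symbolB d2 \<phi>) (symbolA d1' \<alpha>' \<beta>') (symbolB d2' \<phi>') f' g'"
    unfolding f'_def g'_def by (rule ext_cocycle_subtract_cob[OF c d])
  have gm: "ev2 g' x m = 0" for x using p[of x] by (simp add: g'_def)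
  have "poly g' [:l:] = 0" for l
  proof (rule twisted_difference_inj[OF _ m])
    show "d2 * poly \<phi> m * poly (poly g' [:l:]) (x + m) = d2' * poly \<phi>' m * poly (poly g' [:l:]) x" for x
    proof -
      have "jacobi_defect (symbolB d2 \<phi>) (symbolB d2' \<phi>') g' (symbolB d2 \<phi>) (symbolB d2' \<phi>') g' x l m = 0"
        using c' unfolding ext_cocycle_def by blast
      then show ?thesis by (simp add: jacobi_defect_def gm flip: ev2_def)
    qed
  qed
  then have g': "g' = 0" by (rule poly_const_zero_imp_zero)
  have "poly f' [:l:] = 0" for l
  proof (rule twisted_difference_inj[OF _ m])
    show "d2 * poly \<phi> m * poly (poly f' [:l:]) (x + m) = d2' * poly \<phi>' m * poly (poly f' [:l:]) x" for x
    proof -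
      have "jacobi_defect (symbolA d1 \<alpha> \<beta>) (symbolA d1' \<alpha>' \<beta>') f' (symbolB d2 \<phi>) (symbolB d2' \<phi>') g' x l m = 0"
        using c' unfolding ext_cocycle_def by blast
      then show ?thesis by (simp add: jacobi_defect_def g' flip: ev2_def)
    qed
  qed
  then have "f' = 0" by (rule poly_const_zero_imp_zero)
  with g' show ?thesis unfolding f'_def g'_def by auto
qed

text \<open>
  Once \<open>g(\<cdot>, m) = 0\<close> for one \<open>m\<close> with \<open>m \<noteq> 0\<close> and \<open>\<phi>(m) \<noteq> 0\<close>, the equation for \<open>[B, B]\<close> says that every
  \<open>g(\<cdot>, l)\<close> is \<open>m\<close>-periodic, hence constant.
\<close>

lemma normal_form_B_equal:
  assumes c: "ext_cocycle (symbolA 0 \<alpha> \<beta>) (symbolB 1 \<phi>) (symbolA 0 \<alpha>' \<beta>') (symbolB 1 \<phi>) f g"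
    and \<phi>: "\<phi> \<noteq> 0"
  shows "f = 0" and "\<exists>p t. g - cob_poly (symbolB 1 \<phi>) (symbolB 1 \<phi>) p = lam_poly t"
proof -
  show "f = 0"
  proof (rule ev2_eqI)
    fix x l
    have eq: "(l - m) * ev2 f x (l + m) = 0" for l m
      using c unfolding ext_cocycle_def jacobi_defect_def by simp
    \<comment> \<open>Two decompositions of \<open>l\<close>, at least one of them into distinct summands.\<close>
    show "ev2 f x l = ev2 0 x l"
      using eq[of "l + 1" "- 1"] eq[of "l - 1" 1] by (cases "l = -2") auto
  qed
  have "finite {m. poly ([:0, 1:] * \<phi>) m = 0}" using \<phi> by (intro poly_roots_finite) auto
  from ex_new_if_finite[OF infinite_UNIV_char_0 this]
  obtain m where m: "m \<noteq> 0" "poly \<phi> m \<noteq> 0" by auto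
  obtain p where p: "\<And>x. poly \<phi> m * poly p (x + m) - poly \<phi> m * poly p x = ev2 g x m"
    using twisted_difference_surj[of "poly \<phi> m" "poly \<phi> m" m "poly g [:m:]"] m
    unfolding ev2_def by blast
  define g' where "g' = g - cob_poly (symbolB 1 \<phi>) (symbolB 1 \<phi>) p"
  have c': "ext_cocycle (symbolA 0 \<alpha> \<beta>) (symbolB 1 \<phi>) (symbolA 0 \<alpha>' \<beta>') (symbolB 1 \<phi>)
     (f - cob_poly (symbolA 0 \<alpha> \<beta>) (symbolA 0 \<alpha>' \<beta>') p) g'"
    unfolding g'_def by (rule ext_cocycle_subtract_cob[OF c]) auto
  have gm: "ev2 g' x m = 0" for x using p[of x] by (simp add: g'_def)
  define t where "t = map_poly (\<lambda>q. poly q 0) g'"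
  have t: "poly t l = ev2 g' 0 l" for l
    unfolding t_def ev2_def by (induction g') (auto simp: map_poly_pCons)
  have "poly g' [:l:] = [:poly (poly g' [:l:]) 0:]" for l
  proof (rule periodic_poly_constant[OF _ m(1)])
    show "poly (poly g' [:l:]) (x + m) = poly (poly g' [:l:]) x" for x
    proof -
      have "jacobi_defect (symbolB 1 \<phi>) (symbolB 1 \<phi>) g' (symbolB 1 \<phi>) (symbolB 1 \<phi>) g' x l m = 0"
        using c' unfolding ext_cocycle_def by blast
      then have "poly \<phi> m * (ev2 g' x l - ev2 g' (x + m) l) = 0"
        by (simp add: jacobi_defect_def gm algebra_simps)
      then show ?thesis using m(2) by (simp add: ev2_def)
    qed
  qed
  then have "poly (poly g' [:l:]) x = poly [:poly (poly g' [:l:]) 0:] x" for x l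
    by (rule arg_cong)
  then have "ev2 g' x l = ev2 g' 0 l" for x l
    by (simp add: ev2_def)
  then have "ev2 g' x l = ev2 (lam_poly t) x l" for x l
    by (simp only: ev2_lam_poly t)
  then have "g' = lam_poly t" by (rule ev2_eqI)
  then show "\<exists>p t. g - cob_poly (symbolB 1 \<phi>) (symbolB 1 \<phi>) p = lam_poly t"
    unfolding g'_def by blast
qed

lemma lam_poly_cocycle:
  "ext_cocycle (symbolA 0 \<alpha> \<beta>) (symbolB 1 \<phi>) (symbolA 0 \<alpha>' \<beta>') (symbolB 1 \<phi>) 0 (lam_poly t)"
  unfolding ext_cocycle_def jacobi_defect_def by simp

lemma lam_multiple_coboundary:
  "lam_poly (smult k ([:0, 1:] * \<phi>)) = cob_poly (symbolB 1 \<phi>) (symbolB 1 \<phi>) (smult k [:0, 1:])"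
  by (rule ev2_eqI) (simp add: algebra_simps)

text \<open>
  The increments \<open>p(x + m) - p(x)\<close> are independent of \<open>x\<close>, so \<open>p\<close> minus a linear polynomial is
  periodic and \<open>p\<close> has degree at most one.
\<close>

lemma lam_multiple_if_coboundary:
  fixes \<phi> :: "complex poly"
  assumes \<phi>: "\<phi> \<noteq> 0" and eq: "\<And>x l. poly t l = poly \<phi> l * (poly p (x + l) - poly p x)"
  shows "\<exists>k. t = smult k ([:0, 1:] * \<phi>)"
proof -
  have "finite {m. poly ([:0, 1:] * \<phi>) m = 0}" using \<phi> by (intro poly_roots_finite) auto
  from ex_new_if_finite[OF infinite_UNIV_char_0 this]
  obtain m where m: "m \<noteq> 0" "poly \<phi> m \<noteq> 0" by auto
  define k where "k = (poly p m - poly p 0) / m"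
  let ?r = "p - smult k [:0, 1:]"
  have per: "poly ?r (x + m) = poly ?r x" for x
  proof -
    have "poly \<phi> m * (poly p (x + m) - poly p x) = poly \<phi> m * (poly p m - poly p 0)"
      using eq[of m x] eq[of m 0] by (simp only: add_0)
    then have "poly p (x + m) - poly p x = poly p m - poly p 0" using m by simp
    moreover have "k * m = poly p m - poly p 0" using m by (simp add: k_def)
    ultimately have "poly p (x + m) = poly p x + k * m" by (metis diff_add_cancel add.commute)
    then show ?thesis by (simp add: algebra_simps)
  qed
  have r: "?r = [:poly ?r 0:]" by (rule periodic_poly_constant[OF per m(1)])
  have p: "poly p l - poly p 0 = k * l" for l
  proof -
    have "poly ?r l = poly ?r 0" by (subst r) simp
    then show ?thesis by (simp add: algebra_simps)
  qed
  have "t = smult k ([:0, 1:] * \<phi>)"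
  proof (rule poly_evals_eqI)
    fix x
    show "poly t x = poly (smult k ([:0, 1:] * \<phi>)) x"
      using eq[of x 0] p[of x] by simp
  qed
  then show ?thesis by blast
qed

lemma subcase_vi_iff: "subcase_vi \<alpha> \<alpha>' \<longleftrightarrow> \<alpha>' = \<alpha> + 6 \<and> 2 * \<alpha>\<^sup>2 + 10 * \<alpha> + 3 = 0"
proof -
  define r where "r = complex_of_real (sqrt 19)"
  have r: "r * r = 19" unfolding r_def by (simp flip: of_real_mult)
  have "2 * \<alpha>\<^sup>2 + 10 * \<alpha> + 3 = 2 * ((\<alpha> - (-5/2 + r/2)) * (\<alpha> - (- (r/2) - 5/2)))"
    using r by (simp add: field_simps power2_eq_square)
  then have "2 * \<alpha>\<^sup>2 + 10 * \<alpha> + 3 = 0 \<longleftrightarrow> \<alpha> = -5/2 + r/2 \<or> \<alpha> = - (r/2) - 5/2"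
    by (simp only: mult_eq_0_iff right_minus_eq zero_neq_numeral[symmetric] simp_thms)
  moreover have "subcase_vi \<alpha> \<alpha>' \<longleftrightarrow>
      (\<alpha>' = 7/2 + r/2 \<and> \<alpha> = -5/2 + r/2) \<or> (\<alpha>' = 7/2 - r/2 \<and> \<alpha> = - (r/2) - 5/2)"
    unfolding subcase_vi_def r_def[symmetric] by simp
  moreover have "7/2 + r/2 = -5/2 + r/2 + 6" "7/2 - r/2 = - (r/2) - 5/2 + 6" by simp_all
  ultimately show ?thesis by metis
qed

lemma std_cocycle_disjunction:
  "(\<exists>n e s. (n = 2 \<and> e = E2 \<or> n = 3 \<and> e = E3 \<or> n = 4 \<and> e = E4 \<or> n = 5 \<and> \<alpha> = -4 \<and> e = E5 \<or> n = 6 \<and> Q \<and> e = E6)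
      \<and> \<alpha>' = \<alpha> + of_nat n \<and> s \<noteq> (0::complex) \<and> Pr e s) \<longleftrightarrow>
   (\<alpha>' = \<alpha> + 2 \<and> (\<exists>s. s \<noteq> 0 \<and> Pr E2 s)) \<or> (\<alpha>' = \<alpha> + 3 \<and> (\<exists>s. s \<noteq> 0 \<and> Pr E3 s)) \<or>
   (\<alpha>' = \<alpha> + 4 \<and> (\<exists>s. s \<noteq> 0 \<and> Pr E4 s)) \<or> (\<alpha>' = \<alpha> + (5::complex) \<and> \<alpha> = -4 \<and> (\<exists>s. s \<noteq> 0 \<and> Pr E5 s)) \<or>
   ((\<alpha>' = \<alpha> + 6 \<and> Q) \<and> (\<exists>s. s \<noteq> 0 \<and> Pr E6 s))"
  by (simp only: conj_disj_distribR ex_disj_distrib conj_assoc ex_simps simp_thms of_nat_numeral) blast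

lemma case_one_f_iff:
  "case_one_f \<alpha> \<beta> \<alpha>' f \<longleftrightarrow>
     (\<alpha>' = \<alpha> \<and> (\<exists>s0 s1. (s0, s1) \<noteq> (0, 0) \<and> (\<forall>x l. ev2 f x l = s0 + s1 * l))) \<or>
     (\<exists>n e s. std_cocycle \<alpha> n e \<and> \<alpha>' = \<alpha> + of_nat n \<and> s \<noteq> 0 \<and> (\<forall>x l. ev2 f x l = s * ev2 e (x + \<beta>) l))"
proof -
  have ev: "f = g \<longleftrightarrow> (\<forall>x l. ev2 f x l = ev2 g x l)" for f g using ev2_eqI by blast
  have ii: "ev2 (cst s * lam^2 * (2 * der_plus \<beta> + lam)) x l
      = s * ev2 [:0, 0, [:0, 2:], [:1:]:] (x + \<beta>) l" for s x l
    by simp algebra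
  have iii: "ev2 (cst s * der_plus \<beta> * lam^2 * (der_plus \<beta> + lam)) x l
      = s * ev2 [:0, 0, [:0, 0, 1:], [:0, 1:]:] (x + \<beta>) l" for s x l
    by simp algebra
  have iv: "ev2 (cst s * lam^2 * (4 * der_plus \<beta>^3 + 6 * der_plus \<beta>^2 * lam - der_plus \<beta> * lam^2 + cst \<alpha> * lam^3)) x l
      = s * ev2 [:0, 0, [:0, 0, 0, 4:], [:0, 0, 6:], [:0, -1:], [:\<alpha>:]:] (x + \<beta>) l" for s x l
    by simp algebra
  have v: "ev2 (cst s * (der_plus \<beta>^4 * lam^2 - 10 * der_plus \<beta>^2 * lam^4 - 17 * der_plus \<beta> * lam^5 - 8 * lam^6)) x l
      = s * ev2 [:0, 0, [:0, 0, 0, 0, 1:], 0, [:0, 0, -10:], [:0, -17:], [:-8:]:] (x + \<beta>) l" for s x l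
    by simp algebra
  have vi: "ev2 (cst s * (der_plus \<beta>^4 * lam^3 - cst (2 * \<alpha> + 3) * der_plus \<beta>^3 * lam^4
          - cst (3 * \<alpha>) * der_plus \<beta>^2 * lam^5 - cst (3 * \<alpha> + 1) * der_plus \<beta> * lam^6
          - cst (\<alpha> + 9/28) * lam^7)) x l
      = s * ev2 [:0, 0, 0, [:0, 0, 0, 0, 1:], [:0, 0, 0, - (2 * \<alpha> + 3):], [:0, 0, - (3 * \<alpha>):],
            [:0, - (3 * \<alpha> + 1):], [:- (\<alpha> + 9/28):]:] (x + \<beta>) l" for s x l
  proof -
    have "ev2 [:0, 0, 0, [:0, 0, 0, 0, 1:], [:0, 0, 0, - (2 * \<alpha> + 3):], [:0, 0, - (3 * \<alpha>):],
            [:0, - (3 * \<alpha> + 1):], [:- c:]:] (x + \<beta>) l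
        = ev2 (der_plus \<beta>^4 * lam^3 - cst (2 * \<alpha> + 3) * der_plus \<beta>^3 * lam^4
          - cst (3 * \<alpha>) * der_plus \<beta>^2 * lam^5 - cst (3 * \<alpha> + 1) * der_plus \<beta> * lam^6
          - cst c * lam^7) x l" for c
      by simp algebra
    then show ?thesis by (simp only: ev2_simps poly_pCons poly_0 mult_zero_right add_0_right)
  qed
  have std: "(\<exists>n e s. std_cocycle \<alpha> n e \<and> \<alpha>' = \<alpha> + of_nat n \<and> s \<noteq> 0 \<and> Pr e s) \<longleftrightarrow>
      (\<alpha>' - \<alpha> = 2 \<and> (\<exists>s. s \<noteq> 0 \<and> Pr [:0, 0, [:0, 2:], [:1:]:] s)) \<or>
      (\<alpha>' - \<alpha> = 3 \<and> (\<exists>s. s \<noteq> 0 \<and> Pr [:0, 0, [:0, 0, 1:], [:0, 1:]:] s)) \<or>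
      (\<alpha>' - \<alpha> = 4 \<and> (\<exists>s. s \<noteq> 0 \<and> Pr [:0, 0, [:0, 0, 0, 4:], [:0, 0, 6:], [:0, -1:], [:\<alpha>:]:] s)) \<or>
      (\<alpha>' = 1 \<and> \<alpha> = -4 \<and> (\<exists>s. s \<noteq> 0 \<and>
         Pr [:0, 0, [:0, 0, 0, 0, 1:], 0, [:0, 0, -10:], [:0, -17:], [:-8:]:] s)) \<or>
      (subcase_vi \<alpha> \<alpha>' \<and> (\<exists>s. s \<noteq> 0 \<and>
         Pr [:0, 0, 0, [:0, 0, 0, 0, 1:], [:0, 0, 0, - (2 * \<alpha> + 3):], [:0, 0, - (3 * \<alpha>):],
            [:0, - (3 * \<alpha> + 1):], [:- (\<alpha> + 9/28):]:] s))" for Pr :: "complex poly poly \<Rightarrow> complex \<Rightarrow> bool"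
  proof -
    have \<alpha>': "\<alpha>' - \<alpha> = c \<longleftrightarrow> \<alpha>' = \<alpha> + c" for c by (auto simp: algebra_simps)
    have five: "\<alpha>' = 1 \<and> \<alpha> = -4 \<and> P \<longleftrightarrow> \<alpha>' = \<alpha> + 5 \<and> \<alpha> = -4 \<and> P" for P by auto
    show ?thesis
      unfolding std_cocycle_def subcase_vi_iff \<alpha>' five by (rule std_cocycle_disjunction[where Pr = Pr])
  qed
  have i: "ev2 (cst s0 + cst s1 * lam) x l = s0 + s1 * l" for s0 s1 x l by simp
  show ?thesis
    unfolding case_one_f_def Let_def std ev[of f] i ii iii iv v vi ..
qed

lemma case_one_f_weights:
  assumes "case_one_f \<alpha> \<beta> \<alpha>' f"
  shows "\<alpha>' - \<alpha> \<in> {0, 1, 2, 3, 4, 5, 6}"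
  using assms unfolding case_one_f_iff std_cocycle_def by auto

definition shift_inner :: "complex \<Rightarrow> complex poly poly \<Rightarrow> complex poly poly"
  where "shift_inner b f = map_poly (\<lambda>q. pcompose q [:b, 1:]) f"

lemma ev2_shift_inner [simp]: "ev2 (shift_inner b f) x l = ev2 f (x + b) l"
  unfolding shift_inner_def
  by (induction f) (auto simp: map_poly_pCons poly_pcompose add.commute)

lemma case_one_f_std:
  assumes "std_cocycle \<alpha> n e" "\<alpha>' = \<alpha> + of_nat n" "s \<noteq> 0"
  shows "case_one_f \<alpha> \<beta> \<alpha>' (smult [:s:] (shift_inner \<beta> e))"
  unfolding case_one_f_iff using assms by auto

lemma ext_cocycle_vir_iff:
  "ext_cocycle (symbolA 1 \<alpha> \<beta>) (symbolB 0 \<phi>) (symbolA 1 \<alpha>' \<beta>) (symbolB 0 \<phi>') f 0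
     \<longleftrightarrow> vir_cocycle \<alpha> \<alpha>' (ev2 (shift_inner (- \<beta>) f))"
proof
  assume L: "ext_cocycle (symbolA 1 \<alpha> \<beta>) (symbolB 0 \<phi>) (symbolA 1 \<alpha>' \<beta>) (symbolB 0 \<phi>') f 0"
  show "vir_cocycle \<alpha> \<alpha>' (ev2 (shift_inner (- \<beta>) f))"
    unfolding vir_cocycle_def
  proof (intro allI)
    fix x l m
    have "jacobi_defect (symbolA 1 \<alpha> \<beta>) (symbolA 1 \<alpha>' \<beta>) f (symbolA 1 \<alpha> \<beta>) (symbolA 1 \<alpha>' \<beta>) f (x - \<beta>) l m
        = (l - m) * ev2 f (x - \<beta>) (l + m)"
      using L unfolding ext_cocycle_def by blast
    then show "(x + l + \<alpha>' * m) * ev2 (shift_inner (- \<beta>) f) x l + (x + \<alpha> * l) * ev2 (shift_inner (- \<beta>) f) (x + l) m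
       - (x + m + \<alpha>' * l) * ev2 (shift_inner (- \<beta>) f) x m - (x + \<alpha> * m) * ev2 (shift_inner (- \<beta>) f) (x + m) l
       = (l - m) * ev2 (shift_inner (- \<beta>) f) x (l + m)"
      by (simp add: jacobi_defect_def algebra_simps)
  qed
next
  assume R: "vir_cocycle \<alpha> \<alpha>' (ev2 (shift_inner (- \<beta>) f))"
  have "jacobi_defect (symbolA 1 \<alpha> \<beta>) (symbolA 1 \<alpha>' \<beta>) f (symbolA 1 \<alpha> \<beta>) (symbolA 1 \<alpha>' \<beta>) f x l m
        = (l - m) * ev2 f x (l + m)" for x l m
  proof -
    have "(x + \<beta> + l + \<alpha>' * m) * ev2 (shift_inner (- \<beta>) f) (x + \<beta>) l
       + (x + \<beta> + \<alpha> * l) * ev2 (shift_inner (- \<beta>) f) (x + \<beta> + l) m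
       - (x + \<beta> + m + \<alpha>' * l) * ev2 (shift_inner (- \<beta>) f) (x + \<beta>) m
       - (x + \<beta> + \<alpha> * m) * ev2 (shift_inner (- \<beta>) f) (x + \<beta> + m) l
       = (l - m) * ev2 (shift_inner (- \<beta>) f) (x + \<beta>) (l + m)"
      using R unfolding vir_cocycle_def by blast
    moreover have "x + \<beta> + l - \<beta> = x + l" "x + \<beta> + m - \<beta> = x + m" by simp_all
    ultimately show ?thesis by (simp add: jacobi_defect_def algebra_simps)
  qed
  then show "ext_cocycle (symbolA 1 \<alpha> \<beta>) (symbolB 0 \<phi>) (symbolA 1 \<alpha>' \<beta>) (symbolB 0 \<phi>') f 0"
    unfolding ext_cocycle_def by (auto simp: jacobi_defect_def)
qed

lemma vir_B_zero:
  assumes "ext_cocycle (symbolA 1 \<alpha> \<beta>) (symbolB 0 \<phi>) (symbolA 1 \<alpha>' \<beta>') (symbolB 0 \<phi>') f g"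
  shows "g = 0"
proof -
  \<comment> \<open>The equation for \<open>[A, B]\<close> at \<open>l = 0\<close> reads \<open>(\<beta> - \<beta>' - m) g(x, m) = 0\<close>.\<close>
  have "[:[:\<beta> - \<beta>':], [:-1:]:] * g = 0"
  proof (rule ev2_eqI)
    fix x m
    have "jacobi_defect (symbolA 1 \<alpha> \<beta>) (symbolA 1 \<alpha>' \<beta>') f (symbolB 0 \<phi>) (symbolB 0 \<phi>') g x 0 m = 0"
      using assms unfolding ext_cocycle_def by blast
    then show "ev2 ([:[:\<beta> - \<beta>':], [:-1:]:] * g) x m = ev2 0 x m"
      by (simp add: jacobi_defect_def algebra_simps)
  qed
  then have "[:[:\<beta> - \<beta>':], [:-1:]:] = 0 \<or> g = 0" by (rule mult_eq_0_iff[THEN iffD1])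
  then show ?thesis by simp
qed

text \<open>
  At \<open>l = 0\<close> the cocycle equation reads \<open>(\<beta> - \<beta>') f =\<close> coboundary of \<open>f(\<cdot>, 0)\<close>.
\<close>

lemma vir_split_if_beta_differs:
  assumes "ext_cocycle (symbolA 1 \<alpha> \<beta>) (symbolB 0 \<phi>) (symbolA 1 \<alpha>' \<beta>') (symbolB 0 \<phi>') f g" and "\<beta> \<noteq> \<beta>'"
  shows "\<exists>p. f = cob_poly (symbolA 1 \<alpha> \<beta>) (symbolA 1 \<alpha>' \<beta>') p"
proof
  let ?p = "smult (inverse (\<beta> - \<beta>')) (coeff f 0)"
  have f0: "ev2 f x 0 = poly (coeff f 0) x" for x by (simp add: ev2_def poly_0_coeff_0)
  show "f = cob_poly (symbolA 1 \<alpha> \<beta>) (symbolA 1 \<alpha>' \<beta>') ?p"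
  proof (rule ev2_eqI)
    fix x m
    have "jacobi_defect (symbolA 1 \<alpha> \<beta>) (symbolA 1 \<alpha>' \<beta>') f (symbolA 1 \<alpha> \<beta>) (symbolA 1 \<alpha>' \<beta>') f x 0 m
        = (0 - m) * ev2 f x (0 + m)"
      using assms(1) unfolding ext_cocycle_def by blast
    then have "(\<beta> - \<beta>') * ev2 f x m
        = (x + \<alpha> * m + \<beta>) * poly (coeff f 0) (x + m) - (x + \<alpha>' * m + \<beta>') * poly (coeff f 0) x"
      by (simp add: jacobi_defect_def f0 algebra_simps)
    then have "ev2 f x m
        = ((x + \<alpha> * m + \<beta>) * poly (coeff f 0) (x + m) - (x + \<alpha>' * m + \<beta>') * poly (coeff f 0) x) / (\<beta> - \<beta>')"
      using assms(2) by (metis nonzero_mult_div_cancel_left right_minus_eq)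
    then show "ev2 f x m = ev2 (cob_poly (symbolA 1 \<alpha> \<beta>) (symbolA 1 \<alpha>' \<beta>') ?p) x m"
      by (simp add: divide_inverse algebra_simps)
  qed
qed

lemma vir_normal_form:
  assumes c: "ext_cocycle (symbolA 1 \<alpha> \<beta>) (symbolB 0 \<phi>) (symbolA 1 \<alpha>' \<beta>) (symbolB 0 \<phi>') f g"
    and \<alpha>: "\<alpha> \<noteq> 0"
  shows "\<exists>p. f - cob_poly (symbolA 1 \<alpha> \<beta>) (symbolA 1 \<alpha>' \<beta>) p = 0 \<or>
    case_one_f \<alpha> \<beta> \<alpha>' (f - cob_poly (symbolA 1 \<alpha> \<beta>) (symbolA 1 \<alpha>' \<beta>) p)"
proof -
  let ?cob = "cob_poly (symbolA 1 \<alpha> \<beta>) (symbolA 1 \<alpha>' \<beta>)"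
  let ?f = "shift_inner (- \<beta>) f"
  have v: "vir_cocycle \<alpha> \<alpha>' (ev2 ?f)"
    using c vir_B_zero[OF c] ext_cocycle_vir_iff by metis
  have unshift: "ev2 f x l = ev2 ?f (x + \<beta>) l" for x l by simp
  have cobE: "vir_cob \<alpha> \<alpha>' p (x + \<beta>) l = ev2 (?cob (pcompose p [:\<beta>, 1:])) x l" for p x l
    by (simp add: vir_cob_def poly_pcompose algebra_simps)
  show ?thesis
  proof (cases "\<alpha>' = \<alpha>")
    case True
    obtain p s0 s1 where p: "\<And>x l. ev2 ?f x l = vir_cob \<alpha> \<alpha>' p x l + (s0 + s1 * l)"
      using vir_classify_equal_weight[OF _ \<alpha>] v True by metis
    have r: "ev2 (f - ?cob (pcompose p [:\<beta>, 1:])) x l = s0 + s1 * l" for x l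
      using p[of "x + \<beta>" l] unfolding unshift[symmetric] cobE by simp
    show ?thesis
    proof (cases "(s0, s1) = (0, 0)")
      case True
      then have "f - ?cob (pcompose p [:\<beta>, 1:]) = 0" using r by (intro ev2_eqI) simp
      then show ?thesis by blast
    next
      case False
      then have "case_one_f \<alpha> \<beta> \<alpha>' (f - ?cob (pcompose p [:\<beta>, 1:]))"
        unfolding case_one_f_iff using r True by blast
      then show ?thesis by blast
    qed
  next
    case False
    from v \<alpha> False show ?thesis
    proof (cases rule: vir_classify_distinct_weights)
      case (1 p)
      have "f - ?cob (pcompose p [:\<beta>, 1:]) = 0"
        using 1[of "_ + \<beta>"] unfolding unshift[symmetric] cobE by (intro ev2_eqI) simp
      then show ?thesis by blast
    next
      case (2 n e p s)
      have r: "ev2 (f - ?cob (pcompose p [:\<beta>, 1:])) x l = s * ev2 e (x + \<beta>) l" for x l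
        using 2(3)[of "x + \<beta>" l] unfolding unshift[symmetric] cobE by simp
      show ?thesis
      proof (cases "s = 0")
        case True
        then have "f - ?cob (pcompose p [:\<beta>, 1:]) = 0" using r by (intro ev2_eqI) simp
        then show ?thesis by blast
      next
        case False
        then have "case_one_f \<alpha> \<beta> \<alpha>' (f - ?cob (pcompose p [:\<beta>, 1:]))"
          unfolding case_one_f_iff using r 2 by blast
        then show ?thesis by blast
      qed
    qed
  qed
qed

lemma case_one_f_cocycle:
  assumes "case_one_f \<alpha> \<beta> \<alpha>' f"
  shows "ext_cocycle (symbolA 1 \<alpha> \<beta>) (symbolB 0 \<phi>) (symbolA 1 \<alpha>' \<beta>) (symbolB 0 \<phi>') f 0"
  unfolding ext_cocycle_vir_iff
proof -
  from assms[unfolded case_one_f_iff]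
  show "vir_cocycle \<alpha> \<alpha>' (ev2 (shift_inner (- \<beta>) f))"
  proof (elim disjE conjE exE)
    fix s0 s1 assume "\<alpha>' = \<alpha>" "\<forall>x l. ev2 f x l = s0 + s1 * l"
    then show ?thesis by (simp add: vir_cocycle_def algebra_simps)
  next
    fix n e s assume e: "std_cocycle \<alpha> n e" "\<alpha>' = \<alpha> + of_nat n" "\<forall>x l. ev2 f x l = s * ev2 e (x + \<beta>) l"
    have "ev2 (shift_inner (- \<beta>) f) = (\<lambda>x l. ev2 0 x l + s * ev2 e x l)"
      by (intro ext) (simp add: e(3))
    then show ?thesis
      using vir_cocycle_combine[OF _ std_cocycle_cocycle[OF e(1)], of "ev2 0" s]
      by (simp add: e(2) vir_cocycle_def)
  qed
qed

lemma case_one_f_nontrivial: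
  assumes f: "case_one_f \<alpha> \<beta> \<alpha>' f" and \<alpha>: "\<alpha> \<noteq> 0"
  shows "f \<noteq> cob_poly (symbolA 1 \<alpha> \<beta>) (symbolA 1 \<alpha>' \<beta>) p"
proof
  assume eq: "f = cob_poly (symbolA 1 \<alpha> \<beta>) (symbolA 1 \<alpha>' \<beta>) p"
  from f[unfolded case_one_f_iff] show False
  proof (elim disjE conjE exE)
    fix s0 s1 assume *: "\<alpha>' = \<alpha>" "(s0, s1) \<noteq> (0, 0)" "\<forall>x l. ev2 f x l = s0 + s1 * l"
    have F: "s0 + s1 * l = (x + \<alpha> * l + \<beta>) * (poly p (x + l) - poly p x)" for x l
      using *(3)[rule_format, of x l] unfolding eq by (simp add: *(1) algebra_simps)
    \<comment> \<open>For each \<open>l\<close> the factor \<open>x + \<alpha>l + \<beta>\<close> has a zero, and the left-hand side is independent of \<open>x\<close>.\<close>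
    have "s0 + s1 * l = 0" for l
      using F[of l "- (\<alpha> * l + \<beta>)"] by simp
    from this[of 0] this[of 1] have "s0 = 0" "s1 = 0" by simp_all
    with *(2) show False by simp
  next
    fix n e s assume *: "std_cocycle \<alpha> n e" "\<alpha>' = \<alpha> + of_nat n" "s \<noteq> 0" "\<forall>x l. ev2 f x l = s * ev2 e (x + \<beta>) l"
    have "s * ev2 e x l = vir_cob \<alpha> (\<alpha> + of_nat n) (pcompose p [:- \<beta>, 1:]) x l" for x l
      using *(4)[rule_format, of "x - \<beta>" l] unfolding eq
      by (simp add: *(2) vir_cob_def poly_pcompose algebra_simps)
    from std_cocycle_nontrivial[OF *(1) \<alpha> this] *(3) show False by simp
  qed
qed

section \<open>Modules over the polynomial ring and values of polynomials\<close>

locale der_module = module S for S :: "complex poly \<Rightarrow> 'v::ab_group_add \<Rightarrow> 'v"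

begin

lemma subst_lambda_bound:
  assumes "degree p \<le> n"
  shows "subst_lambda S p q = (\<Sum>i\<le>n. S (q ^ i) (coeff p i))"
  unfolding subst_lambda_def
  by (rule sum.mono_neutral_left) (use assms in \<open>auto simp: coeff_eq_0\<close>)

lemma subst_lambda_0 [simp]: "subst_lambda S 0 q = 0"
  by (simp add: subst_lambda_def)

lemma subst_lambda_pCons [simp]: "subst_lambda S (pCons a p) q = a + S q (subst_lambda S p q)"
proof -
  have "subst_lambda S (pCons a p) q = (\<Sum>i\<le>Suc (degree p). S (q ^ i) (coeff (pCons a p) i))"
    by (rule subst_lambda_bound) (simp add: degree_pCons_le)
  also have "\<dots> = a + S q (subst_lambda S p q)"
    by (simp add: sum.atMost_Suc_shift subst_lambda_def scale_sum_right del: sum.atMost_Suc)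
  finally show ?thesis .
qed

lemma subst_lambda_add [simp]: "subst_lambda S (p + r) q = subst_lambda S p q + subst_lambda S r q"
proof (induction p r rule: poly_induct2)
  case (pCons a p b r)
  then show ?case by (simp add: scale_right_distrib)
qed simp

lemma subst_lambda_minus [simp]: "subst_lambda S (- p) q = - subst_lambda S p q"
  using subst_lambda_add[of p "- p" q] by (simp add: eq_neg_iff_add_eq_0 add.commute)

lemma subst_lambda_diff [simp]: "subst_lambda S (p - r) q = subst_lambda S p q - subst_lambda S r q"
  using subst_lambda_add[of p "- r" q] by simp

lemma module_hom_scale: "module_hom S S (S q)"
  by (simp add: module_hom_iff module_axioms scale_right_distrib mult.commute)

text \<open>
  A Vandermonde argument without determinants: if the values at all \<open>l\<close> vanish, then so does the value
  at \<open>2l\<close> minus \<open>2^n\<close> times the value at \<open>l\<close>, in which the term of top degree \<open>n\<close> has disappeared.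
\<close>

lemma vanishing_values:
  assumes "\<And>l. (\<Sum>i\<le>n. S [:l ^ i:] (c i)) = 0" "i \<le> n"
  shows "c i = 0"
  using assms
proof (induction n arbitrary: c i)
  case 0
  then show ?case using "0.prems"(1)[of 1] by (simp flip: one_pCons)
next
  case (Suc n)
  let ?c = "\<lambda>i. S [:2 ^ i - 2 ^ Suc n:] (c i)"
  have "(\<Sum>i\<le>n. S [:l ^ i:] (?c i)) = 0" for l
  proof -
    have "(\<Sum>i\<le>n. S [:l ^ i:] (?c i)) = (\<Sum>i\<le>Suc n. S [:l ^ i:] (?c i))"
      by simp
    also have "\<dots> = (\<Sum>i\<le>Suc n. S [:(2 * l) ^ i:] (c i) - S [:2 ^ Suc n:] (S [:l ^ i:] (c i)))"
      by (rule sum.cong) (simp_all add: algebra_simps power_mult_distrib flip: scale_left_diff_distrib)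
    also have "\<dots> = 0"
      using Suc.prems(1)[of "2 * l"] Suc.prems(1)[of l]
      by (simp only: sum_subtractf scale_sum_right[symmetric] scale_zero_right diff_zero)
    finally show ?thesis .
  qed
  from Suc.IH[OF this] have z: "?c j = 0" if "j \<le> n" for j using that by blast
  have low: "c j = 0" if "j \<le> n" for j
  proof -
    have "(2::nat) ^ j < 2 ^ Suc n" using that by (intro power_strict_increasing) auto
    then have "complex_of_nat (2 ^ j) \<noteq> of_nat (2 ^ Suc n)" by (simp only: of_nat_eq_iff)
    then have "(2::complex) ^ j \<noteq> 2 ^ Suc n" by (simp only: of_nat_power of_nat_numeral not_False_eq_True)
    then have "S [:inverse (2 ^ j - 2 ^ Suc n):] (?c j) = c j"
      by (simp flip: one_pCons)
    with z[OF that] show ?thesis by simp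
  qed
  have "c (Suc n) = 0"
    using Suc.prems(1)[of 1] low by (simp flip: one_pCons)
  with low Suc.prems(2) show ?case by (cases "i = Suc n") auto
qed

lemma subst_lambda_eqI:
  assumes "\<And>l. subst_lambda S p [:l:] = subst_lambda S r [:l:]"
  shows "p = r"
proof -
  have "(\<Sum>i\<le>degree (p - r). S [:l ^ i:] (coeff (p - r) i)) = 0" for l
    using assms[of l] subst_lambda_diff[of p r "[:l:]"]
    by (simp add: subst_lambda_def poly_const_pow)
  from vanishing_values[OF this] have "coeff (p - r) i = 0" for i
    using coeff_eq_0[of "p - r" i] by (cases "i \<le> degree (p - r)") auto
  then have "p - r = 0" by (intro poly_eqI) simp
  then show ?thesis by simp
qed

lemma papply_pCons [simp]: "papply S (pCons q F) x = pCons (S q x) (papply S F x)" "papply S 0 x = 0"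
  by (simp_all add: papply_def map_poly_pCons)

lemma subst_lambda_papply [simp]: "subst_lambda S (papply S F x) [:l:] = S (poly F [:l:]) x"
  by (induction F) (simp_all add: scale_left_distrib)

lemma papply_from_coeffs:
  assumes "\<And>k. \<exists>q. coeff D k = S q x"
  shows "\<exists>f. D = papply S f x"
  using assms
proof (induction D)
  case 0
  then show ?case by (intro exI[of _ 0]) simp
next
  case (pCons d D)
  obtain q where "d = S q x" using pCons.prems[of 0] by auto
  moreover have "\<exists>q. coeff D k = S q x" for k using pCons.prems[of "Suc k"] by simp
  then obtain f where "D = papply S f x" using pCons.IH by blast
  ultimately show ?case by (intro exI[of _ "pCons q f"]) simp
qed

lemma free_basis_one:
  "free_basis S [x] \<longleftrightarrow> (\<forall>z. \<exists>q. z = S q x) \<and> (\<forall>q. S q x = 0 \<longrightarrow> q = 0)"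
proof -
  have "dependent {x} \<longleftrightarrow> (\<exists>q. q \<noteq> 0 \<and> S q x = 0)"
    by (subst dependent_finite) (auto intro: exI[of _ "\<lambda>_. _"])
  moreover have "span {x} = UNIV \<longleftrightarrow> (\<forall>z. \<exists>q. z = S q x)"
    by (auto simp: span_singleton)
  ultimately show ?thesis by (auto simp: free_basis_def)
qed

lemma free_basis_two:
  "free_basis S [x, y] \<longleftrightarrow>
     (\<forall>z. \<exists>p q. z = S p x + S q y) \<and> (\<forall>p q. S p x + S q y = 0 \<longrightarrow> p = 0 \<and> q = 0)"
proof -
  have dep: "dependent {x, y} \<longleftrightarrow> (\<exists>p q. (p \<noteq> 0 \<or> q \<noteq> 0) \<and> S p x + S q y = 0)" if "x \<noteq> y"
  proof -
    have "dependent {x, y} \<longleftrightarrow> (\<exists>u. (u x \<noteq> 0 \<or> u y \<noteq> 0) \<and> S (u x) x + S (u y) y = 0)"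
      using that by (subst dependent_finite) auto
    also have "\<dots> \<longleftrightarrow> (\<exists>p q. (p \<noteq> 0 \<or> q \<noteq> 0) \<and> S p x + S q y = 0)"
    proof
      assume "\<exists>p q. (p \<noteq> 0 \<or> q \<noteq> 0) \<and> S p x + S q y = 0"
      then obtain p q where "(p \<noteq> 0 \<or> q \<noteq> 0) \<and> S p x + S q y = 0" by blast
      then show "\<exists>u. (u x \<noteq> 0 \<or> u y \<noteq> 0) \<and> S (u x) x + S (u y) y = 0"
        using that by (intro exI[of _ "\<lambda>z. if z = x then p else q"]) auto
    qed blast
    finally show ?thesis .
  qed
  have sp: "span {x, y} = UNIV \<longleftrightarrow> (\<forall>z. \<exists>p q. z = S p x + S q y)"
    by (auto simp: span_insert span_singleton image_iff set_eq_iff algebra_simps diff_eq_eq)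
  have "x \<noteq> y" if "\<forall>p q. S p x + S q y = 0 \<longrightarrow> p = 0 \<and> q = 0"
  proof
    assume "x = y"
    then have "S 1 x + S (-1) y = 0" by simp
    with that have "(1::complex poly) = 0" by blast
    then show False by simp
  qed
  then show ?thesis unfolding free_basis_def using dep sp by auto
qed

end

lemma subst_lambda_map_poly:
  assumes h: "module_hom S T h"
  shows "subst_lambda T (map_poly h p) q = h (subst_lambda S p q)"
proof -
  interpret h: module_hom S T h by (rule h)
  interpret S: der_module S by unfold_locales
  interpret T: der_module T by unfold_locales
  show ?thesis
    by (induction p) (simp_all add: map_poly_pCons h.add h.scale)
qed

section \<open>Conformal modules as sesquilinear actions\<close>

text \<open>
  The value at \<open>\<lambda> = l\<close> of a \<open>\<lambda>\<close>-bracket or \<open>\<lambda>\<close>-action: \<open>\<partial>\<close> on the left acts as the number \<open>-l\<close>, and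
  \<open>\<partial>\<close> on the right can be moved out as \<open>\<partial> + l\<close>.
\<close>

definition sesquilinear ::
  "(complex poly \<Rightarrow> 'r::ab_group_add \<Rightarrow> 'r) \<Rightarrow> (complex poly \<Rightarrow> 'w::ab_group_add \<Rightarrow> 'w)
    \<Rightarrow> (complex poly \<Rightarrow> 'v::ab_group_add \<Rightarrow> 'v) \<Rightarrow> ('r \<Rightarrow> complex \<Rightarrow> 'w \<Rightarrow> 'v) \<Rightarrow> bool"
  where "sesquilinear SR SW SV T \<longleftrightarrow>
    (\<forall>a b l x. T (a + b) l x = T a l x + T b l x) \<and>
    (\<forall>a l x y. T a l (x + y) = T a l x + T a l y) \<and>
    (\<forall>p a l x. T (SR p a) l x = SV [:poly p (- l):] (T a l x)) \<and>
    (\<forall>q a l x. T a l (SW q x) = SV (pcompose q [:l, 1:]) (T a l x))"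

lemma sesquilinear_zero:
  assumes "sesquilinear SR SW SV T"
  shows "T a l 0 = 0" "T 0 l x = 0"
  using assms unfolding sesquilinear_def by (metis add_cancel_right_right)+

lemma sesquilinearI:
  fixes act :: "'r::ab_group_add \<Rightarrow> 'w::ab_group_add \<Rightarrow> 'v::ab_group_add poly"
  assumes "module SR" "module SW" "module SV"
    and add_left: "\<And>a b x. act (a + b) x = act a x + act b x"
    and add_right: "\<And>a x y. act a (x + y) = act a x + act a y"
    and scale_left: "\<And>k a x. act (SR [:k:] a) x = map_poly (SV [:k:]) (act a x)"
    and scale_right: "\<And>k a x. act a (SW [:k:] x) = map_poly (SV [:k:]) (act a x)"
    and der_left: "\<And>a x. act (SR der a) x = - pCons 0 (act a x)"
    and der_right: "\<And>a x. act a (SW der x) = map_poly (SV der) (act a x) + pCons 0 (act a x)"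
  shows "sesquilinear SR SW SV (\<lambda>a l x. subst_lambda SV (act a x) [:l:])"
proof -
  interpret R: der_module SR using assms(1) by (simp add: der_module_def)
  interpret W: der_module SW using assms(2) by (simp add: der_module_def)
  interpret V: der_module SV using assms(3) by (simp add: der_module_def)
  note hom = subst_lambda_map_poly[OF V.module_hom_scale]
  have left: "subst_lambda SV (act (SR p a) x) [:l:] = SV [:poly p (- l):] (subst_lambda SV (act a x) [:l:])"
    for p a l x
  proof (induction p arbitrary: a)
    case 0
    have "act 0 x = 0" using add_left[of 0 0 x] by simp
    then show ?case by simp
  next
    case (pCons k p)
    have "pCons k p = [:k:] + p * der" by simp
    then have "SR (pCons k p) a = SR [:k:] a + SR p (SR der a)"
      by (simp only: R.scale_left_distrib R.scale_scale)
    then have "subst_lambda SV (act (SR (pCons k p) a) x) [:l:]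
        = SV [:k:] (subst_lambda SV (act a x) [:l:]) + SV [:poly p (- l):] (- SV [:l:] (subst_lambda SV (act a x) [:l:]))"
      by (simp only: add_left scale_left hom pCons.IH der_left V.subst_lambda_add V.subst_lambda_minus V.subst_lambda_pCons add_0)
    also have "\<dots> = SV [:poly (pCons k p) (- l):] (subst_lambda SV (act a x) [:l:])"
      by (simp add: mult.commute flip: V.scale_left_distrib V.scale_minus_left)
    finally show ?case .
  qed
  have right: "subst_lambda SV (act a (SW q x)) [:l:] = SV (pcompose q [:l, 1:]) (subst_lambda SV (act a x) [:l:])"
    for q a l x
  proof (induction q arbitrary: x)
    case 0
    have "act a 0 = 0" using add_right[of a 0 0] by simp
    then show ?case by simp
  next
    case (pCons k q)
    have "pCons k q = [:k:] + q * der" by simp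
    then have "SW (pCons k q) x = SW [:k:] x + SW q (SW der x)"
      by (simp only: W.scale_left_distrib W.scale_scale)
    then have "subst_lambda SV (act a (SW (pCons k q) x)) [:l:]
        = SV [:k:] (subst_lambda SV (act a x) [:l:])
        + SV (pcompose q [:l, 1:]) (SV der (subst_lambda SV (act a x) [:l:]) + SV [:l:] (subst_lambda SV (act a x) [:l:]))"
      by (simp only: add_right scale_right hom pCons.IH der_right V.subst_lambda_add V.subst_lambda_pCons add_0)
    also have "\<dots> = SV ([:k:] + pcompose q [:l, 1:] * (der + [:l:])) (subst_lambda SV (act a x) [:l:])"
      by (simp only: V.scale_left_distrib V.scale_scale[symmetric] V.scale_right_distrib)
    also have "[:k:] + pcompose q [:l, 1:] * (der + [:l:]) = pcompose (pCons k q) [:l, 1:]"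
      by (simp add: pcompose_pCons mult.commute)
    finally show ?case .
  qed
  show ?thesis
    unfolding sesquilinear_def by (simp add: add_left add_right left right)
qed

lemma sesquilinearD:
  fixes act :: "'r::ab_group_add \<Rightarrow> 'w::ab_group_add \<Rightarrow> 'v::ab_group_add poly"
  assumes "module SR" "module SW" "module SV"
    and T: "sesquilinear SR SW SV (\<lambda>a l x. subst_lambda SV (act a x) [:l:])"
  shows "act (a + b) x = act a x + act b x"
    and "act a (x + y) = act a x + act a y"
    and "act (SR [:k:] a) x = map_poly (SV [:k:]) (act a x)"
    and "act a (SW [:k:] x) = map_poly (SV [:k:]) (act a x)"
    and "act (SR der a) x = - pCons 0 (act a x)"
    and "act a (SW der x) = map_poly (SV der) (act a x) + pCons 0 (act a x)"
proof -
  interpret R: der_module SR using assms(1) by (simp add: der_module_def)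
  interpret W: der_module SW using assms(2) by (simp add: der_module_def)
  interpret V: der_module SV using assms(3) by (simp add: der_module_def)
  note hom = subst_lambda_map_poly[OF V.module_hom_scale]
  note T = T[unfolded sesquilinear_def]
  show "act (a + b) x = act a x + act b x" "act a (x + y) = act a x + act a y"
    "act (SR [:k:] a) x = map_poly (SV [:k:]) (act a x)"
    "act a (SW [:k:] x) = map_poly (SV [:k:]) (act a x)"
    by (rule V.subst_lambda_eqI; simp add: T hom pcompose_pCons)+
  show "act (SR der a) x = - pCons 0 (act a x)"
    by (rule V.subst_lambda_eqI) (simp add: T flip: V.scale_minus_left)
  show "act a (SW der x) = map_poly (SV der) (act a x) + pCons 0 (act a x)"
    by (rule V.subst_lambda_eqI) (simp add: T hom pcompose_pCons flip: V.scale_left_distrib)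
qed

definition bracket_at :: "'r::ab_group_add lca \<Rightarrow> 'r \<Rightarrow> complex \<Rightarrow> 'r \<Rightarrow> 'r"
  where "bracket_at R a l b = subst_lambda (scal R) (bracket R a b) [:l:]"

definition act_at :: "('r, 'v::ab_group_add) cmod \<Rightarrow> 'r \<Rightarrow> complex \<Rightarrow> 'v \<Rightarrow> 'v"
  where "act_at V a l x = subst_lambda (mscal V) (act V a x) [:l:]"

lemma act_at_hom:
  assumes "cmod_hom E F h"
  shows "h (act_at E a l z) = act_at F a l (h z)"
  using assms subst_lambda_map_poly[of "mscal E" "mscal F" h] unfolding cmod_hom_def act_at_def by simp

lemma lie_conformal_algebra_sesquilinear:
  assumes "lie_conformal_algebra R"
  shows "sesquilinear (scal R) (scal R) (scal R) (bracket_at R)"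
proof -
  interpret lie_conformal_algebra R by (rule assms)
  show ?thesis
    unfolding bracket_at_def
    by (rule sesquilinearI)
      (rule module_scal bracket_add_left bracket_add_right bracket_scale_left bracket_scale_right
         bracket_der_left bracket_der_right)+
qed

lemma conformal_module_iff:
  "conformal_module R V \<longleftrightarrow>
     lie_conformal_algebra R \<and> module (mscal V) \<and> sesquilinear (scal R) (mscal V) (mscal V) (act_at V) \<and>
     (\<forall>a b x l m. act_at V a l (act_at V b m x) = act_at V (bracket_at R a l b) (l + m) x + act_at V b m (act_at V a l x))"
proof
  assume "conformal_module R V"
  then interpret conformal_module R V .
  have "sesquilinear (scal R) (mscal V) (mscal V) (act_at V)"
    unfolding act_at_def
    by (rule sesquilinearI)
      (rule lie_conformal_algebra.module_scal[OF lca] module_mscal act_add_left act_add_right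
         act_scale_left act_scale_right act_der_left act_der_right)+
  with lca module_mscal show "lie_conformal_algebra R \<and> module (mscal V) \<and> sesquilinear (scal R) (mscal V) (mscal V) (act_at V) \<and>
     (\<forall>a b x l m. act_at V a l (act_at V b m x) = act_at V (bracket_at R a l b) (l + m) x + act_at V b m (act_at V a l x))"
    unfolding act_at_def bracket_at_def using act_jacobi by blast
next
  assume *: "lie_conformal_algebra R \<and> module (mscal V) \<and> sesquilinear (scal R) (mscal V) (mscal V) (act_at V) \<and>
     (\<forall>a b x l m. act_at V a l (act_at V b m x) = act_at V (bracket_at R a l b) (l + m) x + act_at V b m (act_at V a l x))"
  then have R: "lie_conformal_algebra R" and V: "module (mscal V)"
    and T: "sesquilinear (scal R) (mscal V) (mscal V) (\<lambda>a l x. subst_lambda (mscal V) (act V a x) [:l:])"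
    unfolding act_at_def by blast+
  from * have J: "act_at V a l (act_at V b m x) = act_at V (bracket_at R a l b) (l + m) x + act_at V b m (act_at V a l x)"
    for a b x l m by blast
  note D = sesquilinearD[OF lie_conformal_algebra.module_scal[OF R] V V T]
  show "conformal_module R V"
    by (rule conformal_module.intro) (rule R V D J[unfolded act_at_def bracket_at_def])+
qed

lemma sesquilinear_eqI:
  assumes "module SR" "module SW" "module SV"
    and T: "sesquilinear SR SW SV T" "sesquilinear SR SW SV T'"
    and gR: "\<And>a. \<exists>p q. a = SR p A + SR q B" and gW: "\<And>z. \<exists>p q. z = SW p x + SW q y"
    and eq: "\<And>l. T A l x = T' A l x" "\<And>l. T A l y = T' A l y" "\<And>l. T B l x = T' B l x" "\<And>l. T B l y = T' B l y"
  shows "T = T'"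
proof (intro ext)
  fix a l z
  obtain p q where a: "a = SR p A + SR q B" using gR by blast
  obtain r s where z: "z = SW r x + SW s y" using gW by blast
  show "T a l z = T' a l z"
    using T[unfolded sesquilinear_def] eq unfolding a z by simp
qed

definition jacobi_at :: "'r::ab_group_add lca \<Rightarrow> ('r, 'v::ab_group_add) cmod \<Rightarrow> 'r \<Rightarrow> 'r \<Rightarrow> 'v \<Rightarrow> bool"
  where "jacobi_at R V a b x \<longleftrightarrow>
    (\<forall>l m. act_at V a l (act_at V b m x) = act_at V (bracket_at R a l b) (l + m) x + act_at V b m (act_at V a l x))"

text \<open>
  The difference of the two sides of the Jacobi identity is semilinear in each of its three arguments.
\<close>

lemma jacobi_from_generators:
  assumes R: "lie_conformal_algebra R" and V: "module (mscal V)"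
    and T: "sesquilinear (scal R) (mscal V) (mscal V) (act_at V)"
    and gR: "\<And>a. \<exists>p q. a = scal R p A + scal R q B" and gV: "\<And>z. \<exists>p q. z = mscal V p x + mscal V q y"
    and gen: "\<And>a b z. a \<in> {A, B} \<Longrightarrow> b \<in> {A, B} \<Longrightarrow> z \<in> {x, y} \<Longrightarrow> jacobi_at R V a b z"
  shows "jacobi_at R V a b z"
proof -
  interpret S: der_module "mscal V" using V by (simp add: der_module_def)
  note T = T[unfolded sesquilinear_def] 
  note B = lie_conformal_algebra_sesquilinear[OF R, unfolded sesquilinear_def]
  have add1: "jacobi_at R V (a + a') b z" if "jacobi_at R V a b z" "jacobi_at R V a' b z" for a a' b z
    using that unfolding jacobi_at_def by (simp add: T B)
  have add2: "jacobi_at R V a (b + b') z" if "jacobi_at R V a b z" "jacobi_at R V a b' z" for a b b' z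
    using that unfolding jacobi_at_def by (simp add: T B)
  have add3: "jacobi_at R V a b (z + z')" if "jacobi_at R V a b z" "jacobi_at R V a b z'" for a b z z'
    using that unfolding jacobi_at_def by (simp add: T B)
  have sc1: "jacobi_at R V (scal R p a) b z" if "jacobi_at R V a b z" for p a b z
    using that unfolding jacobi_at_def by (simp add: T B S.scale_right_distrib)
  have sc2: "jacobi_at R V a (scal R p b) z" if "jacobi_at R V a b z" for p a b z
    using that unfolding jacobi_at_def by (simp add: T B S.scale_right_distrib poly_pcompose)
  have sc3: "jacobi_at R V a b (mscal V p z)" if "jacobi_at R V a b z" for p a b z
  proof -
    have "pcompose (pcompose p [:m, 1:]) [:l, 1:] = pcompose p [:l + m, 1:]" for l m
      by (rule poly_evals_eqI) (simp add: poly_pcompose algebra_simps)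
    then show ?thesis
      using that unfolding jacobi_at_def by (simp add: T B S.scale_right_distrib add.commute)
  qed
  have 3: "jacobi_at R V a b z" if "a \<in> {A, B}" "b \<in> {A, B}" for a b z
  proof -
    obtain p q where "z = mscal V p x + mscal V q y" using gV by blast
    then show ?thesis using gen[OF that, of x] gen[OF that, of y] by (auto intro!: add3 sc3)
  qed
  have 2: "jacobi_at R V a b z" if "a \<in> {A, B}" for a b z
  proof -
    obtain p q where "b = scal R p A + scal R q B" using gR by blast
    then show ?thesis using 3[OF that, of A z] 3[OF that, of B z] by (auto intro!: add2 sc2)
  qed
  obtain p q where "a = scal R p A + scal R q B" using gR by blast
  then show ?thesis using 2[of A b z] 2[of B b z] by (auto intro!: add1 sc1)
qed

lemma type_I_skew:
  assumes "lie_conformal_algebra R" "bracket R a b = 0"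
  shows "bracket R b a = 0"
proof -
  interpret lie_conformal_algebra R by (rule assms)
  interpret S: der_module "scal R" using module_scal by (simp add: der_module_def)
  show ?thesis
    by (rule S.subst_lambda_eqI) (simp add: skew_symmetry[of b a] assms(2))
qed

lemma type_I_facts:
  assumes "type_I R A B"
  shows "lie_conformal_algebra R" "module (scal R)"
    "bracket_at R A l A = scal R [:2 * l, 1:] A" "bracket_at R A l B = 0" "bracket_at R B l A = 0" "bracket_at R B l B = 0"
    "\<exists>p q. a = scal R p A + scal R q B" "scal R p A + scal R q B = 0 \<Longrightarrow> p = 0 \<and> q = 0"
proof -
  show R: "lie_conformal_algebra R" using assms by (simp add: type_I_def)
  show m: "module (scal R)" by (rule lie_conformal_algebra.module_scal[OF R])
  interpret S: der_module "scal R" using m by (simp add: der_module_def)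
  have AA: "bracket R A A = [:scal R der A, scal R 2 A:]"
    and z: "bracket R A B = 0" "bracket R B B = 0" using assms by (simp_all add: type_I_def)
  have "[:2 * l, 1:] = der + [:l:] * 2" by (simp add: numeral_poly)
  then show "bracket_at R A l A = scal R [:2 * l, 1:] A"
    unfolding bracket_at_def AA by (simp only: S.subst_lambda_pCons S.subst_lambda_0 S.scale_zero_right add_0_right
        S.scale_scale S.scale_left_distrib)
  show "bracket_at R A l B = 0" "bracket_at R B l A = 0" "bracket_at R B l B = 0"
    using z type_I_skew[OF R z(1)] by (simp_all add: bracket_at_def)
  show "\<exists>p q. a = scal R p A + scal R q B" "scal R p A + scal R q B = 0 \<Longrightarrow> p = 0 \<and> q = 0"
    using assms unfolding type_I_def S.free_basis_two by blast+
qed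

lemma poly_symbols:
  "poly (poly (symbolA d \<alpha> \<beta>) [:l:]) x = d * (x + \<alpha> * l + \<beta>)"
  "poly (poly (symbolB d \<phi>) [:l:]) x = d * poly \<phi> l"
  using ev2_symbols[unfolded ev2_def] .

lemma poly_cob_poly: "poly (cob_poly s t p) [:l:] = poly s [:l:] * pcompose p [:l, 1:] - poly t [:l:] * p"
  by (rule poly_evals_eqI) (simp add: poly_pcompose ev2_cob_poly[unfolded ev2_def] add.commute)

lemma act_at_eq_iff:
  assumes "module (mscal E)"
  shows "act E a y = papply (mscal E) s x + papply (mscal E) t z
      \<longleftrightarrow> (\<forall>l. act_at E a l y = mscal E (poly s [:l:]) x + mscal E (poly t [:l:]) z)"
    and "act E a y = papply (mscal E) s x \<longleftrightarrow> (\<forall>l. act_at E a l y = mscal E (poly s [:l:]) x)"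
proof -
  interpret S: der_module "mscal E" using assms(1) by (simp add: der_module_def)
  show "act E a y = papply (mscal E) s x + papply (mscal E) t z
      \<longleftrightarrow> (\<forall>l. act_at E a l y = mscal E (poly s [:l:]) x + mscal E (poly t [:l:]) z)"
    unfolding act_at_def by (auto intro: S.subst_lambda_eqI)
  show "act E a y = papply (mscal E) s x \<longleftrightarrow> (\<forall>l. act_at E a l y = mscal E (poly s [:l:]) x)"
    unfolding act_at_def by (auto intro: S.subst_lambda_eqI)
qed

lemma commutator_coefficient:
  fixes E :: "('r::ab_group_add, 'e::ab_group_add) cmod"
  assumes "module (mscal E)" and T: "sesquilinear SR (mscal E) (mscal E) (act_at E)"
    and x: "\<And>l. act_at E a l x = mscal E (poly s [:l:]) x" "\<And>l. act_at E b l x = mscal E (poly s' [:l:]) x"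
    and y: "\<And>l. act_at E a l y = mscal E (poly t [:l:]) y + mscal E (poly f [:l:]) x"
       "\<And>l. act_at E b l y = mscal E (poly t' [:l:]) y + mscal E (poly f' [:l:]) x"
  obtains p q where "act_at E a l (act_at E b m y) - act_at E b m (act_at E a l y) = mscal E p x + mscal E q y"
    "\<And>z. poly p z = jacobi_defect s t f s' t' f' z l m"
    "\<And>z. poly q z = ev2 t z l * ev2 t' (z + l) m - ev2 t' z m * ev2 t (z + m) l"
proof -
  interpret S: der_module "mscal E" using assms(1) by (simp add: der_module_def)
  let ?sh = "\<lambda>l q. pcompose q [:l, 1:]"
  let ?p = "?sh l (poly t' [:m:]) * poly f [:l:] + ?sh l (poly f' [:m:]) * poly s [:l:]
    - (?sh m (poly t [:l:]) * poly f' [:m:] + ?sh m (poly f [:l:]) * poly s' [:m:])"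
  let ?q = "?sh l (poly t' [:m:]) * poly t [:l:] - ?sh m (poly t [:l:]) * poly t' [:m:]"
  have add: "act_at E c k (u + u') = act_at E c k u + act_at E c k u'"
    and sc: "act_at E c k (mscal E r u) = mscal E (?sh k r) (act_at E c k u)" for c k u u' r
    using T unfolding sesquilinear_def by auto
  have "act_at E a l (act_at E b m y) - act_at E b m (act_at E a l y) = mscal E ?p x + mscal E ?q y"
    unfolding y add sc x
    by (simp add: S.scale_left_distrib S.scale_left_diff_distrib S.scale_right_distrib algebra_simps)
  moreover have "poly ?p z = jacobi_defect s t f s' t' f' z l m" for z
    by (simp add: jacobi_defect_def ev2_def poly_pcompose algebra_simps)
  moreover have "poly ?q z = ev2 t z l * ev2 t' (z + l) m - ev2 t' z m * ev2 t (z + m) l" for z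
    by (simp add: ev2_def poly_pcompose algebra_simps)
  ultimately show ?thesis by (rule that)
qed

lemma extensionD:
  assumes "extension R V W E i p"
  shows "conformal_module R E" "module (mscal E)" "sesquilinear (scal R) (mscal E) (mscal E) (act_at E)"
    "cmod_hom V E i" "cmod_hom E W p" "module_hom (mscal V) (mscal E) i" "module_hom (mscal E) (mscal W) p"
    "p (i z) = 0" "i z = 0 \<Longrightarrow> z = 0" "p e = 0 \<Longrightarrow> \<exists>z. e = i z" "\<exists>e. p e = u"
    "p (mscal E q e) = mscal W q (p e)" "p (e + e') = p e + p e'" "i (mscal V q z) = mscal E q (i z)"
proof -
  show E: "conformal_module R E" and h: "cmod_hom V E i" "cmod_hom E W p"
    using assms unfolding extension_def by blast+
  show "module (mscal E)" "sesquilinear (scal R) (mscal E) (mscal E) (act_at E)"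
    using E unfolding conformal_module_iff by blast+
  show m: "module_hom (mscal V) (mscal E) i" "module_hom (mscal E) (mscal W) p"
    using h unfolding cmod_hom_def by blast+
  interpret i: module_hom "mscal V" "mscal E" i by (rule m)
  interpret p: module_hom "mscal E" "mscal W" p by (rule m)
  have r: "inj i" "surj p" "range i = {x. p x = 0}" using assms unfolding extension_def by blast+
  show "p (i z) = 0" using r(3) by blast
  show "i z = 0 \<Longrightarrow> z = 0" using r(1) i.zero by (metis injD)
  show "p e = 0 \<Longrightarrow> \<exists>z. e = i z" using r(3) by blast
  show "\<exists>e. p e = u" using r(2) by (metis surjD)
  show "p (mscal E q e) = mscal W q (p e)" "p (e + e') = p e + p e'" "i (mscal V q z) = mscal E q (i z)"
    by (simp_all add: p.scale p.add i.scale)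
qed

section \<open>Extensions of rank one modules as polynomial cocycles\<close>

locale rank_one_pair =
  fixes R :: "'r::ab_group_add lca" and A B :: 'r
    and V :: "('r, 'v::ab_group_add) cmod" and v :: 'v
    and W :: "('r, 'w::ab_group_add) cmod" and w :: 'w
    and d1 d2 \<alpha> \<beta> d1' d2' \<alpha>' \<beta>' :: complex and \<phi> \<phi>' :: "complex poly"
  assumes R: "type_I R A B"
    and V: "irreducible_rank_one R A B V v d1 d2 \<alpha> \<beta> \<phi>"
    and W: "irreducible_rank_one R A B W w d1' d2' \<alpha>' \<beta>' \<phi>'"

begin

abbreviation "caseI f g \<equiv> case_one d1 d2 \<alpha> \<beta> d1' d2' \<alpha>' \<beta>' f g"
abbreviation "caseII f g \<equiv> case_two d1 d2 \<phi> d1' d2' \<phi>' f g"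

text \<open>
  \<open>sA\<close>, \<open>sB\<close> are the symbols of the submodule, \<open>tA\<close>, \<open>tB\<close> those of the quotient; \<open>star E x y f g\<close>
  says that \<open>x\<close>, \<open>y\<close> is a basis of \<open>E\<close> in which the extension is given by \<open>(f, g)\<close>.
\<close>
abbreviation "sA \<equiv> symbolA d1 \<alpha> \<beta>"

abbreviation "sB \<equiv> symbolB d2 \<phi>"

abbreviation "tA \<equiv> symbolA d1' \<alpha>' \<beta>'"

abbreviation "tB \<equiv> symbolB d2' \<phi>'"

abbreviation "cocycle f g \<equiv> ext_cocycle sA sB tA tB f g"

abbreviation "star E x y f g \<equiv> star_form A B E x y d1 d2 \<alpha> \<beta> \<phi> d1' d2' \<alpha>' \<beta>' \<phi>' f g"

lemmas R_facts = type_I_facts[OF R]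

lemma params:
  "(d1, d2) = (1, 0) \<or> (d1, d2) = (0, 1)" "(d1', d2') = (1, 0) \<or> (d1', d2') = (0, 1)"
  "\<alpha> \<noteq> 0" "\<phi> \<noteq> 0" "\<alpha>' \<noteq> 0" "\<phi>' \<noteq> 0"
proof -
  have "d1 \<in> {0, 1} \<and> d2 \<in> {0, 1} \<and> d1\<^sup>2 + d2\<^sup>2 = 1 \<and> \<alpha> \<noteq> 0 \<and> \<phi> \<noteq> 0"
    using V unfolding irreducible_rank_one_def by blast
  then show "(d1, d2) = (1, 0) \<or> (d1, d2) = (0, 1)" "\<alpha> \<noteq> 0" "\<phi> \<noteq> 0" by auto
  have "d1' \<in> {0, 1} \<and> d2' \<in> {0, 1} \<and> d1'\<^sup>2 + d2'\<^sup>2 = 1 \<and> \<alpha>' \<noteq> 0 \<and> \<phi>' \<noteq> 0"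
    using W unfolding irreducible_rank_one_def by blast
  then show "(d1', d2') = (1, 0) \<or> (d1', d2') = (0, 1)" "\<alpha>' \<noteq> 0" "\<phi>' \<noteq> 0" by auto
qed

lemma idem: "d1\<^sup>2 = d1" "d1'\<^sup>2 = d1'" "d1 * d2 = 0" "d1' * d2' = 0"
  using params by auto

lemma modules: "conformal_module R V" "conformal_module R W" "module (mscal V)" "module (mscal W)"
proof -
  show "conformal_module R V" "conformal_module R W"
    using V W unfolding irreducible_rank_one_def by blast+
  then show "module (mscal V)" "module (mscal W)"
    unfolding conformal_module_iff by blast+
qed

sublocale RS: der_module "scal R" using R_facts(2) by (simp add: der_module_def)

sublocale VS: der_module "mscal V" using modules by (simp add: der_module_def)

sublocale WS: der_module "mscal W" using modules by (simp add: der_module_def)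

lemma V_basis: "\<exists>q. z = mscal V q v" "mscal V q v = 0 \<Longrightarrow> q = 0"
  using V unfolding irreducible_rank_one_def VS.free_basis_one by blast+

lemma W_basis: "\<exists>q. z = mscal W q w" "mscal W q w = 0 \<Longrightarrow> q = 0"
  using W unfolding irreducible_rank_one_def WS.free_basis_one by blast+

lemma V_act: "act_at V A l v = mscal V (poly sA [:l:]) v" "act_at V B l v = mscal V (poly sB [:l:]) v"
  using V unfolding irreducible_rank_one_def act_at_eq_iff(2)[OF modules(3)] by blast+

lemma W_act: "act_at W A l w = mscal W (poly tA [:l:]) w" "act_at W B l w = mscal W (poly tB [:l:]) w"
  using W unfolding irreducible_rank_one_def act_at_eq_iff(2)[OF modules(4)] by blast+

lemma V_sesq: "sesquilinear (scal R) (mscal V) (mscal V) (act_at V)"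
  and W_sesq: "sesquilinear (scal R) (mscal W) (mscal W) (act_at W)"
  using modules unfolding conformal_module_iff by blast+

lemma star_iff:
  assumes "module (mscal E)"
  shows "star E x y f g \<longleftrightarrow>
    (\<forall>z. \<exists>p q. z = mscal E p x + mscal E q y) \<and>
    (\<forall>p q. mscal E p x + mscal E q y = 0 \<longrightarrow> p = 0 \<and> q = 0) \<and>
    (\<forall>l. act_at E A l x = mscal E (poly sA [:l:]) x) \<and>
    (\<forall>l. act_at E B l x = mscal E (poly sB [:l:]) x) \<and>
    (\<forall>l. act_at E A l y = mscal E (poly tA [:l:]) y + mscal E (poly f [:l:]) x) \<and>
    (\<forall>l. act_at E B l y = mscal E (poly tB [:l:]) y + mscal E (poly g [:l:]) x)"
  using der_module.free_basis_two[of "mscal E" x y] assms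
  unfolding star_form_def act_at_eq_iff[OF assms] by (simp add: der_module_def)

lemma star_coords:
  assumes "module (mscal E)" "star E x y f g"
  shows "mscal E a x + mscal E b y = mscal E a' x + mscal E b' y \<longleftrightarrow> a = a' \<and> b = b'"
proof
  interpret S: der_module "mscal E" using assms(1) by (simp add: der_module_def)
  assume "mscal E a x + mscal E b y = mscal E a' x + mscal E b' y"
  then have "mscal E (a - a') x + mscal E (b - b') y = 0"
    by (simp add: S.scale_left_diff_distrib flip: add_diff_add)
  with assms have "a - a' = 0 \<and> b - b' = 0" unfolding star_iff[OF assms(1)] by blast
  then show "a = a' \<and> b = b'" by simp
qed simp

text \<open>
  Both sides of the Jacobi identity at \<open>y\<close> are expanded in the basis \<open>x\<close>, \<open>y\<close>.  The coefficients of
  \<open>y\<close> agree because the quotient is a module, and those of \<open>x\<close> agree exactly when the cocycle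
  equation holds.
\<close>

lemma jacobi_iff_cocycle:
  assumes E: "module (mscal E)" and T: "sesquilinear (scal R) (mscal E) (mscal E) (act_at E)"
    and st: "star E x y f g"
  shows "(\<forall>a\<in>{A, B}. \<forall>b\<in>{A, B}. jacobi_at R E a b y) \<longleftrightarrow> cocycle f g"
proof -
  interpret S: der_module "mscal E" using E by (simp add: der_module_def)
  note indep = star_coords[OF E st]
  note st = st[unfolded star_iff[OF E]]
  note T' = T[unfolded sesquilinear_def]
  note act0 = sesquilinear_zero(2)[OF T]
  have polys: "p = q \<longleftrightarrow> (\<forall>z. poly p z = poly q z)" for p q :: "complex poly"
    using poly_evals_eqI by blast
  have AA: "jacobi_at R E A A y \<longleftrightarrow> (\<forall>x l m. jacobi_defect sA tA f sA tA f x l m = (l - m) * ev2 f x (l + m))"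
  proof -
    have "act_at E A l (act_at E A m y) = act_at E (bracket_at R A l A) (l + m) y + act_at E A m (act_at E A l y)
        \<longleftrightarrow> (\<forall>z. jacobi_defect sA tA f sA tA f z l m = (l - m) * ev2 f z (l + m))" for l m
    proof -
      obtain p q where pq: "act_at E A l (act_at E A m y) - act_at E A m (act_at E A l y) = mscal E p x + mscal E q y"
        "\<And>z. poly p z = jacobi_defect sA tA f sA tA f z l m"
        "\<And>z. poly q z = ev2 tA z l * ev2 tA (z + l) m - ev2 tA z m * ev2 tA (z + m) l"
        by (rule commutator_coefficient[OF E T, of A x sA A sA y tA f tA f l m]) (use st in auto)
      have q: "q = [:l - m:] * poly tA [:l + m:]"
      proof (rule poly_evals_eqI)
        fix z
        have "poly q z = (l - m) * (d1' * (z + \<alpha>' * (l + m) + \<beta>'))"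
          using pq(3)[of z] unfolding ev2_symbols symbolA_commutator[OF idem(2)] .
        then show "poly q z = poly ([:l - m:] * poly tA [:l + m:]) z" by (simp add: poly_symbols)
      qed
      have "act_at E (bracket_at R A l A) (l + m) y = mscal E ([:l - m:] * poly f [:l + m:]) x + mscal E q y"
        unfolding R_facts(3) q using T' st by (simp add: S.scale_right_distrib)
      then have "act_at E A l (act_at E A m y) = act_at E (bracket_at R A l A) (l + m) y + act_at E A m (act_at E A l y)
        \<longleftrightarrow> mscal E p x + mscal E q y = mscal E ([:l - m:] * poly f [:l + m:]) x + mscal E q y"
        using pq(1) by (simp add: algebra_simps) 
      also have "\<dots> \<longleftrightarrow> p = [:l - m:] * poly f [:l + m:]" unfolding indep by simp
      also have "\<dots> \<longleftrightarrow> (\<forall>z. jacobi_defect sA tA f sA tA f z l m = (l - m) * ev2 f z (l + m))"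
        unfolding polys by (simp add: pq(2) ev2_def)
      finally show ?thesis .
    qed
    then show ?thesis unfolding jacobi_at_def by blast
  qed
  have zero: "jacobi_at R E a b y \<longleftrightarrow> (\<forall>x l m. jacobi_defect s t f s' t' f' x l m = 0)"
    if h: "\<And>l. bracket_at R a l b = 0"
      and hx: "\<And>l. act_at E a l x = mscal E (poly s [:l:]) x" "\<And>l. act_at E b l x = mscal E (poly s' [:l:]) x"
      and hy: "\<And>l. act_at E a l y = mscal E (poly t [:l:]) y + mscal E (poly f [:l:]) x"
       "\<And>l. act_at E b l y = mscal E (poly t' [:l:]) y + mscal E (poly f' [:l:]) x"
      and comm: "\<And>z l m. ev2 t z l * ev2 t' (z + l) m = ev2 t' z m * ev2 t (z + m) l"
    for a b s t f s' t' f'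
  proof -
    have "act_at E a l (act_at E b m y) = act_at E (bracket_at R a l b) (l + m) y + act_at E b m (act_at E a l y)
        \<longleftrightarrow> (\<forall>z. jacobi_defect s t f s' t' f' z l m = 0)" for l m
    proof -
      obtain p q where pq: "act_at E a l (act_at E b m y) - act_at E b m (act_at E a l y) = mscal E p x + mscal E q y"
        "\<And>z. poly p z = jacobi_defect s t f s' t' f' z l m"
        "\<And>z. poly q z = ev2 t z l * ev2 t' (z + l) m - ev2 t' z m * ev2 t (z + m) l"
        using commutator_coefficient[OF E T hx hy, of l m] by metis
      have q: "q = 0" unfolding polys using pq(3) comm by simp
      have "act_at E a l (act_at E b m y) = act_at E (bracket_at R a l b) (l + m) y + act_at E b m (act_at E a l y)
        \<longleftrightarrow> mscal E p x + mscal E q y = mscal E 0 x + mscal E 0 y"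
        using pq(1) by (simp add: h act0 algebra_simps)
      also have "\<dots> \<longleftrightarrow> (\<forall>z. jacobi_defect s t f s' t' f' z l m = 0)"
        unfolding indep q by (simp add: polys pq(2))
      finally show ?thesis .
    qed
    then show ?thesis unfolding jacobi_at_def by blast
  qed
  have z': "d1' = 0 \<or> d2' = 0" using idem by auto
  have AB: "jacobi_at R E A B y \<longleftrightarrow> (\<forall>x l m. jacobi_defect sA tA f sB tB g x l m = 0)"
    by (rule zero) (use st R_facts z' in auto)
  have BA: "jacobi_at R E B A y \<longleftrightarrow> (\<forall>x l m. jacobi_defect sB tB g sA tA f x l m = 0)"
    by (rule zero) (use st R_facts z' in auto)
  have BB: "jacobi_at R E B B y \<longleftrightarrow> (\<forall>x l m. jacobi_defect sB tB g sB tB g x l m = 0)"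
    by (rule zero) (use st R_facts in auto)
  have sym: "jacobi_defect sB tB g sA tA f x l m = - jacobi_defect sA tA f sB tB g x m l" for x l m
    by (simp add: jacobi_defect_def)
  show ?thesis
    unfolding ext_cocycle_def by (auto simp: AA AB BA BB sym)
qed

lemma star_cocycle:
  assumes "conformal_module R E" "star E x y f g"
  shows "cocycle f g"
  using assms jacobi_iff_cocycle[of E x y f g] unfolding conformal_module_iff jacobi_at_def by blast

text \<open>
  Any preimage \<open>y\<close> of the generator of the quotient gives a basis, because the quotient is free.  The
  action on \<open>y\<close> differs from the action on the quotient by a polynomial with coefficients in the
  kernel, that is, in the image of the submodule.
\<close>

lemma extension_star:
  assumes ext: "extension R V W E i p"
  shows "\<exists>y f g. p y = w \<and> star E (i v) y f g"
proof -
  note X = extensionD[OF ext]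
  interpret S: der_module "mscal E" using X(2) by (simp add: der_module_def)
  interpret p: module_hom "mscal E" "mscal W" p by (rule X)
  obtain y where y: "p y = w" using X(11) by blast
  have lift: "\<exists>q. e = mscal E q (i v)" if "p e = 0" for e
    using X(10)[OF that] V_basis(1) X(14) by metis
  have data: "\<exists>f. \<forall>l. act_at E a l y = mscal E (poly t [:l:]) y + mscal E (poly f [:l:]) (i v)"
    if aw: "\<And>l. act_at W a l w = mscal W (poly t [:l:]) w" for a t
  proof -
    let ?D = "act E a y - papply (mscal E) t y"
    have "p (coeff ?D k) = 0" for k
    proof -
      have "map_poly p (act E a y) = papply (mscal W) t w"
        using X(5) y aw act_at_eq_iff(2)[OF modules(4)] unfolding cmod_hom_def by metis
      then have "p (coeff (act E a y) k) = coeff (papply (mscal W) t w) k"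
        by (metis coeff_map_poly p.zero)
      then show ?thesis by (simp add: p.diff papply_def coeff_map_poly p.scale y)
    qed
    then have "\<exists>f. ?D = papply (mscal E) f (i v)"
      by (intro S.papply_from_coeffs lift)
    then obtain f where "act E a y = papply (mscal E) t y + papply (mscal E) f (i v)"
      by (metis add.commute diff_add_cancel)
    then show ?thesis unfolding act_at_eq_iff[OF X(2)] by blast
  qed
  obtain f g where fg: "\<And>l. act_at E A l y = mscal E (poly tA [:l:]) y + mscal E (poly f [:l:]) (i v)"
    "\<And>l. act_at E B l y = mscal E (poly tB [:l:]) y + mscal E (poly g [:l:]) (i v)"
    using data[OF W_act(1)] data[OF W_act(2)] by blast
  have "star E (i v) y f g"
    unfolding star_iff[OF X(2)]
  proof (intro conjI allI impI)
    fix z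
    obtain q where q: "p z = mscal W q w" using W_basis(1) by blast
    have "p (z - mscal E q y) = 0" by (simp add: p.diff X(12) y q)
    then obtain r where "z - mscal E q y = mscal E r (i v)" using lift by blast
    then show "\<exists>r q. z = mscal E r (i v) + mscal E q y" by (metis diff_add_cancel)
  next
    fix r q assume eq: "mscal E r (i v) + mscal E q y = 0"
    then have "p (mscal E r (i v) + mscal E q y) = 0" by (simp add: p.zero)
    then have "mscal W q w = 0" by (simp add: X y p.scale p.add)
    then show q: "q = 0" by (rule W_basis)
    with eq have "i (mscal V r v) = 0" by (simp add: X)
    then show "r = 0" using X(9) V_basis(2) by blast
  next
    fix l
    show "act_at E A l (i v) = mscal E (poly sA [:l:]) (i v)" "act_at E B l (i v) = mscal E (poly sB [:l:]) (i v)"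
      unfolding act_at_hom[OF X(4), symmetric] V_act X(14) by blast+
  qed (rule fg)+
  with y show ?thesis by blast
qed

text \<open>
  A morphism of extensions sends \<open>y\<close> to another lift \<open>y' + P(\<partial>)v\<close>; comparing the actions on both gives
  the coboundary of \<open>P\<close>.
\<close>

lemma cohomologous_if_equivalent:
  assumes ext: "extension R V W E i p" "extension R V W E' i' p'"
    and y: "p y = w" "p' y' = w"
    and st: "star E (i v) y f g" "star E' (i' v) y' f' g'"
    and eqv: "equivalent_ext E i p E' i' p'"
  shows "\<exists>P. f = f' + cob_poly sA tA P \<and> g = g' + cob_poly sB tB P"
proof -
  note X = extensionD[OF ext(1)] and X' = extensionD[OF ext(2)]
  interpret S: der_module "mscal E'" using X'(2) by (simp add: der_module_def)
  interpret p': module_hom "mscal E'" "mscal W" p' by (rule X')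
  obtain h where h: "cmod_hom E E' h" "\<And>z. h (i z) = i' z" "\<And>e. p' (h e) = p e"
    using eqv unfolding equivalent_ext_def by blast
  interpret h: module_hom "mscal E" "mscal E'" h using h(1) by (simp add: cmod_hom_def)
  have "p' (h y - y') = 0" by (simp add: p'.diff h y)
  then obtain z where "h y - y' = i' z" using X'(10) by blast
  moreover obtain P where "z = mscal V P v" using V_basis(1) by blast
  ultimately have hy: "h y = y' + mscal E' P (i' v)" by (simp add: X' algebra_simps)
  note T = X'(3)[unfolded sesquilinear_def]
  have key: "F = F' + cob_poly s t P"
    if "\<And>l. act_at E a l y = mscal E (poly t [:l:]) y + mscal E (poly F [:l:]) (i v)"
      and "\<And>l. act_at E' a l y' = mscal E' (poly t [:l:]) y' + mscal E' (poly F' [:l:]) (i' v)"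
      and "\<And>l. act_at E' a l (i' v) = mscal E' (poly s [:l:]) (i' v)" for a s t F F'
  proof -
    have "poly F [:l:] = poly (F' + cob_poly s t P) [:l:]" for l
    proof -
      have "act_at E' a l (h y) = h (act_at E a l y)" by (rule act_at_hom[OF h(1), symmetric])
      then have "mscal E' (poly F' [:l:] + pcompose P [:l, 1:] * poly s [:l:]) (i' v) + mscal E' (poly t [:l:]) y'
          = mscal E' (poly t [:l:] * P + poly F [:l:]) (i' v) + mscal E' (poly t [:l:]) y'"
        unfolding that(1) h.add h.scale h(2) hy using that(2,3) T
        by (simp add: S.scale_left_distrib S.scale_right_distrib algebra_simps)
      then show ?thesis
        unfolding star_coords[OF X'(2) st(2)] by (simp add: poly_cob_poly algebra_simps)
    qed
    then have "poly (F - (F' + cob_poly s t P)) [:l:] = 0" for l by simp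
    then have "F - (F' + cob_poly s t P) = 0" by (rule poly_const_zero_imp_zero)
    then show ?thesis by simp
  qed
  show ?thesis
    by (intro exI[of _ P] conjI key) (use st in \<open>auto simp: star_iff[OF X(2)] star_iff[OF X'(2)]\<close>)
qed

text \<open>
  The \<open>\<complex>[\<partial>]\<close>-linear map with \<open>v \<mapsto> v\<close>, \<open>y \<mapsto> y' + P(\<partial>)v\<close> commutes with \<open>A\<close> and \<open>B\<close> on the basis, and
  by sesquilinearity this is enough.
\<close>

lemma equivalent_if_cohomologous:
  assumes ext: "extension R V W E i p" "extension R V W E' i' p'"
    and y: "p y = w" "p' y' = w"
    and st: "star E (i v) y f g" "star E' (i' v) y' f' g'"
    and coh: "f = f' + cob_poly sA tA P" "g = g' + cob_poly sB tB P"
  shows "equivalent_ext E i p E' i' p'"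
proof -
  note X = extensionD[OF ext(1)] and X' = extensionD[OF ext(2)]
  interpret E: der_module "mscal E" using X(2) by (simp add: der_module_def)
  interpret E': der_module "mscal E'" using X'(2) by (simp add: der_module_def)
  interpret p: module_hom "mscal E" "mscal W" p by (rule X)
  interpret p': module_hom "mscal E'" "mscal W" p' by (rule X')
  note st1 = st(1)[unfolded star_iff[OF X(2)]] and st2 = st(2)[unfolded star_iff[OF X'(2)]]
  define y'' where "y'' = y' + mscal E' P (i' v)"
  have "\<forall>z. \<exists>c. z = mscal E (fst c) (i v) + mscal E (snd c) y" using st1 by auto
  then obtain c where c: "\<And>z. z = mscal E (fst (c z)) (i v) + mscal E (snd (c z)) y" by metis
  define h where "h z = mscal E' (fst (c z)) (i' v) + mscal E' (snd (c z)) y''" for z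
  have h: "h (mscal E a (i v) + mscal E b y) = mscal E' a (i' v) + mscal E' b y''" for a b
    using c[of "mscal E a (i v) + mscal E b y"] unfolding star_coords[OF X(2) st(1)] h_def by simp
  have add: "h (z + z') = h z + h z'" for z z'
  proof -
    have eq: "z + z' = mscal E (fst (c z) + fst (c z')) (i v) + mscal E (snd (c z) + snd (c z')) y"
      by (subst c[of z], subst c[of z']) (simp add: E.scale_left_distrib algebra_simps)
    have "h (z + z') = mscal E' (fst (c z) + fst (c z')) (i' v) + mscal E' (snd (c z) + snd (c z')) y''"
      unfolding eq by (rule h)
    then show ?thesis
      by (simp add: h_def[of z] h_def[of z'] E'.scale_left_distrib algebra_simps)
  qed
  have scale: "h (mscal E q z) = mscal E' q (h z)" for q z
  proof -
    have eq: "mscal E q z = mscal E (q * fst (c z)) (i v) + mscal E (q * snd (c z)) y"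
      by (subst c[of z]) (simp add: E.scale_right_distrib)
    have "h (mscal E q z) = mscal E' (q * fst (c z)) (i' v) + mscal E' (q * snd (c z)) y''"
      unfolding eq by (rule h)
    then show ?thesis
      by (simp add: h_def[of z] E'.scale_right_distrib)
  qed
  have hom: "module_hom (mscal E) (mscal E') h"
    by (simp add: module_hom_iff E.module_axioms E'.module_axioms add scale)
  have hx: "h (mscal E a (i v)) = mscal E' a (i' v)" for a using h[of a 0] by simp
  note T = X(3)[unfolded sesquilinear_def] and T' = X'(3)[unfolded sesquilinear_def]
  have "(\<lambda>a l z. act_at E' a l (h z)) = (\<lambda>a l z. h (act_at E a l z))"
  proof (rule sesquilinear_eqI[OF R_facts(2) X(2) X'(2)])
    show "sesquilinear (scal R) (mscal E) (mscal E') (\<lambda>a l z. act_at E' a l (h z))"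
      "sesquilinear (scal R) (mscal E) (mscal E') (\<lambda>a l z. h (act_at E a l z))"
      unfolding sesquilinear_def using T T' by (simp_all add: add scale)
    show "\<exists>p q. a = scal R p A + scal R q B" for a by (rule R_facts)
    show "\<exists>p q. z = mscal E p (i v) + mscal E q y" for z using st1 by blast
    fix l
    have hy: "h y = y''" using h[of 0 1] by simp
    have hx1: "h (i v) = i' v" using hx[of 1] by simp
    show "act_at E' A l (h (i v)) = h (act_at E A l (i v))" "act_at E' B l (h (i v)) = h (act_at E B l (i v))"
      using st1 st2 by (simp_all add: hx hx1)
    have lift: "act_at E' a l (h y) = h (act_at E a l y)"
      if "act_at E a l y = mscal E (poly t [:l:]) y + mscal E (poly F [:l:]) (i v)"
        and "act_at E' a l y' = mscal E' (poly t [:l:]) y' + mscal E' (poly F' [:l:]) (i' v)"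
        and "act_at E' a l (i' v) = mscal E' (poly s [:l:]) (i' v)"
        and F: "F = F' + cob_poly s t P" for a s t F F'
    proof -
      have "h (act_at E a l y) = mscal E' (poly t [:l:]) y'' + mscal E' (poly F [:l:]) (i' v)"
        unfolding that(1) add scale hx1 hy ..
      also have "\<dots> = act_at E' a l y''"
        unfolding y''_def using T' that(2,3)
        by (simp add: F poly_cob_poly E'.scale_left_distrib E'.scale_left_diff_distrib E'.scale_right_distrib algebra_simps)
      finally show ?thesis by (simp add: hy)
    qed
    show "act_at E' A l (h y) = h (act_at E A l y)"
      by (rule lift[OF _ _ _ coh(1)]) (use st1 st2 in blast)+
    show "act_at E' B l (h y) = h (act_at E B l y)"
      by (rule lift[OF _ _ _ coh(2)]) (use st1 st2 in blast)+
  qed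
  then have act: "act_at E' a l (h z) = h (act_at E a l z)" for a l z by (simp add: fun_eq_iff)
  have "act E' a (h z) = map_poly h (act E a z)" for a z
    by (rule E'.subst_lambda_eqI) (use act[of a _ z] in \<open>simp add: act_at_def subst_lambda_map_poly[OF hom]\<close>)
  with hom have "cmod_hom E E' h" by (simp add: cmod_hom_def)
  moreover have "h (i z) = i' z" for z
  proof -
    obtain q where "z = mscal V q v" using V_basis by blast
    then show ?thesis by (simp add: X X' hx)
  qed
  moreover have "p' (h z) = p z" for z
    by (subst (2) c[of z]) (simp add: h_def y''_def X X' y)
  ultimately show ?thesis unfolding equivalent_ext_def by blast
qed

section \<open>Extensions from polynomial cocycles\<close>

text \<open>
  The maps \<open>c\<close> for which the twisted sum has a sesquilinear action; the Jacobi identity is the further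
  condition \<open>cocycle\<close> on the symbols of \<open>c\<close>.
\<close>

definition cochain :: "('r \<Rightarrow> 'w \<Rightarrow> 'v poly) \<Rightarrow> bool"
  where "cochain c \<longleftrightarrow>
    sesquilinear (scal R) (mscal W) (mscal V) (\<lambda>a l z. subst_lambda (mscal V) (c a z) [:l:])"

definition has_symbols :: "('r \<Rightarrow> 'w \<Rightarrow> 'v poly) \<Rightarrow> complex poly poly \<Rightarrow> complex poly poly \<Rightarrow> bool"
  where "has_symbols c f g \<longleftrightarrow> c A w = papply (mscal V) f v \<and> c B w = papply (mscal V) g v"

lemma papply_inj: "papply (mscal V) f v = papply (mscal V) f' v \<Longrightarrow> f = f'"
proof -
  assume eq: "papply (mscal V) f v = papply (mscal V) f' v"
  have "poly (f - f') [:l:] = 0" for l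
  proof -
    have "mscal V (poly f [:l:]) v = mscal V (poly f' [:l:]) v"
      using eq by (metis VS.subst_lambda_papply)
    then have "mscal V (poly (f - f') [:l:]) v = 0" by (simp add: VS.scale_left_diff_distrib)
    then show ?thesis by (rule V_basis)
  qed
  then have "f - f' = 0" by (rule poly_const_zero_imp_zero)
  then show ?thesis by simp
qed

lemma has_symbols_unique: "has_symbols c f g \<Longrightarrow> has_symbols c f' g' \<Longrightarrow> f = f' \<and> g = g'"
  unfolding has_symbols_def using papply_inj by metis

lemma has_symbols_exist: "\<exists>f g. has_symbols c f g"
  unfolding has_symbols_def using VS.papply_from_coeffs V_basis(1) by metis

text \<open>
  Coordinates with respect to the bases \<open>A\<close>, \<open>B\<close> and \<open>w\<close> turn the prescribed values on generators into
  a formula: \<open>(p(\<partial>)A + q(\<partial>)B, r(\<partial>)w)\<close> goes to \<open>r(\<partial> + \<lambda>)(p(-\<lambda>)f + q(-\<lambda>)g)v\<close>.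
\<close>

lemma cochain_exists: "\<exists>c. cochain c \<and> has_symbols c f g"
proof -
  have "\<forall>a. \<exists>k. a = scal R (fst k) A + scal R (snd k) B" using R_facts(7) by auto
  then obtain k where k: "\<And>a. a = scal R (fst (k a)) A + scal R (snd (k a)) B" by metis
  obtain r where r: "\<And>z. z = mscal W (r z) w" using W_basis(1) by metis
  have kI: "k (scal R p A + scal R q B) = (p, q)" for p q
  proof -
    let ?a = "scal R p A + scal R q B"
    have "scal R (fst (k ?a) - p) A + scal R (snd (k ?a) - q) B = 0"
      using k[of ?a] by (simp add: RS.scale_left_diff_distrib flip: add_diff_add)
    then have "fst (k ?a) - p = 0 \<and> snd (k ?a) - q = 0" by (rule R_facts)
    then show ?thesis by (simp add: prod_eq_iff)
  qed
  have rI: "r (mscal W q w) = q" for q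
  proof -
    have "mscal W (r (mscal W q w) - q) w = 0"
      using r[of "mscal W q w"] by (simp add: WS.scale_left_diff_distrib)
    then have "r (mscal W q w) - q = 0" by (rule W_basis)
    then show ?thesis by simp
  qed
  have kadd: "k (a + b) = k a + k b" for a b
  proof -
    have "a + b = scal R (fst (k a) + fst (k b)) A + scal R (snd (k a) + snd (k b)) B"
      by (subst k[of a], subst k[of b]) (simp add: RS.scale_left_distrib algebra_simps)
    then show ?thesis using kI by (metis plus_prod_def)
  qed
  have kscale: "k (scal R p a) = (p * fst (k a), p * snd (k a))" for p a
  proof -
    have "scal R p a = scal R (p * fst (k a)) A + scal R (p * snd (k a)) B"
      by (subst k[of a]) (simp add: RS.scale_right_distrib)
    then show ?thesis using kI by metis
  qed
  have radd: "r (z + z') = r z + r z'" for z z'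
  proof -
    have "z + z' = mscal W (r z + r z') w"
      by (subst r[of z], subst r[of z']) (simp add: WS.scale_left_distrib)
    then show ?thesis using rI by metis
  qed
  have rscale: "r (mscal W q z) = q * r z" for q z
  proof -
    have "mscal W q z = mscal W (q * r z) w" by (subst r[of z]) simp
    then show ?thesis using rI by metis
  qed
  define F where "F a z = shift_poly (r z) *
      (lam_poly (pcompose (fst (k a)) [:0, -1:]) * f + lam_poly (pcompose (snd (k a)) [:0, -1:]) * g)" for a z
  define c where "c a z = papply (mscal V) (F a z) v" for a z
  have F: "poly (F a z) [:l:] = pcompose (r z) [:l, 1:] *
      ([:poly (fst (k a)) (- l):] * poly f [:l:] + [:poly (snd (k a)) (- l):] * poly g [:l:])" for a z l
    by (rule poly_evals_eqI)
      (simp add: F_def poly_pcompose ev2_shift_poly[unfolded ev2_def] ev2_lam_poly[unfolded ev2_def] add.commute)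
  define M where "M a z l = pcompose (r z) [:l, 1:] *
      ([:poly (fst (k a)) (- l):] * poly f [:l:] + [:poly (snd (k a)) (- l):] * poly g [:l:])" for a z l
  have "cochain c"
    unfolding cochain_def sesquilinear_def c_def VS.subst_lambda_papply F M_def[symmetric]
  proof (intro conjI allI)
    show "mscal V (M (a + b) z l) v = mscal V (M a z l) v + mscal V (M b z l) v" for a b l z
      unfolding VS.scale_left_distrib[symmetric] M_def kadd
      by (rule arg_cong[where f = "\<lambda>q. mscal V q v"], rule poly_evals_eqI) (simp add: algebra_simps)
    show "mscal V (M a (z + z') l) v = mscal V (M a z l) v + mscal V (M a z' l) v" for a l z z'
      unfolding VS.scale_left_distrib[symmetric] M_def radd by (simp only: pcompose_add distrib_right)
    show "mscal V (M (scal R p a) z l) v = mscal V [:poly p (- l):] (mscal V (M a z l) v)" for p a l z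
      unfolding VS.scale_scale M_def kscale
      by (rule arg_cong[where f = "\<lambda>q. mscal V q v"], rule poly_evals_eqI) (simp add: algebra_simps)
    show "mscal V (M a (mscal W q z) l) v = mscal V (pcompose q [:l, 1:]) (mscal V (M a z l) v)" for q a l z
      unfolding VS.scale_scale M_def rscale by (simp only: pcompose_mult mult.assoc)
  qed
  moreover have "has_symbols c f g"
  proof -
    have "k A = (1, 0)" "k B = (0, 1)" "r w = 1" using kI[of 1 0] kI[of 0 1] rI[of 1] by simp_all
    then have "poly (F A w) [:l:] = poly f [:l:]" "poly (F B w) [:l:] = poly g [:l:]" for l
      unfolding F by - (rule poly_evals_eqI, simp add: poly_pcompose)+
    then have "F A w = f" "F B w = g"
      using poly_const_zero_imp_zero[of "F A w - f"] poly_const_zero_imp_zero[of "F B w - g"] by simp_all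
    then show ?thesis by (simp add: has_symbols_def c_def)
  qed
  ultimately show ?thesis by blast
qed

abbreviation "tw c \<equiv> twisted_sum V W c"

lemma tw_module: "module (mscal (tw c))"
  by (unfold_locales)
    (auto simp: twisted_sum_def VS.scale_right_distrib WS.scale_right_distrib
       VS.scale_left_distrib WS.scale_left_distrib)

lemma mscal_tw: "mscal (tw c) q (z, u) = (mscal V q z, mscal W q u)"
  by (simp add: twisted_sum_def)

lemma act_at_tw:
  "act_at (tw c) a l (z, u) = (act_at V a l z + subst_lambda (mscal V) (c a u) [:l:], act_at W a l u)"
proof -
  interpret T: der_module "mscal (tw c)" using tw_module by (simp add: der_module_def)
  have 1: "module_hom (mscal V) (mscal (tw c)) (\<lambda>x. (x, 0))"
    by (simp add: module_hom_iff VS.module_axioms T.module_axioms mscal_tw)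
  have 2: "module_hom (mscal W) (mscal (tw c)) (\<lambda>y. (0, y))"
    by (simp add: module_hom_iff WS.module_axioms T.module_axioms mscal_tw)
  have "act (tw c) a (z, u) = map_poly (\<lambda>x. (x, 0)) (act V a z + c a u) + map_poly (\<lambda>y. (0, y)) (act W a u)"
    by (simp add: twisted_sum_def)
  then show ?thesis
    by (simp add: act_at_def subst_lambda_map_poly[OF 1] subst_lambda_map_poly[OF 2])
qed

lemma tw_star: "star (tw c) (v, 0) (0, w) f g \<longleftrightarrow> has_symbols c f g" if c: "cochain c"
proof -
  have c0: "subst_lambda (mscal V) (c a 0) [:l:] = 0" for a l
    using sesquilinear_zero(1)[OF c[unfolded cochain_def]] .
  have W0: "act_at W a l 0 = 0" and V0: "act_at V a l 0 = 0" for a l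
    by (rule sesquilinear_zero(1)[OF W_sesq] sesquilinear_zero(1)[OF V_sesq])+
  have sy: "c a w = papply (mscal V) f v \<longleftrightarrow> (\<forall>l. subst_lambda (mscal V) (c a w) [:l:] = mscal V (poly f [:l:]) v)" for a f
    by (auto intro: VS.subst_lambda_eqI)
  have "\<exists>p q. z = mscal V p v \<and> u = mscal W q w" for z u using V_basis(1) W_basis(1) by blast
  then show ?thesis
    unfolding star_iff[OF tw_module] has_symbols_def sy
    using V_basis(2) W_basis(2) by (auto simp: mscal_tw act_at_tw V_act W_act c0 W0 V0 split_paired_all zero_prod_def)
qed

lemma tw_sesquilinear_iff:
  "sesquilinear (scal R) (mscal (tw c)) (mscal (tw c)) (act_at (tw c)) \<longleftrightarrow> cochain c"
proof
  assume "cochain c"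
  then show "sesquilinear (scal R) (mscal (tw c)) (mscal (tw c)) (act_at (tw c))"
    using V_sesq W_sesq unfolding cochain_def sesquilinear_def
    by (simp add: split_paired_all act_at_tw mscal_tw VS.scale_right_distrib)
next
  assume T: "sesquilinear (scal R) (mscal (tw c)) (mscal (tw c)) (act_at (tw c))"
  have V0: "act_at V a l 0 = 0" for a l
    by (rule sesquilinear_zero(1)[OF V_sesq])
  have c: "subst_lambda (mscal V) (c a u) [:l:] = fst (act_at (tw c) a l (0, u))" for a l u
    by (simp add: act_at_tw V0)
  have s: "(0, mscal W q u) = mscal (tw c) q (0, u)" "(0, u + u') = (0, u) + (0::'v, u')"
    "mscal V q (fst t) = fst (mscal (tw c) q t)" for q u u' t
    by (simp_all add: mscal_tw twisted_sum_def split: prod.split)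
  show "cochain c"
    unfolding cochain_def sesquilinear_def
  proof (intro conjI allI)
    note T = T[unfolded sesquilinear_def]
    show "subst_lambda (mscal V) (c (a + b) u) [:l:] = subst_lambda (mscal V) (c a u) [:l:] + subst_lambda (mscal V) (c b u) [:l:]" for a b l u
      unfolding c using T by (metis fst_add)
    show "subst_lambda (mscal V) (c a (u + u')) [:l:] = subst_lambda (mscal V) (c a u) [:l:] + subst_lambda (mscal V) (c a u') [:l:]" for a l u u'
      unfolding c s(2) using T by (metis fst_add)
    show "subst_lambda (mscal V) (c (scal R p a) u) [:l:] = mscal V [:poly p (- l):] (subst_lambda (mscal V) (c a u) [:l:])" for p a l u
      unfolding c s(3) using T by metis
    show "subst_lambda (mscal V) (c a (mscal W q u)) [:l:] = mscal V (pcompose q [:l, 1:]) (subst_lambda (mscal V) (c a u) [:l:])" for q a l u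
      unfolding c s(1,3) using T by metis
  qed
qed

lemma ext_cocycles_iff:
  "c \<in> ext_cocycles R V W \<longleftrightarrow> cochain c \<and> (\<exists>f g. has_symbols c f g \<and> cocycle f g)"
proof
  assume "c \<in> ext_cocycles R V W"
  then have E: "conformal_module R (tw c)" by (simp add: ext_cocycles_def)
  then have c: "cochain c" unfolding conformal_module_iff tw_sesquilinear_iff by blast
  obtain f g where s: "has_symbols c f g" using has_symbols_exist by blast
  with c tw_star star_cocycle[OF E] show "cochain c \<and> (\<exists>f g. has_symbols c f g \<and> cocycle f g)" by blast
next
  assume "cochain c \<and> (\<exists>f g. has_symbols c f g \<and> cocycle f g)"
  then obtain f g where c: "cochain c" and s: "has_symbols c f g" and fg: "cocycle f g" by blast
  have T: "sesquilinear (scal R) (mscal (tw c)) (mscal (tw c)) (act_at (tw c))"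
    using c tw_sesquilinear_iff by blast
  have st: "star (tw c) (v, 0) (0, w) f g" using tw_star[OF c] s by blast
  have c0: "subst_lambda (mscal V) (c a 0) [:l:] = 0" for a l
    using sesquilinear_zero(1)[OF c[unfolded cochain_def]] .
  have W0: "act_at W a l 0 = 0" for a l
    by (rule sesquilinear_zero(1)[OF W_sesq])
  have "jacobi_at R (tw c) a b z" for a b z
  proof (rule jacobi_from_generators[OF R_facts(1) tw_module T])
    show "\<exists>p q. a = scal R p A + scal R q B" for a by (rule R_facts)
    show "\<exists>p q. z = mscal (tw c) p (v, 0) + mscal (tw c) q (0, w)" for z
      using st unfolding star_iff[OF tw_module] by blast
    fix a b z assume ab: "a \<in> {A, B}" "b \<in> {A, B}" and "z \<in> {(v, 0), (0, w)}"
    then consider "z = (v, 0)" | "z = (0, w)" by auto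
    then show "jacobi_at R (tw c) a b z"
    proof cases
      case 1
      have "act_at V a l (act_at V b m v) = act_at V (bracket_at R a l b) (l + m) v + act_at V b m (act_at V a l v)" for l m
        using modules(1) unfolding conformal_module_iff by blast
      then show ?thesis unfolding jacobi_at_def 1 by (simp only: act_at_tw c0 W0 add_0_right add_Pair) simp
    next
      case 2
      then show ?thesis using jacobi_iff_cocycle[OF tw_module T st] fg ab by blast
    qed
  qed
  then show "c \<in> ext_cocycles R V W"
    unfolding ext_cocycles_def conformal_module_iff jacobi_at_def using R_facts(1) tw_module T by blast
qed

lemma tw_extension:
  assumes "c \<in> ext_cocycles R V W"
  shows "extension R V W (tw c) (\<lambda>x. (x, 0)) snd"
proof -
  have E: "conformal_module R (tw c)" using assms by (simp add: ext_cocycles_def)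
  have c: "cochain c" using assms ext_cocycles_iff by blast
  have c0: "subst_lambda (mscal V) (c a 0) [:l:] = 0" for a l
    using sesquilinear_zero(1)[OF c[unfolded cochain_def]] .
  have W0: "act_at W a l 0 = 0" for a l
    by (rule sesquilinear_zero(1)[OF W_sesq])
  interpret T: der_module "mscal (tw c)" using tw_module by (simp add: der_module_def)
  have i: "module_hom (mscal V) (mscal (tw c)) (\<lambda>x. (x, 0))"
    by (simp add: module_hom_iff VS.module_axioms T.module_axioms mscal_tw)
  have p: "module_hom (mscal (tw c)) (mscal W) snd"
    by (simp add: module_hom_iff WS.module_axioms T.module_axioms mscal_tw split_paired_all)
  have "act (tw c) a (x, 0) = map_poly (\<lambda>x. (x, 0)) (act V a x)" for a x
    by (rule T.subst_lambda_eqI)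
      (use act_at_tw[of c a _ x 0] in \<open>simp add: subst_lambda_map_poly[OF i] c0 W0[unfolded act_at_def] act_at_def\<close>)
  moreover have "act W a (snd x) = map_poly snd (act (tw c) a x)" for a x
    by (rule WS.subst_lambda_eqI)
      (use act_at_tw[of c a _ "fst x" "snd x"] in \<open>simp add: subst_lambda_map_poly[OF p] act_at_def\<close>)
  ultimately have "cmod_hom V (tw c) (\<lambda>x. (x, 0))" "cmod_hom (tw c) W snd"
    using i p by (simp_all add: cmod_hom_def)
  then show ?thesis
    unfolding extension_def using modules E by (auto simp: inj_on_def surj_def image_iff)
qed

lemma cocycle_realized:
  assumes "cocycle f g"
  obtains c where "c \<in> ext_cocycles R V W" "has_symbols c f g"
    "extension R V W (tw c) (\<lambda>x. (x, 0)) snd" "star (tw c) (v, 0) (0, w) f g"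
proof -
  obtain c where c: "cochain c" "has_symbols c f g" using cochain_exists by blast
  then have "c \<in> ext_cocycles R V W" using ext_cocycles_iff assms by blast
  then show ?thesis using that c tw_extension tw_star by blast
qed

lemma direct_sum_extension:
  "extension R V W (direct_sum V W) (\<lambda>x. (x, 0)) snd" "star (direct_sum V W) (v, 0) (0, w) 0 0"
proof -
  have c: "cochain (\<lambda>_ _. 0)" by (simp add: cochain_def sesquilinear_def)
  have s: "has_symbols (\<lambda>_ _. 0) 0 0" by (simp add: has_symbols_def)
  have "cocycle 0 0" by (simp add: ext_cocycle_def jacobi_defect_def)
  with c s have "(\<lambda>_ _. 0) \<in> ext_cocycles R V W" using ext_cocycles_iff by blast
  then show "extension R V W (direct_sum V W) (\<lambda>x. (x, 0)) snd" "star (direct_sum V W) (v, 0) (0, w) 0 0"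
    unfolding direct_sum_def using tw_extension tw_star[OF c] s by blast+
qed

lemma trivial_iff_coboundary:
  assumes ext: "extension R V W E i p" and y: "p y = w" and st: "star E (i v) y f g"
  shows "trivial_ext V W E i p \<longleftrightarrow> (\<exists>P. f = cob_poly sA tA P \<and> g = cob_poly sB tB P)"
proof
  assume "trivial_ext V W E i p"
  from cohomologous_if_equivalent[OF ext direct_sum_extension(1) y snd_conv st direct_sum_extension(2)
      this[unfolded trivial_ext_def]]
  show "\<exists>P. f = cob_poly sA tA P \<and> g = cob_poly sB tB P" by simp
next
  assume "\<exists>P. f = cob_poly sA tA P \<and> g = cob_poly sB tB P"
  then obtain P where "f = 0 + cob_poly sA tA P" "g = 0 + cob_poly sB tB P" by auto
  from equivalent_if_cohomologous[OF ext direct_sum_extension(1) y snd_conv st direct_sum_extension(2) this]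
  show "trivial_ext V W E i p" by (simp add: trivial_ext_def)
qed

lemma trivial_cocycle_iff:
  assumes "c \<in> ext_cocycles R V W" "has_symbols c f g"
  shows "c \<in> trivial_cocycles R V W \<longleftrightarrow> (\<exists>P. f = cob_poly sA tA P \<and> g = cob_poly sB tB P)"
proof -
  have "star (tw c) (v, 0) (0, w) f g" using assms ext_cocycles_iff tw_star by blast
  from trivial_iff_coboundary[OF tw_extension[OF assms(1)] snd_conv this]
  show ?thesis using assms(1) by (simp add: trivial_cocycles_def)
qed

section \<open>Normal forms of extensions\<close>

text \<open>
  Whether \<open>B\<close> acts by the same polynomial on both modules decides which normal form can occur; if
  \<open>(d1, d2) \<noteq> (d1', d2')\<close>, one of the two polynomials is zero and the other is not.
\<close>

lemma cocycle_normal_form: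
  assumes c: "cocycle f g"
  shows "\<exists>P f' g'. f = f' + cob_poly sA tA P \<and> g = g' + cob_poly sB tB P \<and>
    (f' = 0 \<and> g' = 0 \<or> caseI f' g' \<or> caseII f' g')"
proof (cases "smult d2 \<phi> = smult d2' \<phi>'")
  case False
  from split_if_B_differs[OF c idem False]
  obtain p where "f = cob_poly sA tA p" "g = cob_poly sB tB p" by blast
  then show ?thesis by (intro exI[of _ p] exI[of _ 0]) simp
next
  case eq: True
  show ?thesis
  proof (cases "d2 = 0")
    case True
    with eq params have d: "d1 = 1" "d2 = 0" "d1' = 1" "d2' = 0" by auto
    note c = c[unfolded d]
    have g: "g = 0" by (rule vir_B_zero[OF c])
    have B0: "cob_poly (symbolB 0 \<phi>) (symbolB 0 \<phi>') p = 0" for p by (rule ev2_eqI) simp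
    show ?thesis
    proof (cases "\<beta> = \<beta>'")
      case False
      from vir_split_if_beta_differs[OF c False]
      obtain p where "f = cob_poly (symbolA 1 \<alpha> \<beta>) (symbolA 1 \<alpha>' \<beta>') p" by blast
      then show ?thesis unfolding d by (intro exI[of _ p] exI[of _ 0]) (simp add: g B0)
    next
      case b: True
      from vir_normal_form[OF c[folded b] params(3)]
      obtain p where p: "f - cob_poly (symbolA 1 \<alpha> \<beta>) (symbolA 1 \<alpha>' \<beta>') p = 0 \<or>
          case_one_f \<alpha> \<beta> \<alpha>' (f - cob_poly (symbolA 1 \<alpha> \<beta>) (symbolA 1 \<alpha>' \<beta>') p)" using b by blast
      show ?thesis
      proof (intro exI conjI)
        show "f = (f - cob_poly sA tA p) + cob_poly sA tA p" by simp
        show "g = 0 + cob_poly sB tB p" by (simp add: d g B0)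
        show "f - cob_poly sA tA p = 0 \<and> (0 :: complex poly poly) = 0 \<or>
            caseI (f - cob_poly sA tA p) 0 \<or> caseII (f - cob_poly sA tA p) 0"
          using p case_one_f_weights[of \<alpha> \<beta> \<alpha>'] params unfolding case_one_def d b by auto
      qed
    qed
  next
    case False
    with eq params have d: "d1 = 0" "d2 = 1" "d1' = 0" "d2' = 1" and \<phi>: "\<phi>' = \<phi>" by auto
    note c = c[unfolded d \<phi>]
    have f: "f = 0" by (rule normal_form_B_equal(1)[OF c params(4)])
    have A0: "cob_poly (symbolA 0 \<alpha> \<beta>) (symbolA 0 \<alpha>' \<beta>') p = 0" for p by (rule ev2_eqI) simp
    from normal_form_B_equal(2)[OF c params(4)]
    obtain p t where t: "g - cob_poly (symbolB 1 \<phi>) (symbolB 1 \<phi>) p = lam_poly t" by blast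
    show ?thesis
    proof (cases "\<exists>k. t = smult k ([:0, 1:] * \<phi>)")
      case True
      then obtain k where "lam_poly t = cob_poly (symbolB 1 \<phi>) (symbolB 1 \<phi>) (smult k [:0, 1:])"
        using lam_multiple_coboundary by metis
      with t have "g = cob_poly (symbolB 1 \<phi>) (symbolB 1 \<phi>) p + cob_poly (symbolB 1 \<phi>) (symbolB 1 \<phi>) (smult k [:0, 1:])"
        by (simp add: algebra_simps)
      then have "g = cob_poly (symbolB 1 \<phi>) (symbolB 1 \<phi>) (p + smult k [:0, 1:])"
        by (intro ev2_eqI) (simp add: algebra_simps)
      then show ?thesis
        unfolding d \<phi> by (intro exI[of _ "p + smult k [:0, 1:]"] exI[of _ 0]) (simp add: f A0)
    next
      case False
      then have "caseII 0 (lam_poly t)"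
        unfolding case_two_def d \<phi> using lam_poly_pCons(2) by metis
      moreover have "g = lam_poly t + cob_poly sB tB p" unfolding d \<phi> t[symmetric] by simp
      moreover have "f = 0 + cob_poly sA tA p" by (simp add: d f A0)
      ultimately show ?thesis by blast
    qed
  qed
qed

lemma normal_form_not_coboundary:
  assumes c: "cocycle f g"
    and nf: "caseI f g \<or> caseII f g"
  shows "\<not> (f = cob_poly sA tA P \<and> g = cob_poly sB tB P)"
  using nf
proof
  assume "caseI f g"
  then have "d1 = 1" "d1' = 1" "\<beta>' = \<beta>" "case_one_f \<alpha> \<beta> \<alpha>' f" by (auto simp: case_one_def)
  then show ?thesis using case_one_f_nontrivial[OF _ params(3)] by metis
next
  assume two: "caseII f g"
  then have d: "d1 = 0" "d2 = 1" "d1' = 0" "d2' = 1" and \<phi>: "\<phi>' = \<phi>" by (simp_all add: case_two_def)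
  obtain s t where st: "f = lam_poly s" "g = lam_poly t" "s \<noteq> 0 \<or> \<not> (\<exists>k. t = smult k ([:0, 1:] * \<phi>))"
    using two unfolding case_two_def by blast
  have "f = 0" by (rule normal_form_B_equal(1)[OF c[unfolded d \<phi>] params(4)])
  then have "poly s l = 0" for l using ev2_lam_poly[of s 0 l] by (simp add: st)
  then have "s = 0" using poly_all_0_iff_0 by blast
  show ?thesis
  proof
    assume "f = cob_poly sA tA P \<and> g = cob_poly sB tB P"
    then have g: "g = cob_poly (symbolB 1 \<phi>) (symbolB 1 \<phi>) P" by (simp add: d \<phi>)
    have "poly t l = poly \<phi> l * (poly P (x + l) - poly P x)" for x l
      using ev2_lam_poly[of t x l] unfolding st(2)[symmetric] g by (simp add: algebra_simps)
    from lam_multiple_if_coboundary[OF params(4) this] st(3) \<open>s = 0\<close> show False by blast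
  qed
qed

lemma normal_form_cocycle:
  assumes "caseI f g \<or> caseII f g \<and> f = 0"
  shows "cocycle f g"
  using assms
proof
  assume *: "caseI f g"
  then have d: "d1 = 1" "d2 = 0" "d1' = 1" "d2' = 0" "\<beta>' = \<beta>" "g = 0" "case_one_f \<alpha> \<beta> \<alpha>' f"
    by (auto simp: case_one_def)
  show ?thesis unfolding d(1-6) by (rule case_one_f_cocycle[OF d(7)])
next
  assume *: "caseII f g \<and> f = 0"
  then have d: "d1 = 0" "d2 = 1" "d1' = 0" "d2' = 1" "\<phi>' = \<phi>" "f = 0" by (simp_all add: case_two_def)
  obtain t where "g = lam_poly t" using * unfolding case_two_def by blast
  then show ?thesis unfolding d by (simp only: lam_poly_cocycle)
qed

section \<open>The dimension of Ext\<close>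

lemma map_poly_scale: "subst_lambda (mscal V) (map_poly (mscal V q) p) [:l:] = mscal V q (subst_lambda (mscal V) p [:l:])"
  by (rule subst_lambda_map_poly[OF VS.module_hom_scale])

lemma has_symbols_iff:
  "has_symbols c f g \<longleftrightarrow> (\<forall>l. subst_lambda (mscal V) (c A w) [:l:] = mscal V (poly f [:l:]) v) \<and>
     (\<forall>l. subst_lambda (mscal V) (c B w) [:l:] = mscal V (poly g [:l:]) v)"
  unfolding has_symbols_def by (auto intro: VS.subst_lambda_eqI)

lemma cocycle_scale_minus: "cocycle_scale V (- k) c = - cocycle_scale V k c"
proof (intro ext, rule VS.subst_lambda_eqI)
  fix a z l
  have "[:- k:] = - [:k:]" by simp
  then show "subst_lambda (mscal V) (cocycle_scale V (- k) c a z) [:l:]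
      = subst_lambda (mscal V) ((- cocycle_scale V k c) a z) [:l:]"
    by (simp only: cocycle_scale_def map_poly_scale fun_Compl_def uminus_apply
        VS.subst_lambda_minus VS.scale_minus_left)
qed

lemma combination_cochain:
  assumes "cochain c" "cochain c'" "has_symbols c f g" "has_symbols c' f' g'"
  shows "cochain (c + cocycle_scale V k c')"
    and "has_symbols (c + cocycle_scale V k c') (f + smult [:k:] f') (g + smult [:k:] g')"
  using assms unfolding cochain_def sesquilinear_def has_symbols_iff cocycle_scale_def
  by (simp_all add: map_poly_scale VS.scale_right_distrib VS.scale_left_distrib mult.commute algebra_simps)

lemma combination_cocycle:
  assumes "cocycle f g" "cocycle f' g'"
  shows "cocycle (f + smult [:k:] f') (g + smult [:k:] g')"
proof -
  have lin: "jacobi_defect s t (f + smult [:k:] f') s' t' (g + smult [:k:] g') x l m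
      = jacobi_defect s t f s' t' g x l m + k * jacobi_defect s t f' s' t' g' x l m" for s t s' t' f f' g g' x l m
    by (simp add: jacobi_defect_def algebra_simps)
  have c: "jacobi_defect sA tA f sA tA f x l m = (l - m) * ev2 f x (l + m)"
      "jacobi_defect sA tA f sB tB g x l m = 0" "jacobi_defect sB tB g sB tB g x l m = 0"
    if "cocycle f g" for f g x l m using that unfolding ext_cocycle_def by blast+
  show ?thesis
    unfolding ext_cocycle_def lin c[OF assms(1)] c[OF assms(2)] by (simp add: algebra_simps)
qed

text \<open>
  The symbols of a linear combination of extension cocycles are the same combination of their symbols,
  so independence and spanning modulo trivial cocycles can be decided on polynomials.
\<close>

lemma combination_sum:
  assumes "finite S" "\<And>x. x \<in> S \<Longrightarrow> cochain x \<and> has_symbols x (F x) (G x) \<and> cocycle (F x) (G x)"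
    and "cochain c" "has_symbols c f g" "cocycle f g"
  shows "cochain (c - (\<Sum>x\<in>S. cocycle_scale V (k x) x)) \<and>
    has_symbols (c - (\<Sum>x\<in>S. cocycle_scale V (k x) x)) (f - (\<Sum>x\<in>S. smult [:k x:] (F x))) (g - (\<Sum>x\<in>S. smult [:k x:] (G x))) \<and>
    cocycle (f - (\<Sum>x\<in>S. smult [:k x:] (F x))) (g - (\<Sum>x\<in>S. smult [:k x:] (G x)))"
  using assms(1,2)
proof (induction S)
  case empty
  then show ?case using assms by simp
next
  case (insert x S)
  let ?c = "c - (\<Sum>x\<in>S. cocycle_scale V (k x) x)" and ?f = "f - (\<Sum>x\<in>S. smult [:k x:] (F x))"
    and ?g = "g - (\<Sum>x\<in>S. smult [:k x:] (G x))"
  have IH: "cochain ?c" "has_symbols ?c ?f ?g" "cocycle ?f ?g"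
    using insert.IH[OF insert.prems[OF insertI2]] by blast+
  have x: "cochain x" "has_symbols x (F x) (G x)" "cocycle (F x) (G x)" using insert by auto
  have "c - (\<Sum>x\<in>insert x S. cocycle_scale V (k x) x) = ?c + cocycle_scale V (- k x) x"
    "f - (\<Sum>x\<in>insert x S. smult [:k x:] (F x)) = ?f + smult [:- k x:] (F x)"
    "g - (\<Sum>x\<in>insert x S. smult [:k x:] (G x)) = ?g + smult [:- k x:] (G x)"
    using insert(1,2) smult_minus_left[of "[:k x:]"] by (simp_all add: cocycle_scale_minus)
  then show ?case
    using combination_cochain[OF IH(1) x(1) IH(2) x(2), of "- k x"] combination_cocycle[OF IH(3) x(3), of "- k x"]
    by (simp only: simp_thms)
qed

lemma ext_cocycle_symbols:
  assumes "c \<in> ext_cocycles R V W"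
  obtains f g where "cochain c" "has_symbols c f g" "cocycle f g"
  using assms ext_cocycles_iff by blast

lemma ext_cocycle_family:
  assumes S: "S \<subseteq> ext_cocycles R V W"
  obtains F G where "\<And>x. x \<in> S \<Longrightarrow> cochain x \<and> has_symbols x (F x) (G x) \<and> cocycle (F x) (G x)"
proof -
  have "\<forall>x\<in>S. \<exists>f g. cochain x \<and> has_symbols x f g \<and> cocycle f g"
    using S ext_cocycles_iff by blast
  then show ?thesis using that by metis
qed

lemma combination_trivial_iff:
  assumes S: "finite S" "\<And>x. x \<in> S \<Longrightarrow> cochain x \<and> has_symbols x (F x) (G x) \<and> cocycle (F x) (G x)"
    and c: "cochain c" "has_symbols c f g" "cocycle f g"
  shows "c - (\<Sum>x\<in>S. cocycle_scale V (k x) x) \<in> trivial_cocycles R V W \<longleftrightarrow>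
    (\<exists>P. f - (\<Sum>x\<in>S. smult [:k x:] (F x)) = cob_poly sA tA P \<and> g - (\<Sum>x\<in>S. smult [:k x:] (G x)) = cob_poly sB tB P)"
proof -
  have "c - (\<Sum>x\<in>S. cocycle_scale V (k x) x) \<in> ext_cocycles R V W"
    using combination_sum[OF S c, of k] ext_cocycles_iff by blast
  then show ?thesis
    using trivial_cocycle_iff combination_sum[OF S c, of k] by blast
qed

lemma sum_trivial_iff:
  assumes S: "finite S" "\<And>x. x \<in> S \<Longrightarrow> cochain x \<and> has_symbols x (F x) (G x) \<and> cocycle (F x) (G x)"
  shows "(\<Sum>x\<in>S. cocycle_scale V (k x) x) \<in> trivial_cocycles R V W \<longleftrightarrow>
    (\<exists>P. (\<Sum>x\<in>S. smult [:k x:] (F x)) = cob_poly sA tA P \<and> (\<Sum>x\<in>S. smult [:k x:] (G x)) = cob_poly sB tB P)"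
proof -
  have c: "cochain 0" "has_symbols 0 0 0" "cocycle 0 0"
    by (simp_all add: cochain_def sesquilinear_def has_symbols_def ext_cocycle_def jacobi_defect_def)
  have "0 - (\<Sum>x\<in>S. cocycle_scale V (- k x) x) = (\<Sum>x\<in>S. cocycle_scale V (k x) x)"
    "0 - (\<Sum>x\<in>S. smult [:- k x:] (F x)) = (\<Sum>x\<in>S. smult [:k x:] (F x))"
    "0 - (\<Sum>x\<in>S. smult [:- k x:] (G x)) = (\<Sum>x\<in>S. smult [:k x:] (G x))"
    using smult_minus_left[of "[:k _:]"] by (simp_all add: cocycle_scale_minus sum_negf)
  then show ?thesis using combination_trivial_iff[OF S c, of "\<lambda>x. - k x"] by simp
qed

lemma dim_Ext_one:
  assumes d: "d1 = 1" "d2 = 0" "d1' = 1" "d2' = 0" "\<beta>' = \<beta>"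
    and e: "std_cocycle \<alpha> n e" "\<alpha>' = \<alpha> + of_nat n"
  shows "dim_Ext_eq R W V 1"
proof -
  let ?f = "shift_inner \<beta> e"
  have std: "case_one_f \<alpha> \<beta> \<alpha>' (smult [:s:] ?f)" if "s \<noteq> 0" for s
    by (rule case_one_f_std[OF e that])
  have "cocycle ?f 0"
    using case_one_f_cocycle[OF std[of 1]] unfolding d by (simp flip: one_pCons)
  then obtain c where c: "c \<in> ext_cocycles R V W" "has_symbols c ?f 0"
    using cocycle_realized by blast
  have fam: "cochain x \<and> has_symbols x ?f 0 \<and> cocycle ?f 0" if "x \<in> {c}" for x
    using that c \<open>cocycle ?f 0\<close> ext_cocycles_iff by blast
  have B0: "cob_poly sB tB P = 0" for P by (rule ev2_eqI) (simp add: d)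
  have "independent_mod (cocycle_scale V) (trivial_cocycles R V W) {c}"
    unfolding independent_mod_def
  proof (intro allI impI)
    fix k assume "(\<Sum>x\<in>{c}. cocycle_scale V (k x) x) \<in> trivial_cocycles R V W"
    then obtain P where "smult [:k c:] ?f = cob_poly sA tA P"
      using sum_trivial_iff[of "{c}" "\<lambda>_. ?f" "\<lambda>_. 0" k] fam by auto
    then have "k c = 0"
      using case_one_f_nontrivial[OF std params(3)] unfolding d by metis
    then show "\<forall>x\<in>{c}. k x = 0" by simp
  qed
  moreover have "spanning_mod (cocycle_scale V) (ext_cocycles R V W) (trivial_cocycles R V W) {c}"
    unfolding spanning_mod_def
  proof
    fix z assume "z \<in> ext_cocycles R V W"
    then obtain f g where z: "cochain z" "has_symbols z f g" "cocycle f g" by (rule ext_cocycle_symbols)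
    obtain P f' where P: "f = f' + cob_poly sA tA P" "f' = 0 \<or> case_one_f \<alpha> \<beta> \<alpha>' f'"
      using cocycle_normal_form[OF z(3)] unfolding case_one_def case_two_def d by auto
    have g: "g = 0" using vir_B_zero z(3) unfolding d by blast
    have "\<exists>s. f' = smult [:s:] ?f"
    proof (cases "f' = 0")
      case True
      then show ?thesis by (intro exI[of _ 0]) simp
    next
      case False
      have "\<alpha>' \<noteq> \<alpha>" using e std_cocycle_coeffs(1)[OF e(1) params(3)] by auto
      with False P obtain n' e' s where e': "std_cocycle \<alpha> n' e'" "\<alpha>' = \<alpha> + of_nat n'"
        "\<And>x l. ev2 f' x l = s * ev2 e' (x + \<beta>) l"
        unfolding case_one_f_iff by blast
      have "n' = n" using e(2) e'(2) by simp
      with e' e have "e' = e" using std_cocycle_unique by blast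
      then have "f' = smult [:s:] ?f" using e'(3) by (intro ev2_eqI) simp
      then show ?thesis by blast
    qed
    then obtain s where "f - smult [:s:] ?f = cob_poly sA tA P" using P by auto
    then have "z - (\<Sum>x\<in>{c}. cocycle_scale V s x) \<in> trivial_cocycles R V W"
      using combination_trivial_iff[of "{c}" "\<lambda>_. ?f" "\<lambda>_. 0" z f g "\<lambda>_. s"] fam z by (auto simp: g B0)
    then show "\<exists>k. z - (\<Sum>x\<in>{c}. cocycle_scale V (k x) x) \<in> trivial_cocycles R V W"
      by (intro exI[of _ "\<lambda>_. s"])
  qed
  ultimately show ?thesis
    unfolding dim_Ext_eq_def using c(1) by (intro exI[of _ "{c}"]) simp
qed

lemma dim_Ext_two:
  assumes d: "d1 = 1" "d2 = 0" "d1' = 1" "d2' = 0" "\<beta>' = \<beta>" "\<alpha>' = \<alpha>"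
  shows "dim_Ext_eq R W V 2"
proof -
  have std: "case_one_f \<alpha> \<beta> \<alpha>' [:[:s0:], [:s1:]:]" if "(s0, s1) \<noteq> (0, 0)" for s0 s1
    unfolding case_one_f_iff using that d(6)
    by (intro disjI1 conjI exI[of _ s0] exI[of _ s1]) (auto simp: mult.commute)
  have coc: "cocycle [:[:1:], [:0:]:] 0" "cocycle [:[:0:], [:1:]:] 0"
    unfolding d(1-5) by (rule case_one_f_cocycle[OF std], simp)+
  obtain c where c: "c \<in> ext_cocycles R V W" "has_symbols c [:[:1:], [:0:]:] 0" using cocycle_realized[OF coc(1)] by blast
  obtain c' where c': "c' \<in> ext_cocycles R V W" "has_symbols c' [:[:0:], [:1:]:] 0" using cocycle_realized[OF coc(2)] by blast
  have ne: "c \<noteq> c'"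
  proof
    assume "c = c'"
    with c(2) have "has_symbols c' [:[:1:], [:0:]:] 0" by simp
    from has_symbols_unique[OF this c'(2)] show False by simp
  qed
  define F where "F x = (if x = c then [:[:1:], [:0:]:] else [:[:0:], [:1::complex:]:])" for x
  have fam: "cochain x \<and> has_symbols x (F x) 0 \<and> cocycle (F x) 0" if "x \<in> {c, c'}" for x
    using that c c' coc ext_cocycles_iff ne by (auto simp: F_def)
  have sum: "(\<Sum>x\<in>{c, c'}. smult [:k x:] (F x)) = [:[:k c:], [:k c':]:]" for k
    using ne by (simp add: F_def)
  have B0: "cob_poly sB tB P = 0" for P by (rule ev2_eqI) (simp add: d)
  have "independent_mod (cocycle_scale V) (trivial_cocycles R V W) {c, c'}"
    unfolding independent_mod_def
  proof (intro allI impI)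
    fix k assume "(\<Sum>x\<in>{c, c'}. cocycle_scale V (k x) x) \<in> trivial_cocycles R V W"
    then obtain P where "(\<Sum>x\<in>{c, c'}. smult [:k x:] (F x)) = cob_poly sA tA P"
      using sum_trivial_iff[of "{c, c'}" F "\<lambda>_. 0" k] fam by auto
    then have "(k c, k c') = (0, 0)"
      using case_one_f_nontrivial[OF std params(3)] unfolding sum d by metis
    then show "\<forall>x\<in>{c, c'}. k x = 0" by simp
  qed
  moreover have "spanning_mod (cocycle_scale V) (ext_cocycles R V W) (trivial_cocycles R V W) {c, c'}"
    unfolding spanning_mod_def
  proof
    fix z assume "z \<in> ext_cocycles R V W"
    then obtain f g where z: "cochain z" "has_symbols z f g" "cocycle f g" by (rule ext_cocycle_symbols)
    obtain P f' where P: "f = f' + cob_poly sA tA P" "f' = 0 \<or> case_one_f \<alpha> \<beta> \<alpha>' f'"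
      using cocycle_normal_form[OF z(3)] unfolding case_one_def case_two_def d by auto
    have g: "g = 0" using vir_B_zero z(3) unfolding d by blast
    obtain s0 s1 where "f' = [:[:s0:], [:s1:]:]"
    proof (cases "f' = 0")
      case True
      then show ?thesis using that[of 0 0] by simp
    next
      case False
      with P have "case_one_f \<alpha> \<beta> \<alpha>' f'" by blast
      then obtain s0 s1 where "\<And>x l. ev2 f' x l = s0 + s1 * l"
        unfolding case_one_f_iff using d(6) std_cocycle_coeffs(1)[OF _ params(3)] by fastforce
      then have "f' = [:[:s0:], [:s1:]:]" by (intro ev2_eqI) simp
      then show ?thesis by (rule that)
    qed
    then have f: "f - [:[:s0:], [:s1:]:] = cob_poly sA tA P" using P by simp
    define k where "k x = (if x = c then s0 else s1)" for x
    have "[:[:s0:], [:s1:]:] = (\<Sum>x\<in>{c, c'}. smult [:k x:] (F x))"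
      unfolding sum using ne by (simp add: k_def)
    then have "z - (\<Sum>x\<in>{c, c'}. cocycle_scale V (k x) x) \<in> trivial_cocycles R V W"
      using combination_trivial_iff[of "{c, c'}" F "\<lambda>_. 0" z f g k] fam z f by (auto simp: g B0)
    then show "\<exists>k. z - (\<Sum>x\<in>{c, c'}. cocycle_scale V (k x) x) \<in> trivial_cocycles R V W" by blast
  qed
  ultimately show ?thesis
    unfolding dim_Ext_eq_def using c(1) c'(1) ne by (intro exI[of _ "{c, c'}"]) simp
qed

text \<open>
  Finitely many cocycles are cohomologous to finitely many polynomials in \<open>\<lambda>\<close>, and a power of \<open>\<lambda>\<close> above
  all their degrees and the degree of \<open>\<lambda>\<phi>\<close> is not in their span modulo \<open>\<lambda>\<phi>\<close>.
\<close>

lemma Ext_infinite: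
  assumes d: "d1 = 0" "d2 = 1" "d1' = 0" "d2' = 1" "\<phi>' = \<phi>"
  shows "infinite_dim_Ext R W V"
  unfolding infinite_dim_Ext_def
proof
  assume "\<exists>S. finite S \<and> S \<subseteq> ext_cocycles R V W \<and>
       spanning_mod (cocycle_scale V) (ext_cocycles R V W) (trivial_cocycles R V W) S"
  then obtain S where S: "finite S" "S \<subseteq> ext_cocycles R V W"
    "spanning_mod (cocycle_scale V) (ext_cocycles R V W) (trivial_cocycles R V W) S" by blast
  obtain F G where FG: "\<And>x. x \<in> S \<Longrightarrow> cochain x \<and> has_symbols x (F x) (G x) \<and> cocycle (F x) (G x)"
    using ext_cocycle_family[OF S(2)] by blast
  have "\<forall>x\<in>S. \<exists>p t. G x - cob_poly (symbolB 1 \<phi>) (symbolB 1 \<phi>) p = lam_poly t"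
    using FG normal_form_B_equal(2)[OF _ params(4)] unfolding d by blast
  then obtain p t where pt: "\<And>x. x \<in> S \<Longrightarrow> G x - cob_poly (symbolB 1 \<phi>) (symbolB 1 \<phi>) (p x) = lam_poly (t x)"
    by metis
  define N where "N = Suc (Max (insert (degree ([:0, 1:] * \<phi>)) ((\<lambda>x. degree (t x)) ` S)))"
  have N: "degree ([:0, 1:] * \<phi>) < N" "\<And>x. x \<in> S \<Longrightarrow> degree (t x) < N"
    unfolding N_def less_Suc_eq_le using S(1) by (auto intro: Max_ge)
  define m where "m = monom (1::complex) N"
  have "cocycle 0 (lam_poly m)" unfolding d by (rule lam_poly_cocycle)
  then obtain z where z: "z \<in> ext_cocycles R V W" "has_symbols z 0 (lam_poly m)" using cocycle_realized by blast
  then obtain k where k: "z - (\<Sum>x\<in>S. cocycle_scale V (k x) x) \<in> trivial_cocycles R V W"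
    using S(3) unfolding spanning_mod_def by blast
  have "cochain z" using z ext_cocycles_iff by blast
  from combination_trivial_iff[OF S(1) FG this z(2) \<open>cocycle 0 (lam_poly m)\<close>, of k] k
  obtain P where P: "lam_poly m - (\<Sum>x\<in>S. smult [:k x:] (G x)) = cob_poly (symbolB 1 \<phi>) (symbolB 1 \<phi>) P"
    unfolding d by blast
  define q where "q = P + (\<Sum>x\<in>S. smult (k x) (p x))"
  have "poly (m - (\<Sum>x\<in>S. smult (k x) (t x))) l = poly \<phi> l * (poly q (x + l) - poly q x)" for x l
  proof -
    have G: "ev2 (G y) x l = poly (t y) l + poly \<phi> l * (poly (p y) (x + l) - poly (p y) x)" if "y \<in> S" for y
    proof -
      have "ev2 (G y - cob_poly (symbolB 1 \<phi>) (symbolB 1 \<phi>) (p y)) x l = poly (t y) l"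
        by (simp only: pt[OF that] ev2_lam_poly)
      then show ?thesis by (simp add: algebra_simps)
    qed
    have "ev2 (lam_poly m - (\<Sum>x\<in>S. smult [:k x:] (G x))) x l = poly \<phi> l * (poly P (x + l) - poly P x)"
      by (simp only: P) (simp add: algebra_simps)
    then have "poly m l - (\<Sum>y\<in>S. k y * (poly (t y) l + poly \<phi> l * (poly (p y) (x + l) - poly (p y) x)))
        = poly \<phi> l * (poly P (x + l) - poly P x)"
      by (simp add: ev2_sum G)
    then show ?thesis
      by (simp add: q_def poly_sum sum.distrib distrib_left right_diff_distrib sum_subtractf sum_distrib_left
          algebra_simps)
  qed
  from lam_multiple_if_coboundary[OF params(4) this]
  obtain r where r: "m - (\<Sum>x\<in>S. smult (k x) (t x)) = smult r ([:0, 1:] * \<phi>)" by blast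
  have "coeff (m - (\<Sum>x\<in>S. smult (k x) (t x))) N = 1"
    using N(2) by (simp add: m_def coeff_sum coeff_eq_0)
  moreover have "coeff (smult r ([:0, 1:] * \<phi>)) N = 0"
    using coeff_eq_0[OF N(1)] by (simp only: coeff_smult mult_zero_right)
  ultimately show False unfolding r by simp
qed

end

section \<open>The classification\<close>

theorem theorem5p6:
  fixes R :: "'r::ab_group_add lca" and A B :: 'r
    and V :: "('r, 'v::ab_group_add) cmod" and v :: 'v
    and W :: "('r, 'w::ab_group_add) cmod" and w :: 'w
    and d1 d2 \<alpha> \<beta> d1' d2' \<alpha>' \<beta>' :: complex and \<phi> \<phi>' :: "complex poly"
  assumes R: "type_I R A B"
    and V: "irreducible_rank_one R A B V v d1 d2 \<alpha> \<beta> \<phi>"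
    and W: "irreducible_rank_one R A B W w d1' d2' \<alpha>' \<beta>' \<phi>'"
  shows
    "(\<forall>(E :: ('r, 'e::ab_group_add) cmod) i p. extension R V W E i p \<longrightarrow>
        (\<exists>y f g. p y = w \<and>
           star_form A B E (i v) y d1 d2 \<alpha> \<beta> \<phi> d1' d2' \<alpha>' \<beta>' \<phi>' f g))
   \<and> (\<forall>(E :: ('r, 'e) cmod) i p. extension R V W E i p \<and> \<not> trivial_ext V W E i p \<longrightarrow>
        (d1, d2) = (d1', d2') \<and>
        (\<exists>(E' :: ('r, 'v \<times> 'w) cmod) i' p' y f g.
           extension R V W E' i' p' \<and> equivalent_ext E i p E' i' p' \<and> p' y = w \<and>
           star_form A B E' (i' v) y d1 d2 \<alpha> \<beta> \<phi> d1' d2' \<alpha>' \<beta>' \<phi>' f g \<and>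
           (case_one d1 d2 \<alpha> \<beta> d1' d2' \<alpha>' \<beta>' f g \<or> case_two d1 d2 \<phi> d1' d2' \<phi>' f g)))
   \<and> (\<forall>(E :: ('r, 'e) cmod) i p y f g.
        extension R V W E i p \<and> p y = w \<and>
        star_form A B E (i v) y d1 d2 \<alpha> \<beta> \<phi> d1' d2' \<alpha>' \<beta>' \<phi>' f g \<and>
        (case_one d1 d2 \<alpha> \<beta> d1' d2' \<alpha>' \<beta>' f g \<or> case_two d1 d2 \<phi> d1' d2' \<phi>' f g) \<longrightarrow>
        \<not> trivial_ext V W E i p)
   \<and> (\<forall>f g.
        case_one d1 d2 \<alpha> \<beta> d1' d2' \<alpha>' \<beta>' f g \<or> (case_two d1 d2 \<phi> d1' d2' \<phi>' f g \<and> f = 0) \<longrightarrow>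
        (\<exists>(E :: ('r, 'v \<times> 'w) cmod) i p y.
           extension R V W E i p \<and> \<not> trivial_ext V W E i p \<and> p y = w \<and>
           star_form A B E (i v) y d1 d2 \<alpha> \<beta> \<phi> d1' d2' \<alpha>' \<beta>' \<phi>' f g))
   \<and> ((d1, d2) = (1, 0) \<and> (d1', d2') = (1, 0) \<and> \<beta> = \<beta>' \<longrightarrow>
        (\<alpha>' = \<alpha> \<longrightarrow> dim_Ext_eq R W V 2) \<and>
        (\<alpha>' - \<alpha> \<in> {2, 3, 4} \<or> (\<alpha>' = 1 \<and> \<alpha> = -4) \<or> subcase_vi \<alpha> \<alpha>' \<longrightarrow> dim_Ext_eq R W V 1))
   \<and> ((d1, d2) = (0, 1) \<and> (d1', d2') = (0, 1) \<and> \<phi> = \<phi>' \<longrightarrow> infinite_dim_Ext R W V)"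
proof -
  interpret rank_one_pair R A B V v W w d1 d2 \<alpha> \<beta> d1' d2' \<alpha>' \<beta>' \<phi> \<phi>'
    using R V W by unfold_locales
  show ?thesis
  proof (intro conjI, goal_cases)
    case 1
    show ?case using extension_star by blast
  next
    case 2
    show ?case
    proof (intro allI impI, elim conjE, goal_cases)
      case (1 E i p)
      note ext = 1(1) and nt = 1(2)
      obtain y f g where y: "p y = w" and st: "star E (i v) y f g" using extension_star[OF ext] by blast
      have fg: "cocycle f g" by (rule star_cocycle[OF extensionD(1)[OF ext] st])
      from cocycle_normal_form[OF fg] obtain P f' g' where
        P: "f = f' + cob_poly sA tA P" "g = g' + cob_poly sB tB P" and
        nf: "f' = 0 \<and> g' = 0 \<or> caseI f' g' \<or> caseII f' g'" by blast
      have "\<not> (f' = 0 \<and> g' = 0)" using nt trivial_iff_coboundary[OF ext y st] P by auto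
      with nf have nf: "caseI f' g' \<or> caseII f' g'" by blast
      have "cocycle f' g'" using ext_cocycle_subtract_cob[OF fg idem, of P] by (simp add: P)
      then obtain c where c: "extension R V W (tw c) (\<lambda>x. (x, 0)) snd" "star (tw c) (v, 0) (0, w) f' g'"
        using cocycle_realized by blast
      have "equivalent_ext E i p (tw c) (\<lambda>x. (x, 0)) snd"
        by (rule equivalent_if_cohomologous[OF ext c(1) y snd_conv st c(2) P])
      moreover have "(d1, d2) = (d1', d2')" using nf by (auto simp: case_one_def case_two_def)
      ultimately show ?case using c nf by (metis snd_conv)
    qed
  next
    case 3
    show ?case
      using trivial_iff_coboundary star_cocycle extensionD(1) normal_form_not_coboundary by metis
  next
    case 4
    show ?case
    proof (intro allI impI, goal_cases)
      case nf: (1 f g)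
      have fg: "cocycle f g" by (rule normal_form_cocycle[OF nf])
      obtain c where c: "extension R V W (tw c) (\<lambda>x. (x, 0)) snd" "star (tw c) (v, 0) (0, w) f g"
        using cocycle_realized[OF fg] by blast
      have "\<not> trivial_ext V W (tw c) (\<lambda>x. (x, 0)) snd"
        using trivial_iff_coboundary[OF c(1) snd_conv c(2)] normal_form_not_coboundary[OF fg] nf by blast
      with c show ?case by (metis snd_conv)
    qed
  next
    case 5
    show ?case
    proof (intro impI conjI)
      assume *: "(d1, d2) = (1, 0) \<and> (d1', d2') = (1, 0) \<and> \<beta> = \<beta>'"
      show "dim_Ext_eq R W V 2" if "\<alpha>' = \<alpha>" using * that by (intro dim_Ext_two) auto
      assume "\<alpha>' - \<alpha> \<in> {2, 3, 4} \<or> (\<alpha>' = 1 \<and> \<alpha> = -4) \<or> subcase_vi \<alpha> \<alpha>'"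
      then consider "\<alpha>' = \<alpha> + of_nat 2" | "\<alpha>' = \<alpha> + of_nat 3" | "\<alpha>' = \<alpha> + of_nat 4"
        | "\<alpha>' = \<alpha> + of_nat 5" "\<alpha> = -4" | "\<alpha>' = \<alpha> + of_nat 6" "2 * \<alpha>\<^sup>2 + 10 * \<alpha> + 3 = 0"
        unfolding subcase_vi_iff by (auto simp: algebra_simps)
      then obtain n e where "std_cocycle \<alpha> n e" "\<alpha>' = \<alpha> + of_nat n"
        unfolding std_cocycle_def by metis
      then show "dim_Ext_eq R W V 1" using * by (intro dim_Ext_one) auto
    qed
  next
    case 6
    show ?case using Ext_infinite by auto
  qed
qed

end
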